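(* Let $E$ be either $\mathbb{Q}$ or an imaginary quadratic field with class number $1$, with ring of integers $\mathcal O$. Then, as $s\to\infty$, $$\phi^*_{\mathcal O}(s)\ \ge\ \left(\frac{\ln s}{(4+4\sqrt 2)\sqrt{\beta_E}}\right)^2(1+o(1)).$$
   Context: Let $*$ be the nontrivial automorphism of $E$ if $E\neq\mathbb{Q}$, and the identity if $E=\mathbb{Q}$. A hermitian form in $x_1,\dots,x_n$ over $E$ is $f=\sum_{i,j}a_{ij}x_ix_j^*$ with $a_{ij}=a_{ji}^*\in E$; it is integral if all $a_{ij}\in\mathcal O$. For a linear form $\ell=\sum a_ix_i$, $N(\ell)=(\sum a_ix_i)(\sum a_i^*x_i^* )$. A form $f$ is a sum of norms if $f=\sum_{k=1}^r N(\ell_k)$ for some $r$ and linear forms $\ell_k$ with coefficients in $\mathcal O$ (for $E=\mathbb Q$: a sum of squares of integral linear forms). For a positive integer $s$, $\phi^*_{\mathcal O}(s)$ is the smallest positive integer $n$ such that there exists a positive definite integral hermitian form $f$ in $n$ variables for which $sf$ is not a sum of norms. Here $\beta_E:=\sup_{x\in E}\inf_{c\in\mathcal O}|N_{E/\mathbb Q}(x-c)|^{1/[E:\mathbb Q]}$. *)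

theory Defs
  imports
    "HOL-Analysis.Analysis"
    "HOL-Computational_Algebra.Computational_Algebra"
    "HOL-Algebra.Ideal"
    "HOL-Library.Landau_Symbols"
    "HOL-Library.Extended_Real"
begin

text \<open>
  Number fields are taken as subfields of the complex numbers.  The involution on the field is
  then complex conjugation \<^const>\<open>cnj\<close>: it is the identity on the rationals, and on an imaginary
  quadratic field it is the unique nontrivial automorphism
  (lemmas \<open>cnj_Rats\<close>, \<open>cnj_imaginary_quadratic\<close> and \<open>imaginary_quadratic_aut_unique\<close> below).
\<close>

definition imaginary_quadratic_field :: "complex set \<Rightarrow> bool" where
  "imaginary_quadratic_field E \<longleftrightarrow>
     (\<exists>d::nat. squarefree d \<and>
        E = {of_rat a + of_rat b * (\<i> * of_real (sqrt (real d))) | a b. True})"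

definition ring_of_integers :: "complex set \<Rightarrow> complex set" where
  "ring_of_integers E = {x \<in> E. algebraic_int x}"

definition integer_ring :: "complex set \<Rightarrow> complex ring" where
  "integer_ring E =
     \<lparr>carrier = ring_of_integers E, monoid.mult = (*), one = 1, zero = 0, add = (+)\<rparr>"

definition nonzero_ideals :: "complex set \<Rightarrow> complex set set" where
  "nonzero_ideals E = {I. ideal I (integer_ring E) \<and> I \<noteq> {0}}"

definition ideal_equivalence :: "complex set \<Rightarrow> (complex set \<times> complex set) set" where
  "ideal_equivalence E =
     {(I, J). I \<in> nonzero_ideals E \<and> J \<in> nonzero_ideals E \<and>
        (\<exists>a \<in> ring_of_integers E - {0}. \<exists>b \<in> ring_of_integers E - {0}. (*) a ` I = (*) b ` J)}"

definition class_number :: "complex set \<Rightarrow> nat" where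
  "class_number E = card (nonzero_ideals E // ideal_equivalence E)"

definition field_degree :: "complex set \<Rightarrow> nat" where
  "field_degree E = vector_space.dim (\<lambda>(q::rat) (x::complex). of_rat q * x) E"

text \<open>The norm of the field over the rationals, for the rationals themselves or an imaginary
  quadratic field.\<close>

definition field_norm :: "complex set \<Rightarrow> complex \<Rightarrow> complex" where
  "field_norm E x = (if E = \<rat> then x else x * cnj x)"

definition beta :: "complex set \<Rightarrow> real" where
  "beta E = (SUP x\<in>E. INF c\<in>ring_of_integers E.
               cmod (field_norm E (x - c)) powr (1 / real (field_degree E)))"

text \<open>
  A form in \<open>n\<close> variables is given by its coefficients \<open>a i j\<close> with \<open>i, j < n\<close>, a linear form by
  its coefficients \<open>l i\<close> with \<open>i < n\<close>; values of these functions at other indices are irrelevant.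
\<close>

definition vectors :: "complex set \<Rightarrow> nat \<Rightarrow> (nat \<Rightarrow> complex) set" where
  "vectors E n = {x. \<forall>i<n. x i \<in> E}"

definition form_eval :: "nat \<Rightarrow> (nat \<Rightarrow> nat \<Rightarrow> complex) \<Rightarrow> (nat \<Rightarrow> complex) \<Rightarrow> complex" where
  "form_eval n a x = (\<Sum>i<n. \<Sum>j<n. a i j * x i * cnj (x j))"

definition hermitian_form :: "complex set \<Rightarrow> nat \<Rightarrow> (nat \<Rightarrow> nat \<Rightarrow> complex) \<Rightarrow> bool" where
  "hermitian_form E n a \<longleftrightarrow> (\<forall>i<n. \<forall>j<n. a i j \<in> E \<and> a i j = cnj (a j i))"

definition integral_form :: "complex set \<Rightarrow> nat \<Rightarrow> (nat \<Rightarrow> nat \<Rightarrow> complex) \<Rightarrow> bool" where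
  "integral_form E n a \<longleftrightarrow> (\<forall>i<n. \<forall>j<n. a i j \<in> ring_of_integers E)"

text \<open>Hermitian forms take real values (lemma \<open>Im_form_eval\<close>).\<close>

definition pos_def_form :: "complex set \<Rightarrow> nat \<Rightarrow> (nat \<Rightarrow> nat \<Rightarrow> complex) \<Rightarrow> bool" where
  "pos_def_form E n a \<longleftrightarrow>
     (\<forall>x \<in> vectors E n. (\<exists>i<n. x i \<noteq> 0) \<longrightarrow> Re (form_eval n a x) > 0)"

definition norm_linear_form :: "nat \<Rightarrow> (nat \<Rightarrow> complex) \<Rightarrow> (nat \<Rightarrow> complex) \<Rightarrow> complex" where
  "norm_linear_form n l x = (\<Sum>i<n. l i * x i) * (\<Sum>i<n. cnj (l i) * cnj (x i))"

text \<open>Equality of forms is equality of the functions they define on \<open>E\<close>; as \<open>E\<close> has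
  characteristic 0, it is the same as equality of the hermitian coefficient matrices.\<close>

definition sum_of_norms :: "complex set \<Rightarrow> nat \<Rightarrow> (nat \<Rightarrow> nat \<Rightarrow> complex) \<Rightarrow> bool" where
  "sum_of_norms E n a \<longleftrightarrow>
     (\<exists>(r::nat) l. (\<forall>k<r. \<forall>i<n. l k i \<in> ring_of_integers E) \<and>
        (\<forall>x \<in> vectors E n. form_eval n a x = (\<Sum>k<r. norm_linear_form n (l k) x)))"

text \<open>The value is \<open>\<infinity>\<close> if no such \<open>n\<close> exists.\<close>

definition phi_star :: "complex set \<Rightarrow> nat \<Rightarrow> enat" where
  "phi_star E s =
     Inf {enat n | n. n \<ge> 1 \<and>
        (\<exists>a. hermitian_form E n a \<and> integral_form E n a \<and> pos_def_form E n a \<and>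
             \<not> sum_of_norms E n (\<lambda>i j. of_nat s * a i j))}"


lemma cnj_Rats: "x \<in> \<rat> \<Longrightarrow> cnj x = x"
proof -
  assume "x \<in> \<rat>"
  then obtain m n :: int where "x = of_int m / of_int n" by (auto elim: Rats_cases')
  thus "cnj x = x" by simp
qed

lemma cnj_of_rat [simp]: "cnj (of_rat a) = of_rat a"
  by (simp add: cnj_Rats)

lemma imaginary_quadratic_fieldE:
  assumes "imaginary_quadratic_field E"
  obtains w where "w \<noteq> 0" "cnj w = - w" "w * w \<in> \<rat>"
    "E = {of_rat a + of_rat b * w | a b. True}"
proof -
  obtain d :: nat where d: "squarefree d"
    "E = {of_rat a + of_rat b * (\<i> * of_real (sqrt (real d))) | a b. True}"
    using assms unfolding imaginary_quadratic_field_def by blast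
  have "d \<noteq> 0" using d(1) by (metis not_squarefree_0)
  have "complex_of_real (sqrt (real d)) * complex_of_real (sqrt (real d)) = of_nat d"
    by (simp flip: of_real_mult)
  hence "(\<i> * of_real (sqrt (real d))) * (\<i> * of_real (sqrt (real d))) = - (of_nat d :: complex)"
    by (simp add: mult.assoc mult.left_commute)
  hence "(\<i> * of_real (sqrt (real d))) * (\<i> * of_real (sqrt (real d))) \<in> (\<rat> :: complex set)"
    by (metis Rats_minus_iff Rats_of_nat)
  thus ?thesis using that[of "\<i> * of_real (sqrt (real d))", OF _ _ _ d(2)] \<open>d \<noteq> 0\<close> by simp
qed

lemma cnj_imaginary_quadratic:
  assumes "imaginary_quadratic_field E"
  shows "bij_betw cnj E E" and "\<exists>x\<in>E. cnj x \<noteq> x"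
proof -
  obtain w where w: "w \<noteq> 0" "cnj w = - w" "E = {of_rat a + of_rat b * w | a b. True}"
    using imaginary_quadratic_fieldE[OF assms] by metis
  have cl: "cnj x \<in> E" if "x \<in> E" for x
  proof -
    obtain a b where "x = of_rat a + of_rat b * w" using \<open>x \<in> E\<close> w(3) by auto
    hence "cnj x = of_rat a + of_rat (- b) * w" using w(2) by (simp add: of_rat_minus)
    thus ?thesis using w(3) by blast
  qed
  show "bij_betw cnj E E"
    by (rule bij_betw_byWitness[where f' = cnj]) (auto simp: cl)
  have "w = of_rat 0 + of_rat 1 * w" by simp
  hence "w \<in> E" using w(3) by blast
  thus "\<exists>x\<in>E. cnj x \<noteq> x" using w by (intro bexI[of _ w]) auto
qed

lemma imaginary_quadratic_aut_unique:
  fixes \<sigma> :: "complex \<Rightarrow> complex"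
  assumes E: "imaginary_quadratic_field E" and bij: "bij_betw \<sigma> E E"
    and add: "\<And>x y. x \<in> E \<Longrightarrow> y \<in> E \<Longrightarrow> \<sigma> (x + y) = \<sigma> x + \<sigma> y"
    and mult: "\<And>x y. x \<in> E \<Longrightarrow> y \<in> E \<Longrightarrow> \<sigma> (x * y) = \<sigma> x * \<sigma> y"
    and nontrivial: "\<exists>x\<in>E. \<sigma> x \<noteq> x" and x: "x \<in> E"
  shows "\<sigma> x = cnj x"
proof -
  obtain w where w: "w \<noteq> 0" "cnj w = - w" "w * w \<in> \<rat>" "E = {of_rat a + of_rat b * w | a b. True}"
    using imaginary_quadratic_fieldE[OF E] .
  have rE: "of_rat q \<in> E" for q
    unfolding w(4) by (rule CollectI, rule exI[of _ q], rule exI[of _ 0]) simp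
  have wE: "w \<in> E"
    unfolding w(4) by (rule CollectI, rule exI[of _ 0], rule exI[of _ 1]) simp
  have s0: "\<sigma> 0 = 0" using add[of 0 0] rE[of 0] by simp
  have "\<sigma> 1 \<noteq> \<sigma> 0"
    using bij rE[of 0] rE[of 1] by (auto simp: bij_betw_def dest: inj_onD)
  hence s1: "\<sigma> 1 = 1" using mult[of 1 1] rE[of 1] s0 by simp
  have snat: "\<sigma> (of_nat n) = of_nat n" for n
  proof (induction n)
    case (Suc n)
    have "(of_nat n :: complex) \<in> E" using rE[of "of_nat n"] by simp
    thus ?case using add[of 1 "of_nat n"] rE[of 1] Suc s1 by simp
  qed (simp add: s0)
  have sint: "\<sigma> (of_int k) = of_int k" for k
  proof (cases "k \<ge> 0")
    case True
    thus ?thesis using snat[of "nat k"] by simp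
  next
    case False
    have "\<sigma> (of_int k + of_int (- k)) = \<sigma> (of_int k) + \<sigma> (of_int (- k))"
      using rE[of "of_int k"] rE[of "of_int (- k)"] by (intro add) (simp_all add: of_rat_minus)
    moreover have "\<sigma> (of_int (- k)) = of_int (- k)" using snat[of "nat (- k)"] False by simp
    ultimately show ?thesis using s0 by (simp add: add_eq_0_iff)
  qed
  have srat: "\<sigma> (of_rat q) = of_rat q" for q
  proof (cases q)
    case (Fract m n)
    have "\<sigma> (of_rat q * of_int n) = \<sigma> (of_rat q) * \<sigma> (of_int n)"
      using rE[of q] rE[of "of_int n"] by (intro mult) simp_all
    moreover have "of_rat q * of_int n = (of_int m :: complex)"
      using Fract by (simp add: of_rat_rat)
    ultimately show ?thesis using Fract by (simp add: sint of_rat_rat field_simps)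
  qed
  have s: "\<sigma> (of_rat a + of_rat b * w) = of_rat a + of_rat b * \<sigma> w" for a b
  proof -
    have "of_rat b * w \<in> E"
      unfolding w(4) by (rule CollectI, rule exI[of _ 0], rule exI[of _ b]) simp
    thus ?thesis using add[OF rE[of a]] mult[OF rE[of b] wE] by (simp add: srat)
  qed
  have "\<sigma> w * \<sigma> w = w * w"
    using mult[OF wE wE] w(3) srat by (auto elim!: Rats_cases)
  hence "\<sigma> w = w \<or> \<sigma> w = - w" by (simp add: square_eq_iff)
  moreover have "\<sigma> w \<noteq> w"
  proof
    assume "\<sigma> w = w"
    hence "\<sigma> y = y" if "y \<in> E" for y using that s w(4) by auto
    thus False using nontrivial by blast
  qed
  ultimately have "\<sigma> w = cnj w" using w(2) by simp
  thus ?thesis using x s w(4) by auto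
qed

lemma ring_of_integers_Rats: "ring_of_integers \<rat> = \<int>"
  using rational_algebraic_int_is_int int_imp_algebraic_int Ints_subset_Rats
  by (auto simp: ring_of_integers_def)

lemma Im_form_eval:
  assumes "hermitian_form E n a"
  shows "Im (form_eval n a x) = 0"
proof -
  have a: "cnj (a i j) = a j i" if "i < n" "j < n" for i j
    using assms that by (metis hermitian_form_def)
  have "cnj (form_eval n a x) = (\<Sum>i<n. \<Sum>j<n. a j i * x j * cnj (x i))"
    unfolding form_eval_def cnj_sum
    by (intro sum.cong refl) (simp add: a)
  also have "\<dots> = form_eval n a x"
    unfolding form_eval_def by (rule sum.swap)
  finally show ?thesis by (simp add: complex_eq_iff)
qed

lemma vector_space_rat: "vector_space (\<lambda>(q::rat) (x::complex). of_rat q * x)"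
  by unfold_locales (simp_all add: algebra_simps of_rat_add of_rat_mult)

lemma field_degree_Rats: "field_degree \<rat> = 1"
proof -
  interpret Q: vector_space "\<lambda>(q::rat) (x::complex). of_rat q * x" by (rule vector_space_rat)
  have "Q.dim \<rat> = 1"
  proof (rule Q.dim_unique[of "{1}"])
    show "\<rat> \<subseteq> Q.span {1}" by (auto simp: Q.span_singleton elim!: Rats_cases)
  qed (auto simp: Q.dependent_single)
  thus ?thesis by (simp add: field_degree_def)
qed

lemma field_degree_imaginary_quadratic:
  assumes "imaginary_quadratic_field E"
  shows "field_degree E = 2"
proof -
  interpret Q: vector_space "\<lambda>(q::rat) (x::complex). of_rat q * x" by (rule vector_space_rat)
  obtain w where w: "w \<noteq> 0" "cnj w = - w" "E = {of_rat a + of_rat b * w | a b. True}"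
    using imaginary_quadratic_fieldE[OF assms] by metis
  have nw: "w \<noteq> of_rat q" for q
  proof
    assume "w = of_rat q"
    hence "w = - w" using w(2) by (metis cnj_of_rat)
    thus False using w(1) by simp
  qed
  have "Q.dim E = 2"
  proof (rule Q.dim_unique[of "{w, 1}"])
    have "w = of_rat 0 + of_rat 1 * w" "1 = of_rat 1 + of_rat 0 * w" by simp_all
    thus "{w, 1} \<subseteq> E" unfolding w(3) by blast
    show "E \<subseteq> Q.span {w, 1}"
    proof
      fix x assume "x \<in> E"
      then obtain a b where x: "x = of_rat a * 1 + of_rat b * w" unfolding w(3) by auto
      show "x \<in> Q.span {w, 1}"
        unfolding x by (rule Q.span_add; rule Q.span_scale; rule Q.span_base) simp_all
    qed
    show "Q.independent {w, 1}"
      using nw by (auto simp: Q.independent_insert Q.dependent_single Q.span_singleton)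
    show "card {w, 1} = 2" using nw[of 1] by simp
  qed
  thus ?thesis by (simp add: field_degree_def)
qed

end

theory Submission
  imports Defs "HOL-Real_Asymp.Real_Asymp"
begin

text \<open>
  A much stronger bound holds: in \<open>n\<close> variables it suffices that \<open>s\<close> exceeds
  \<open>exp (c (ln n)\<^sup>2)\<close> for a constant \<open>c\<close> depending on \<open>E\<close>, so the value of \<open>\<beta>\<^sub>E\<close> plays no role.

  As long as \<open>f - N(l)\<close> stays positive definite for some nonzero integral linear form \<open>l\<close>,
  subtract \<open>N(l)\<close>; this terminates because the trace decreases.  What remains is a form whose own
  minimum and whose dual minimum are both at least 1.  In a Hermite-Korkin-Zolotarev basis, which
  exists as \<open>\<O>\<close> is a principal ideal domain, Minkowski's theorem bounds the ratios of the squared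
  Gram-Schmidt lengths \<open>h\<^sub>i\<close> by \<open>exp (c (ln n)\<^sup>2)\<close>, so both minima confine all \<open>h\<^sub>i\<close> to
  \<open>[exp (- c (ln n)\<^sup>2), exp (c (ln n)\<^sup>2)]\<close>.  Seysen's recursive block reduction then makes the
  unipotent part of the Gram-Schmidt decomposition and its inverse equally small.  In the resulting
  basis \<open>f\<close> has coefficients at most \<open>R\<close> and dominates \<open>\<bar>x\<bar>\<^sup>2 / R\<close>.  Writing \<open>s f - \<delta> \<bar>x\<bar>\<^sup>2\<close>, with
  \<open>\<delta>\<close> slightly below \<open>s / R\<close>, as a real sum of norms and rounding the linear forms to \<open>\<O>\<close> costs an error of
  order \<open>\<surd>s\<close>, and for large \<open>s\<close> the integral remainder is diagonally dominant, hence a sum of norms.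
\<close>

section \<open>Rings of integers of imaginary quadratic fields\<close>

text \<open>It has to be shown that n < K (ln s)^2 suffices for a given constant K. Then ln n is
  O(ln ln s), so every loss exp (c (ln n)^2) is only s^(o(1)), whereas a loss exponential in n would
  exceed s. This is why Korkin-Zolotarev bases and the recursive halving of Seysen's method are
  used: both cost n^(O(ln n)), while size reduction one coordinate at a time may let the inverse
  matrix grow exponentially. The bounds between Gram-Schmidt lengths go in one direction only and
  need an anchor at each end. The length of the shortest vector is a positive rational integer; at
  the other end the subtraction of norms yields \<open>h 0 \<le> 1\<close>. The dual minimum itself
  is never computed: 1 / h 0 is the value of the dual form at the first coordinate function, and
  while h 0 > 1 the norm of that function can be subtracted. The real linear forms have coefficients
  up to sqrt (s R), so rounding them leaves errors of order sqrt s against a diagonal of about s /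
  R. A cross term with coefficient g must therefore cost O(|g|) on the diagonal; a cost of |g|^2
  would be too much.\<close>

lemma Ints_if_bounded_power_denominators:
  fixes x :: complex
  assumes x: "x \<in> \<rat>" and N: "N > 0" and pow: "\<And>k. of_nat N * x ^ k \<in> \<int>"
  shows "x \<in> \<int>"
proof -
  from x obtain a b where ab: "b > 0" "Rings.coprime a b" and x_eq: "x = of_int a / of_int b"
    by (auto elim: Rats_cases')
  \<comment> \<open>Every power of the denominator divides the one number N. The exponent N already
    contradicts b >= 2, because N < 2 ^ N.\<close>
  have dvd: "b ^ k dvd int N" for k
  proof -
    obtain c where c: "of_nat N * x ^ k = of_int c" using pow[of k] by (auto elim: Ints_cases)
    have "(of_int (int N * a ^ k) :: complex) = of_int (c * b ^ k)"
      using c ab(1) by (simp add: x_eq field_simps)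
    hence "int N * a ^ k = c * b ^ k" by (simp only: of_int_eq_iff)
    hence "b ^ k dvd int N * a ^ k" by simp
    moreover have "Rings.coprime (b ^ k) (a ^ k)" using ab(2) by (simp add: coprime_commute)
    ultimately show ?thesis by (simp add: coprime_dvd_mult_left_iff)
  qed
  have "b = 1"
  proof (rule ccontr)
    assume "b \<noteq> 1"
    hence "b \<ge> 2" using ab(1) by simp
    hence "2 ^ N \<le> b ^ N" by (intro power_mono) auto
    also have "b ^ N \<le> int N" using dvd[of N] N by (intro zdvd_imp_le) auto
    also have "int N < 2 ^ N" by (simp add: of_nat_less_two_power)
    finally show False by simp
  qed
  thus ?thesis by (simp add: x_eq)
qed

lemma Re_of_rat: "Re (of_rat a) = of_rat a" and Im_of_rat: "Im (of_rat a) = 0"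
  by (cases a; simp add: of_rat_rat)+

section \<open>An order with explicit basis, and bounded denominators of powers\<close>

locale imag_quad =
  fixes d :: nat and E :: "complex set" and w :: complex
  assumes d_pos: "d > 0"
    and w_def: "w = \<i> * of_real (sqrt (real d))"
    and E_def: "E = {of_rat a + of_rat b * w | a b. True}"
begin

text \<open>The order Z + Z w has an explicit basis, so its arithmetic is a computation. The full
  ring of integers can be larger, for example when d = 3.\<close>

definition order :: "complex set" where
  "order = {of_int a + of_int b * w | a b. True}"

lemma w_sq: "w * w = - of_nat d"
proof -
  have "complex_of_real (sqrt (real d)) * complex_of_real (sqrt (real d)) = of_nat d"
    by (simp flip: of_real_mult)
  thus ?thesis by (simp add: w_def mult.assoc mult.left_commute)
qed

lemma cnj_w: "cnj w = - w"
  by (simp add: w_def)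

lemma E_I: "of_rat a + of_rat b * w \<in> E"
  unfolding E_def by blast

lemma E_E: assumes "x \<in> E" obtains a b where "x = of_rat a + of_rat b * w"
  using assms unfolding E_def by blast

lemma order_I: "of_int a + of_int b * w \<in> order"
  unfolding order_def by blast

lemma order_E: assumes "x \<in> order" obtains a b where "x = of_int a + of_int b * w"
  using assms unfolding order_def by blast

lemma Im_E: "Im (of_rat a + of_rat b * w) = of_rat b * sqrt d"
  by (simp add: w_def Re_of_rat Im_of_rat)

lemma Rats_E: "of_rat a \<in> E"
  using E_I[of a 0] by simp

lemma E_0: "0 \<in> E" and E_1: "1 \<in> E"
  using Rats_E[of 0] Rats_E[of 1] by auto

lemma E_add: assumes "x \<in> E" "y \<in> E" shows "x + y \<in> E"
proof -
  obtain a b a' b' where "x = of_rat a + of_rat b * w" "y = of_rat a' + of_rat b' * w"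
    using assms by (elim E_E)
  hence "x + y = of_rat (a + a') + of_rat (b + b') * w" by (simp add: of_rat_add algebra_simps)
  thus ?thesis using E_I by simp
qed

lemma E_mult: assumes "x \<in> E" "y \<in> E" shows "x * y \<in> E"
proof -
  obtain a b a' b' where xy: "x = of_rat a + of_rat b * w" "y = of_rat a' + of_rat b' * w"
    using assms by (elim E_E)
  have "x * y = of_rat a * of_rat a' + of_rat b * of_rat b' * (w * w)
      + (of_rat a * of_rat b' + of_rat a' * of_rat b) * w"
    by (simp add: xy algebra_simps)
  also have "\<dots> = of_rat (a * a' - b * b' * of_nat d) + of_rat (a * b' + a' * b) * w"
    unfolding w_sq by (simp add: of_rat_add of_rat_mult of_rat_diff)
  finally show ?thesis using E_I by simp
qed

lemma E_minus: assumes "x \<in> E" shows "- x \<in> E"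
  using E_mult[OF Rats_E[of "-1"] assms] by (simp add: of_rat_minus)

lemma E_cnj: assumes "x \<in> E" shows "cnj x \<in> E"
proof -
  obtain a b where x: "x = of_rat a + of_rat b * w" using assms by (elim E_E)
  have "cnj x = of_rat a + of_rat (- b) * w" by (simp add: x cnj_w of_rat_minus)
  thus ?thesis using E_I by simp
qed

lemma E_real: assumes "x \<in> E" "Im x = 0" shows "x \<in> \<rat>"
proof -
  obtain a b where x: "x = of_rat a + of_rat b * w" using assms by (elim E_E)
  have "of_rat b * sqrt d = 0" using assms(2) unfolding x Im_E .
  hence "b = 0" using d_pos by simp
  thus ?thesis by (simp add: x)
qed

lemma E_inverse: assumes "x \<in> E" shows "inverse x \<in> E"
proof -
  have "x * cnj x \<in> \<rat>" using E_mult[OF assms E_cnj[OF assms]] by (intro E_real) auto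
  hence "inverse (x * cnj x) \<in> E" using Rats_E by (metis Rats_cases Rats_inverse)
  hence "cnj x * inverse (x * cnj x) \<in> E" using E_mult E_cnj assms by blast
  moreover have "cnj x * inverse (x * cnj x) = inverse x" by (cases "x = 0") (auto simp: field_simps)
  ultimately show ?thesis by metis
qed

lemma order_add: assumes "x \<in> order" "y \<in> order" shows "x + y \<in> order"
proof -
  obtain a b a' b' where "x = of_int a + of_int b * w" "y = of_int a' + of_int b' * w"
    using assms by (elim order_E)
  hence "x + y = of_int (a + a') + of_int (b + b') * w" by (simp add: algebra_simps)
  thus ?thesis using order_I by (simp only:)
qed

lemma order_mult: assumes "x \<in> order" "y \<in> order" shows "x * y \<in> order"
proof -
  obtain a b a' b' where xy: "x = of_int a + of_int b * w" "y = of_int a' + of_int b' * w"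
    using assms by (elim order_E)
  have "x * y = of_int a * of_int a' + of_int b * of_int b' * (w * w)
      + (of_int a * of_int b' + of_int a' * of_int b) * w"
    by (simp add: xy algebra_simps)
  also have "\<dots> = of_int (a * a' - b * b' * int d) + of_int (a * b' + a' * b) * w"
    unfolding w_sq by simp
  finally show ?thesis using order_I by (simp only:)
qed

lemma order_Ints: "of_int a \<in> order"
  using order_I[of a 0] by simp

lemma order_minus: assumes "x \<in> order" shows "- x \<in> order"
  using order_mult[OF order_Ints[of "-1"] assms] by simp

lemma order_cnj: assumes "x \<in> order" shows "cnj x \<in> order"
proof -
  obtain a b where x: "x = of_int a + of_int b * w" using assms by (elim order_E)
  have "cnj x = of_int a + of_int (- b) * w" by (simp add: x cnj_w)
  thus ?thesis using order_I by (simp only:)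
qed

lemma order_sum: assumes "\<And>i. i \<in> S \<Longrightarrow> f i \<in> order" shows "sum f S \<in> order"
  using assms order_Ints[of 0] by (induction S rule: infinite_finite_induct) (auto intro: order_add)

lemma order_real: assumes "x \<in> order" "Im x = 0" shows "x \<in> \<int>"
proof -
  obtain a b where x: "x = of_int a + of_int b * w" using assms by (elim order_E)
  have "of_int b * sqrt d = 0" using assms(2) unfolding x by (simp add: w_def)
  hence "b = 0" using d_pos by simp
  thus ?thesis by (simp add: x)
qed

lemma ex_denominator_order:
  assumes "x \<in> E" shows "\<exists>N>0. of_nat N * x \<in> order"
proof -
  obtain a b where x: "x = of_rat a + of_rat b * w" using assms by (elim E_E)
  obtain p q where pq: "a = of_int p / of_int q" "q > 0"
    by (cases "quotient_of a") (use quotient_of_div quotient_of_denom_pos in blast)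
  obtain p' q' where pq': "b = of_int p' / of_int q'" "q' > 0"
    by (cases "quotient_of b") (use quotient_of_div quotient_of_denom_pos in blast)
  have "(of_nat (nat (q * q')) :: complex) = of_int (q * q')"
    using pq(2) pq'(2) by simp
  hence "of_nat (nat (q * q')) * x = of_int (q * q') * x"
    by (simp only:)
  also have "\<dots> = of_int (p * q') + of_int (p' * q) * w"
    using pq(2) pq'(2) by (simp add: x pq(1) pq'(1) of_rat_divide field_simps)
  also have "\<dots> \<in> order" by (rule order_I)
  finally have "of_nat (nat (q * q')) * x \<in> order" .
  thus ?thesis using pq(2) pq'(2) by (intro exI[of _ "nat (q * q')"]) (simp add: mult_pos_pos)
qed

text \<open>An element is integral iff its powers have a common denominator; in this form closure under
  sums and products is immediate.\<close>

definition bounded_powers :: "complex \<Rightarrow> bool" where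
  "bounded_powers x \<longleftrightarrow> (\<exists>N>0. \<forall>k. of_nat N * x ^ k \<in> order)"

text \<open>The product of the denominators of the powers below the degree serves for all powers,
  because the monic equation rewrites each higher power as an integral combination of lower
  ones.\<close>

lemma bounded_powers_algebraic_int:
  assumes x: "x \<in> E" and "algebraic_int x"
  shows "bounded_powers x"
proof -
  obtain p where p: "lead_coeff p = 1" "\<forall>i. coeff p i \<in> \<int>" "poly p x = 0"
    using assms(2) by (auto elim: algebraic_int.cases)
  define m where "m = degree p"
  have xk: "x ^ k \<in> E" for k
    by (induction k) (auto intro: E_1 E_mult x)
  have "\<exists>N. \<forall>k. N k > 0 \<and> of_nat (N k) * x ^ k \<in> order"
    using ex_denominator_order[OF xk] by metis
  then obtain N where N: "\<And>k. N k > 0" "\<And>k. of_nat (N k) * x ^ k \<in> order" by metis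
  define M where "M = (\<Prod>k<m. N k)"
  have M: "of_nat M * x ^ k \<in> order" for k
  proof (induction k rule: less_induct)
    case (less k)
    show ?case
    proof (cases "k < m")
      case True
      hence "M = (\<Prod>i\<in>{..<m} - {k}. N i) * N k"
        unfolding M_def by (subst prod.remove[of _ k]) auto
      hence "of_nat M * x ^ k = of_int (int (\<Prod>i\<in>{..<m} - {k}. N i)) * (of_nat (N k) * x ^ k)"
        by simp
      also have "\<dots> \<in> order" by (rule order_mult[OF order_Ints N(2)])
      finally show ?thesis .
    next
      case False
      have "0 = (\<Sum>i\<le>m. coeff p i * x ^ i)" using p(3) by (simp add: poly_altdef m_def)
      also have "\<dots> = (\<Sum>i<m. coeff p i * x ^ i) + x ^ m"
        using p(1) by (simp add: lessThan_Suc_atMost [symmetric] m_def)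
      finally have xm: "x ^ m = - (\<Sum>i<m. coeff p i * x ^ i)" by (simp add: eq_neg_iff_add_eq_0 add.commute)
      have "x ^ k = x ^ m * x ^ (k - m)" using False by (simp flip: power_add)
      also have "\<dots> = - (\<Sum>i<m. coeff p i * x ^ (i + (k - m)))"
        unfolding xm by (simp add: sum_distrib_right power_add mult.assoc)
      finally have "of_nat M * x ^ k = - (\<Sum>i<m. coeff p i * (of_nat M * x ^ (i + (k - m))))"
        by (simp add: sum_distrib_left algebra_simps)
      also have "\<dots> \<in> order"
      proof (intro order_minus order_sum)
        fix i assume i: "i \<in> {..<m}"
        hence "of_nat M * x ^ (i + (k - m)) \<in> order" using False by (intro less) auto
        moreover have "coeff p i \<in> order" using p(2)[rule_format, of i] order_Ints by (auto elim: Ints_cases)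
        ultimately show "coeff p i * (of_nat M * x ^ (i + (k - m))) \<in> order" by (rule order_mult[rotated])
      qed
      finally show ?thesis .
    qed
  qed
  have "M > 0" unfolding M_def using N(1) by (auto intro: prod_pos)
  thus ?thesis using M unfolding bounded_powers_def by blast
qed

lemma bounded_powers_mult:
  assumes "bounded_powers x" "bounded_powers y" shows "bounded_powers (x * y)"
proof -
  obtain N M where NM: "N > 0" "\<And>k. of_nat N * x ^ k \<in> order" "M > 0" "\<And>k. of_nat M * y ^ k \<in> order"
    using assms unfolding bounded_powers_def by blast
  have "of_nat (N * M) * (x * y) ^ k \<in> order" for k
    using order_mult[OF NM(2)[of k] NM(4)[of k]] by (simp add: power_mult_distrib mult_ac)
  thus ?thesis unfolding bounded_powers_def using NM(1,3) by (intro exI[of _ "N * M"]) auto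
qed

lemma bounded_powers_add:
  assumes "bounded_powers x" "bounded_powers y" shows "bounded_powers (x + y)"
proof -
  obtain N M where NM: "N > 0" "\<And>k. of_nat N * x ^ k \<in> order" "M > 0" "\<And>k. of_nat M * y ^ k \<in> order"
    using assms unfolding bounded_powers_def by blast
  have "of_nat (N * M) * (x + y) ^ k \<in> order" for k
  proof -
    have "of_nat (N * M) * (x + y) ^ k
        = (\<Sum>j\<le>k. of_int (int (k choose j)) * ((of_nat N * x ^ j) * (of_nat M * y ^ (k - j))))"
      by (simp add: binomial_ring sum_distrib_left mult_ac)
    also have "\<dots> \<in> order"
      by (intro order_sum order_mult order_Ints NM)
    finally show ?thesis .
  qed
  thus ?thesis unfolding bounded_powers_def using NM(1,3) by (intro exI[of _ "N * M"]) auto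
qed

lemma bounded_powers_cnj:
  assumes "bounded_powers x" shows "bounded_powers (cnj x)"
proof -
  obtain N where N: "N > 0" "\<And>k. of_nat N * x ^ k \<in> order"
    using assms unfolding bounded_powers_def by blast
  have "of_nat N * cnj x ^ k \<in> order" for k
    using order_cnj[OF N(2)[of k]] by simp
  thus ?thesis unfolding bounded_powers_def using N(1) by blast
qed

lemma bounded_powers_real:
  assumes "bounded_powers x" "x \<in> E" "Im x = 0" shows "x \<in> \<int>"
proof -
  obtain N where N: "N > 0" "\<And>k. of_nat N * x ^ k \<in> order"
    using assms unfolding bounded_powers_def by blast
  have xr: "x = of_real (Re x)" using assms(3) by (simp add: complex_eq_iff)
  have "Im (x ^ k) = 0" for k by (subst xr) (simp flip: of_real_power)
  hence "of_nat N * x ^ k \<in> \<int>" for k by (intro order_real N) simp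
  thus ?thesis using Ints_if_bounded_power_denominators[OF E_real[OF assms(2,3)] N(1)] by blast
qed

text \<open>For the converse, the trace and the norm of \<open>x\<close> are real and again have
  bounded powers, so they are rational integers, and \<open>x\<close> is a root of the monic
  quadratic that they define.\<close>

lemma algebraic_int_iff_bounded_powers:
  assumes x: "x \<in> E"
  shows "algebraic_int x \<longleftrightarrow> bounded_powers x"
proof
  assume b: "bounded_powers x"
  have "x * cnj x \<in> \<int>"
    by (intro bounded_powers_real bounded_powers_mult bounded_powers_cnj b E_mult E_cnj x) simp
  moreover have "- (x + cnj x) \<in> \<int>"
    by (rule Ints_minus) (intro bounded_powers_real bounded_powers_add bounded_powers_cnj b E_add E_cnj x, simp)
  ultimately have "\<forall>i. coeff [: x * cnj x, - (x + cnj x), 1 :] i \<in> \<int>"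
    by (simp add: coeff_pCons del: minus_add_distrib split: nat.splits)
  thus "algebraic_int x"
    by (intro algebraic_int.intros[of "[: x * cnj x, - (x + cnj x), 1 :]"]) (auto simp: algebra_simps)
qed (use bounded_powers_algebraic_int x in blast)

lemma integers_iff: "x \<in> ring_of_integers E \<longleftrightarrow> x \<in> E \<and> bounded_powers x"
  unfolding ring_of_integers_def using algebraic_int_iff_bounded_powers by blast

lemma order_subset: "order \<subseteq> ring_of_integers E"
proof
  fix x assume x: "x \<in> order"
  then obtain a b where ab: "x = of_int a + of_int b * w" by (elim order_E)
  have "x \<in> E" using E_I[of "of_int a" "of_int b"] by (simp add: ab)
  moreover have "x ^ k \<in> order" for k
  proof (induction k)
    case 0
    show ?case using order_Ints[of 1] by simp
  next
    case (Suc k)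
    thus ?case using order_mult[OF x Suc] by simp
  qed
  hence "bounded_powers x" unfolding bounded_powers_def by (intro exI[of _ 1]) auto
  ultimately show "x \<in> ring_of_integers E" by (simp add: integers_iff)
qed

lemma w_integer: "w \<in> ring_of_integers E"
  using order_I[of 0 1] order_subset by auto

end

section \<open>Linear forms, hermitian forms and lattice automorphisms\<close>

text \<open>The closure that composing linear maps requires. The field and its ring of integers are
  the two instances.\<close>

definition subsemiring :: "complex set \<Rightarrow> bool" where
  "subsemiring S \<longleftrightarrow> 0 \<in> S \<and> 1 \<in> S \<and> (\<forall>x\<in>S. \<forall>y\<in>S. x + y \<in> S \<and> x * y \<in> S)"

lemma subsemiring_mult: "subsemiring S \<Longrightarrow> x \<in> S \<Longrightarrow> y \<in> S \<Longrightarrow> x * y \<in> S"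
  by (simp add: subsemiring_def)

lemma subsemiring_sum:
  assumes "subsemiring S" "\<And>i. i \<in> I \<Longrightarrow> f i \<in> S" shows "sum f I \<in> S"
  using assms by (induction I rule: infinite_finite_induct) (auto simp: subsemiring_def)

text \<open>Linear forms are functions instead of coefficient lists, so that a change of basis is
  composition. Such a function ignores the entries of its argument from index n on.\<close>

definition linear_over :: "complex set \<Rightarrow> nat \<Rightarrow> ((nat \<Rightarrow> complex) \<Rightarrow> complex) \<Rightarrow> bool" where
  "linear_over S n \<phi> \<longleftrightarrow> (\<exists>c. (\<forall>j<n. c j \<in> S) \<and> \<phi> = (\<lambda>x. \<Sum>j<n. c j * x j))"

lemma linear_overI:
  assumes "\<And>j. j < n \<Longrightarrow> c j \<in> S" "\<And>x. \<phi> x = (\<Sum>j<n. c j * x j)"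
  shows "linear_over S n \<phi>"
  unfolding linear_over_def using assms by (intro exI[of _ c]) auto

lemma linear_overE:
  assumes "linear_over S n \<phi>"
  obtains c where "\<And>j. j < n \<Longrightarrow> c j \<in> S" "\<And>x. \<phi> x = (\<Sum>j<n. c j * x j)"
  using assms unfolding linear_over_def by auto

lemma linear_over_cong:
  assumes "linear_over S n \<phi>" "\<And>i. i < n \<Longrightarrow> x i = y i"
  shows "\<phi> x = \<phi> y"
  using assms(1) by (elim linear_overE) (simp add: assms(2))

lemma linear_over_zero:
  assumes "linear_over S n \<phi>" "\<And>i. i < n \<Longrightarrow> x i = 0"
  shows "\<phi> x = 0"
  using assms(1) by (elim linear_overE) (simp add: assms(2))

lemma linear_over_subset:
  assumes "linear_over S n \<phi>" "S \<subseteq> T" shows "linear_over T n \<phi>"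
  using assms unfolding linear_over_def by blast

lemma linear_over_mem:
  assumes "subsemiring S" "linear_over S n \<phi>" "\<And>i. i < n \<Longrightarrow> x i \<in> S"
  shows "\<phi> x \<in> S"
  using assms(2)
proof (elim linear_overE)
  fix c assume c: "\<And>j. j < n \<Longrightarrow> c j \<in> S" "\<And>x. \<phi> x = (\<Sum>j<n. c j * x j)"
  show "\<phi> x \<in> S"
    unfolding c(2) using assms(1,3) c(1)
    by (intro subsemiring_sum) (auto simp: subsemiring_def)
qed

lemma linear_over_coord:
  assumes "subsemiring S" "i < n" shows "linear_over S n (\<lambda>x. x i)"
proof (rule linear_overI[where c = "\<lambda>j. if j = i then 1 else 0"])
  fix x :: "nat \<Rightarrow> complex"
  have "(\<Sum>j<n. (if j = i then 1 else 0) * x j) = (\<Sum>j<n. if j = i then x j else 0)"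
    by (intro sum.cong) auto
  thus "x i = (\<Sum>j<n. (if j = i then 1 else 0) * x j)" using assms(2) by simp
qed (use assms in \<open>auto simp: subsemiring_def\<close>)

lemma linear_over_add:
  assumes "subsemiring S" "linear_over S n \<phi>" "linear_over S n \<psi>"
  shows "linear_over S n (\<lambda>x. \<phi> x + \<psi> x)"
  using assms(2,3)
proof (elim linear_overE)
  fix c c' assume c: "\<And>j. j < n \<Longrightarrow> c j \<in> S" "\<And>x. \<phi> x = (\<Sum>j<n. c j * x j)"
    "\<And>j. j < n \<Longrightarrow> c' j \<in> S" "\<And>x. \<psi> x = (\<Sum>j<n. c' j * x j)"
  show ?thesis
    by (rule linear_overI[where c = "\<lambda>j. c j + c' j"])
       (use assms(1) c in \<open>auto simp: subsemiring_def sum.distrib algebra_simps\<close>)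
qed

lemma linear_over_scale:
  assumes "subsemiring S" "linear_over S n \<phi>" "a \<in> S"
  shows "linear_over S n (\<lambda>x. a * \<phi> x)"
  using assms(2)
proof (elim linear_overE)
  fix c assume c: "\<And>j. j < n \<Longrightarrow> c j \<in> S" "\<And>x. \<phi> x = (\<Sum>j<n. c j * x j)"
  show ?thesis
    by (rule linear_overI[where c = "\<lambda>j. a * c j"])
       (use assms(1,3) c in \<open>auto simp: subsemiring_def sum_distrib_left algebra_simps\<close>)
qed

lemma linear_over_const_0:
  assumes "subsemiring S" shows "linear_over S n (\<lambda>x. 0)"
  by (rule linear_overI[where c = "\<lambda>_. 0"]) (use assms in \<open>auto simp: subsemiring_def\<close>)

lemma linear_over_sum:
  assumes "subsemiring S" "\<And>i. i \<in> I \<Longrightarrow> linear_over S n (\<phi> i)"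
  shows "linear_over S n (\<lambda>x. \<Sum>i\<in>I. \<phi> i x)"
  using assms(2)
  by (induction I rule: infinite_finite_induct)
     (auto intro: linear_over_const_0 linear_over_add assms(1))

lemma linear_over_comp:
  assumes S: "subsemiring S" and \<phi>: "linear_over S n \<phi>"
    and f: "\<And>i. i < n \<Longrightarrow> linear_over S m (\<lambda>x. f x i)"
  shows "linear_over S m (\<lambda>x. \<phi> (f x))"
  using \<phi>
proof (elim linear_overE)
  fix c assume c: "\<And>j. j < n \<Longrightarrow> c j \<in> S" "\<And>x. \<phi> x = (\<Sum>j<n. c j * x j)"
  show ?thesis
    unfolding c(2) by (intro linear_over_sum linear_over_scale S f) (use c in auto)
qed

lemma linear_over_mono:
  assumes "subsemiring S" "linear_over S n \<phi>" "n \<le> m" shows "linear_over S m \<phi>"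
  by (rule linear_over_comp[OF assms(1,2)]) (use assms in \<open>auto intro: linear_over_coord\<close>)

text \<open>The witness is the congruent matrix, with the coefficients of \<open>f\<close> on one
  side and their conjugates on the other. The case S = E serves the Gram-Schmidt decomposition, the
  case of the ring of integers the integral changes of basis.\<close>

lemma form_eval_comp:
  assumes S: "subsemiring S" and cnj: "\<And>x. x \<in> S \<Longrightarrow> cnj x \<in> S"
    and a: "\<And>i j. i < n \<Longrightarrow> j < n \<Longrightarrow> a i j \<in> S \<and> a i j = cnj (a j i)"
    and f: "\<And>i. i < n \<Longrightarrow> linear_over S m (\<lambda>x. f x i)"
  shows "\<exists>a'. (\<forall>i<m. \<forall>j<m. a' i j \<in> S \<and> a' i j = cnj (a' j i)) \<and> (\<forall>x. form_eval n a (f x) = form_eval m a' x)"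
proof -
  have "\<forall>i. \<exists>c. i < n \<longrightarrow> (\<forall>j<m. c j \<in> S) \<and> (\<forall>x. f x i = (\<Sum>j<m. c j * x j))"
  proof
    fix i
    show "\<exists>c. i < n \<longrightarrow> (\<forall>j<m. c j \<in> S) \<and> (\<forall>x. f x i = (\<Sum>j<m. c j * x j))"
    proof (cases "i < n")
      case True
      from f[OF True] obtain c where "\<forall>j<m. c j \<in> S" "(\<lambda>x. f x i) = (\<lambda>x. \<Sum>j<m. c j * x j)"
        unfolding linear_over_def by blast
      thus ?thesis by (intro exI[of _ c]) (simp add: fun_eq_iff)
    qed auto
  qed
  from choice[OF this] obtain c where
    c': "\<forall>i. i < n \<longrightarrow> (\<forall>j<m. c i j \<in> S) \<and> (\<forall>x. f x i = (\<Sum>j<m. c i j * x j))" ..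
  have c: "\<And>i j. i < n \<Longrightarrow> j < m \<Longrightarrow> c i j \<in> S" "\<And>i x. i < n \<Longrightarrow> f x i = (\<Sum>j<m. c i j * x j)"
    using c' by blast+
  define a' where "a' p q = (\<Sum>i<n. \<Sum>j<n. a i j * c i p * cnj (c j q))" for p q
  show ?thesis
  proof (intro exI[of _ a'] conjI[of "\<forall>i<m. _ i"] allI impI)
    fix p q assume pq: "p < m" "q < m"
    have mem: "a' p q \<in> S"
      unfolding a'_def
    proof (intro subsemiring_sum S)
      fix i j assume ij: "i \<in> {..<n}" "j \<in> {..<n}"
      hence "a i j \<in> S" "c i p \<in> S" "cnj (c j q) \<in> S" by (auto intro!: a[THEN conjunct1] c(1) cnj pq)
      thus "a i j * c i p * cnj (c j q) \<in> S" by (intro subsemiring_mult[OF S])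
    qed
    have "cnj (a' q p) = (\<Sum>i<n. \<Sum>j<n. cnj (a i j) * cnj (c i q) * c j p)"
      by (simp only: a'_def cnj_sum complex_cnj_mult complex_cnj_cnj)
    also have "\<dots> = (\<Sum>i<n. \<Sum>j<n. a j i * c j p * cnj (c i q))"
    proof (intro sum.cong refl)
      fix i j assume "i \<in> {..<n}" "j \<in> {..<n}"
      hence "a j i = cnj (a i j)" using a by blast
      thus "cnj (a i j) * cnj (c i q) * c j p = a j i * c j p * cnj (c i q)"
        by (simp only: mult_ac)
    qed
    also have "\<dots> = a' p q" unfolding a'_def by (rule sum.swap)
    finally show "a' p q \<in> S \<and> a' p q = cnj (a' q p)" using mem by simp
  next
    fix x
    have "form_eval n a (f x)
        = (\<Sum>i<n. \<Sum>j<n. a i j * (\<Sum>p<m. c i p * x p) * (\<Sum>q<m. cnj (c j q) * cnj (x q)))"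
      unfolding form_eval_def by (intro sum.cong[OF refl]) (simp add: c(2))
    also have "\<dots> = (\<Sum>i<n. \<Sum>j<n. \<Sum>p<m. \<Sum>q<m. a i j * c i p * cnj (c j q) * x p * cnj (x q))"
    proof (intro sum.cong[OF refl])
      fix i j
      have "a i j * (\<Sum>p<m. c i p * x p) * (\<Sum>q<m. cnj (c j q) * cnj (x q))
          = (\<Sum>p<m. \<Sum>q<m. a i j * ((c i p * x p) * (cnj (c j q) * cnj (x q))))"
        unfolding mult.assoc[of "a i j"] sum_product by (simp only: sum_distrib_left)
      also have "\<dots> = (\<Sum>p<m. \<Sum>q<m. a i j * c i p * cnj (c j q) * x p * cnj (x q))"
        by (intro sum.cong[OF refl]) (simp only: mult_ac)
      finally show "a i j * (\<Sum>p<m. c i p * x p) * (\<Sum>q<m. cnj (c j q) * cnj (x q))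
          = (\<Sum>p<m. \<Sum>q<m. a i j * c i p * cnj (c j q) * x p * cnj (x q))" .
    qed
    also have "\<dots> = (\<Sum>i<n. \<Sum>p<m. \<Sum>j<n. \<Sum>q<m. a i j * c i p * cnj (c j q) * x p * cnj (x q))"
      by (rule sum.cong[OF refl]) (rule sum.swap)
    also have "\<dots> = (\<Sum>p<m. \<Sum>i<n. \<Sum>j<n. \<Sum>q<m. a i j * c i p * cnj (c j q) * x p * cnj (x q))"
      by (rule sum.swap)
    also have "\<dots> = (\<Sum>p<m. \<Sum>i<n. \<Sum>q<m. \<Sum>j<n. a i j * c i p * cnj (c j q) * x p * cnj (x q))"
      by (rule sum.cong[OF refl], rule sum.cong[OF refl]) (rule sum.swap)
    also have "\<dots> = (\<Sum>p<m. \<Sum>q<m. \<Sum>i<n. \<Sum>j<n. a i j * c i p * cnj (c j q) * x p * cnj (x q))"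
      by (rule sum.cong[OF refl]) (rule sum.swap)
    also have "\<dots> = form_eval m a' x"
      unfolding form_eval_def a'_def by (simp add: sum_distrib_right)
    finally show "form_eval n a (f x) = form_eval m a' x" .
  qed
qed

lemma form_eval_cong:
  assumes "\<And>i. i < n \<Longrightarrow> x i = y i" shows "form_eval n a x = form_eval n a y"
  unfolding form_eval_def using assms by simp

lemma form_eval_Suc:
  "form_eval (Suc n) a x = form_eval n a x + (\<Sum>j<n. a j n * x j * cnj (x n) + a n j * x n * cnj (x j))
     + a n n * x n * cnj (x n)"
  unfolding form_eval_def by (simp add: sum.distrib algebra_simps)

lemma form_eval_unit:
  assumes "k < n" shows "form_eval n a (\<lambda>j. if j = k then d else 0) = a k k * (d * cnj d)"
proof -
  have "form_eval n a (\<lambda>j. if j = k then d else 0)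
      = (\<Sum>i<n. \<Sum>j<n. if j = k then (if i = k then a k k * (d * cnj d) else 0) else 0)"
    unfolding form_eval_def by (intro sum.cong refl) auto
  thus ?thesis using assms by simp
qed

lemma form_eval_complete_square:
  assumes a: "\<And>i j. i < Suc n \<Longrightarrow> j < Suc n \<Longrightarrow> a i j = cnj (a j i)" and nz: "a n n \<noteq> 0"
  shows "form_eval (Suc n) a x =
    a n n * ((x n + (\<Sum>j<n. a j n / a n n * x j)) * cnj (x n + (\<Sum>j<n. a j n / a n n * x j)))
      + form_eval n (\<lambda>i j. a i j - a i n * a n j / a n n) x"
proof -
  define s where "s = (\<Sum>j<n. a j n * x j)"
  have real: "cnj (a n n) = a n n" by (rule a[of n n, symmetric]) auto
  have cs: "cnj s = (\<Sum>j<n. a n j * cnj (x j))"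
    unfolding s_def cnj_sum
  proof (intro sum.cong refl)
    fix j assume "j \<in> {..<n}"
    hence "a n j = cnj (a j n)" by (intro a) auto
    thus "cnj (a j n * x j) = a n j * cnj (x j)" by (simp only: complex_cnj_mult)
  qed
  have s1: "(\<Sum>j<n. a j n / a n n * x j) = s / a n n"
    by (simp add: s_def sum_divide_distrib)
  have "form_eval n (\<lambda>i j. a i j - a i n * a n j / a n n) x
      = form_eval n a x - (\<Sum>i<n. \<Sum>j<n. (a i n * x i) * (a n j * cnj (x j))) / a n n"
    unfolding form_eval_def
    by (simp add: sum_subtractf sum_divide_distrib algebra_simps)
  also have "(\<Sum>i<n. \<Sum>j<n. (a i n * x i) * (a n j * cnj (x j))) = s * cnj s"
    by (subst cs) (simp add: s_def sum_product)
  finally have 1: "form_eval n (\<lambda>i j. a i j - a i n * a n j / a n n) x = form_eval n a x - s * cnj s / a n n" .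
  have 2: "(\<Sum>j<n. a j n * x j * cnj (x n) + a n j * x n * cnj (x j)) = s * cnj (x n) + x n * cnj s"
    by (subst cs) (simp add: s_def sum.distrib sum_distrib_left sum_distrib_right mult_ac)
  show ?thesis
    unfolding form_eval_Suc 1 2 s1 using nz real by (simp add: field_simps)
qed

text \<open>Row i of a unipotent lower triangular matrix, applied to \<open>x\<close>; the entries
  \<open>t\<close> are the Gram-Schmidt coefficients.\<close>

definition tri :: "(nat \<Rightarrow> nat \<Rightarrow> complex) \<Rightarrow> (nat \<Rightarrow> complex) \<Rightarrow> nat \<Rightarrow> complex" where
  "tri t x i = x i + (\<Sum>j<i. t i j * x j)"

text \<open>A form written by Lagrange's method as a sum of squares; the \<open>h i\<close> are the
  squared Gram-Schmidt lengths.\<close>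

definition diag_eval :: "nat \<Rightarrow> (nat \<Rightarrow> real) \<Rightarrow> (nat \<Rightarrow> nat \<Rightarrow> complex) \<Rightarrow> (nat \<Rightarrow> complex) \<Rightarrow> real" where
  "diag_eval n h t x = (\<Sum>i<n. h i * (cmod (tri t x i))\<^sup>2)"

lemma tri_cong:
  assumes "\<And>j. j < i \<Longrightarrow> t i j = t' i j" "\<And>j. j \<le> i \<Longrightarrow> x j = y j"
  shows "tri t x i = tri t' y i"
  unfolding tri_def using assms by simp

lemma diag_eval_cong:
  assumes "\<And>i. i < n \<Longrightarrow> h i = h' i" "\<And>i j. j < i \<Longrightarrow> i < n \<Longrightarrow> t i j = t' i j" "\<And>j. j < n \<Longrightarrow> x j = y j"
  shows "diag_eval n h t x = diag_eval n h' t' y"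
proof -
  have "tri t x i = tri t' y i" if "i < n" for i using assms that by (intro tri_cong) auto
  thus ?thesis unfolding diag_eval_def using assms(1) by simp
qed

text \<open>The properties of \<open>E\<close> and \<open>\<O>\<close> that the argument needs, for \<open>E = \<rat>\<close> (with \<open>w = 0\<close>, \<open>\<delta> = 1\<close>) and for
  imaginary quadratic \<open>E\<close> (with \<open>w = \<i> \<surd>d\<close>, \<open>\<delta> = 2\<close>) alike: real multiples of elements of \<open>E\<close> are within
  \<open>\<rho>\<close> of \<open>\<int> + \<int> w\<close>, and \<open>\<delta>\<close> is the growth exponent of the number of integers in a disc.\<close>

locale integral_field =
  fixes E \<O> :: "complex set" and w :: complex and \<rho> :: real and \<delta> :: nat
  assumes E_semiring: "subsemiring E"
    and E_minus: "\<And>x. x \<in> E \<Longrightarrow> - x \<in> E"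
    and E_inverse: "\<And>x. x \<in> E \<Longrightarrow> inverse x \<in> E"
    and E_cnj: "\<And>x. x \<in> E \<Longrightarrow> cnj x \<in> E"
    and O_semiring: "subsemiring \<O>"
    and O_minus: "\<And>x. x \<in> \<O> \<Longrightarrow> - x \<in> \<O>"
    and O_cnj: "\<And>x. x \<in> \<O> \<Longrightarrow> cnj x \<in> \<O>"
    and O_subset: "\<O> \<subseteq> E"
    and O_real: "\<And>x. x \<in> \<O> \<Longrightarrow> Im x = 0 \<Longrightarrow> x \<in> \<int>"
    and denominator: "\<And>x. x \<in> E \<Longrightarrow> \<exists>q>0. of_nat q * x \<in> \<O>"
    and bezout: "\<And>a b. a \<in> \<O> \<Longrightarrow> b \<in> \<O> \<Longrightarrow>
      \<exists>d\<in>\<O>. \<exists>p\<in>\<O>. \<exists>q\<in>\<O>. \<exists>u\<in>\<O>. \<exists>v\<in>\<O>. a = d * p \<and> b = d * q \<and> u * p + v * q = 1"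
    and w_O: "w \<in> \<O>" and rho_ge_1: "\<rho> \<ge> 1" and w_le: "cmod w \<le> \<rho>"
    and rounding: "\<And>r x. x \<in> E \<Longrightarrow> \<exists>m m'. \<bar>of_int m\<bar> \<le> cmod (of_real r * x) \<and>
      \<bar>of_int m'\<bar> \<le> cmod (of_real r * x) \<and> cmod (of_real r * x - (of_int m + of_int m' * w)) \<le> \<rho>"
    and many_integers: "\<And>L::nat. \<exists>Z\<subseteq>\<O>. finite Z \<and> card Z = (2 * L + 1) ^ \<delta> \<and> (\<forall>z\<in>Z. cmod z \<le> 2 * \<rho> * L)"
    and few_cells: "\<And>l D. 0 < l \<Longrightarrow> l \<le> D \<Longrightarrow>
      finite ((\<lambda>z. (\<lfloor>Re z / l\<rfloor>, \<lfloor>Im z / l\<rfloor>)) ` {z\<in>E. cmod z \<le> D}) \<and>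
      real (card ((\<lambda>z. (\<lfloor>Re z / l\<rfloor>, \<lfloor>Im z / l\<rfloor>)) ` {z\<in>E. cmod z \<le> D})) \<le> (4 * D / l) ^ \<delta>"
    and dim_pos: "\<delta> > 0"
begin

section \<open>Arithmetic of the integers and automorphisms of the lattice\<close>

lemma O_0: "0 \<in> \<O>" and O_1: "1 \<in> \<O>" and E_0: "0 \<in> E" and E_1: "1 \<in> E"
  using O_semiring E_semiring by (auto simp: subsemiring_def)

lemma O_add: "x \<in> \<O> \<Longrightarrow> y \<in> \<O> \<Longrightarrow> x + y \<in> \<O>" and O_mult: "x \<in> \<O> \<Longrightarrow> y \<in> \<O> \<Longrightarrow> x * y \<in> \<O>"
  using O_semiring by (auto simp: subsemiring_def)

lemma E_add: "x \<in> E \<Longrightarrow> y \<in> E \<Longrightarrow> x + y \<in> E" and E_mult: "x \<in> E \<Longrightarrow> y \<in> E \<Longrightarrow> x * y \<in> E"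
  using E_semiring by (auto simp: subsemiring_def)

lemma E_divide: "x \<in> E \<Longrightarrow> y \<in> E \<Longrightarrow> x / y \<in> E"
  unfolding divide_inverse by (intro E_mult E_inverse)

lemma O_diff: "x \<in> \<O> \<Longrightarrow> y \<in> \<O> \<Longrightarrow> x - y \<in> \<O>"
  using O_add[of x "- y"] O_minus by simp

lemma E_diff: "x \<in> E \<Longrightarrow> y \<in> E \<Longrightarrow> x - y \<in> E"
  using E_add[of x "- y"] E_minus by simp

lemma O_of_nat: "of_nat k \<in> \<O>"
  by (induction k) (auto intro: O_0 O_1 O_add)

lemma O_of_int: "of_int k \<in> \<O>"
  by (cases k rule: int_cases2) (auto intro: O_of_nat O_minus)

text \<open>The norm \<open>x * cnj x\<close> is a positive rational integer.\<close>

lemma O_norm: assumes "x \<in> \<O>" "x \<noteq> 0" shows "cmod x \<ge> 1"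
proof -
  have "x * cnj x \<in> \<int>" using assms by (intro O_real O_mult O_cnj) auto
  hence "of_real ((cmod x)\<^sup>2) \<in> (\<int> :: complex set)" by (simp only: complex_norm_square)
  then obtain k where "of_real ((cmod x)\<^sup>2) = (of_int k :: complex)" by (auto elim: Ints_cases)
  hence k: "(cmod x)\<^sup>2 = of_int k" by (metis of_real_eq_iff of_real_of_int_eq)
  have "(cmod x)\<^sup>2 > 0" using assms by simp
  hence "(cmod x)\<^sup>2 \<ge> 1" unfolding k by simp
  thus ?thesis using power2_le_imp_le[of 1 "cmod x"] by simp
qed

text \<open>An element of the general linear group over the integers together with its inverse.
  Coordinates from n on are left free, so composites are compared by \<open>linear_over_cong\<close>
  and not as functions.\<close>

definition aut :: "nat \<Rightarrow> ((nat \<Rightarrow> complex) \<Rightarrow> nat \<Rightarrow> complex) \<Rightarrow> ((nat \<Rightarrow> complex) \<Rightarrow> nat \<Rightarrow> complex) \<Rightarrow> bool" where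
  "aut n f g \<longleftrightarrow> (\<forall>i<n. linear_over \<O> n (\<lambda>x. f x i) \<and> linear_over \<O> n (\<lambda>x. g x i)
     \<and> (\<forall>x. f (g x) i = x i \<and> g (f x) i = x i))"

lemma autD:
  assumes "aut n f g" "i < n"
  shows "linear_over \<O> n (\<lambda>x. f x i)" "linear_over \<O> n (\<lambda>x. g x i)" "f (g x) i = x i" "g (f x) i = x i"
  using assms unfolding aut_def by auto

lemma aut_sym: "aut n f g \<Longrightarrow> aut n g f"
  unfolding aut_def by auto

lemma aut_id: "aut n (\<lambda>x. x) (\<lambda>x. x)"
  unfolding aut_def by (auto intro: linear_over_coord O_semiring)

lemma aut_comp:
  assumes f: "aut n f g" and f': "aut n f' g'"
  shows "aut n (\<lambda>x. f (f' x)) (\<lambda>x. g' (g x))"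
  unfolding aut_def
proof (intro allI impI conjI)
  fix i assume i: "i < n"
  show "linear_over \<O> n (\<lambda>x. f (f' x) i)"
    by (rule linear_over_comp[OF O_semiring autD(1)[OF f i] autD(1)[OF f']])
  show "linear_over \<O> n (\<lambda>x. g' (g x) i)"
    by (rule linear_over_comp[OF O_semiring autD(2)[OF f' i] autD(2)[OF f]])
  fix x
  have "f (f' (g' (g x))) i = f (g x) i"
    by (rule linear_over_cong[OF autD(1)[OF f i]]) (rule autD(3)[OF f'])
  thus "f (f' (g' (g x))) i = x i" using autD(3)[OF f i] by simp
  have "g' (g (f (f' x))) i = g' (f' x) i"
    by (rule linear_over_cong[OF autD(2)[OF f' i]]) (rule autD(4)[OF f])
  thus "g' (g (f (f' x))) i = x i" using autD(4)[OF f' i] by simp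
qed

lemma aut_extend:
  assumes f: "aut n f g"
  shows "aut (Suc n) (\<lambda>x i. if i < n then f x i else x i) (\<lambda>x i. if i < n then g x i else x i)"
  unfolding aut_def
proof (intro allI impI)
  fix i assume i: "i < Suc n"
  show "linear_over \<O> (Suc n) (\<lambda>x. if i < n then f x i else x i) \<and>
    linear_over \<O> (Suc n) (\<lambda>x. if i < n then g x i else x i) \<and>
    (\<forall>x. (if i < n then f (\<lambda>i. if i < n then g x i else x i) i else if i < n then g x i else x i) = x i \<and>
       (if i < n then g (\<lambda>i. if i < n then f x i else x i) i else if i < n then f x i else x i) = x i)"
  proof (cases "i < n")
    case True
    have "f (\<lambda>i. if i < n then g x i else x i) i = x i" for x
      using linear_over_cong[OF autD(1)[OF f True], of "\<lambda>i. if i < n then g x i else x i" "g x"]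
        autD(3)[OF f True] by simp
    moreover have "g (\<lambda>i. if i < n then f x i else x i) i = x i" for x
      using linear_over_cong[OF autD(2)[OF f True], of "\<lambda>i. if i < n then f x i else x i" "f x"]
        autD(4)[OF f True] by simp
    ultimately show ?thesis
      using True linear_over_mono[OF O_semiring autD(1)[OF f True], of "Suc n"]
        linear_over_mono[OF O_semiring autD(2)[OF f True], of "Suc n"] by auto
  qed (use i in \<open>auto intro: linear_over_coord O_semiring\<close>)
qed

lemma aut_mem: assumes "aut n f g" "\<And>i. i < n \<Longrightarrow> x i \<in> \<O>" "i < n" shows "f x i \<in> \<O>"
  using linear_over_mem[OF O_semiring autD(1)[OF assms(1,3)] assms(2)] .

lemma aut_nonzero: assumes f: "aut n f g" and "\<exists>i<n. x i \<noteq> 0" shows "\<exists>i<n. f x i \<noteq> 0"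
proof (rule ccontr)
  assume "\<not> ?thesis"
  hence "g (f x) i = 0" if "i < n" for i
    using linear_over_zero[OF autD(2)[OF f that], of "f x"] by blast
  thus False using autD(4)[OF f] assms(2) by metis
qed

text \<open>The inverse is the adjugate, as the determinant is 1. This is the single step of
  \<open>complete_to_basis\<close>.\<close>

lemma aut_two_by_two:
  assumes "a \<in> \<O>" "b \<in> \<O>" "c \<in> \<O>" "d \<in> \<O>" and det: "a * d - b * c = 1"
  shows "aut (Suc (Suc n)) (\<lambda>x. x(n := a * x n + b * x (Suc n), Suc n := c * x n + d * x (Suc n)))
    (\<lambda>x. x(n := d * x n + (- b) * x (Suc n), Suc n := (- c) * x n + a * x (Suc n)))"
  unfolding aut_def
proof (intro allI impI)
  fix i assume i: "i < Suc (Suc n)"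
  have lin: "linear_over \<O> (Suc (Suc n)) (\<lambda>x. p * x n + q * x (Suc n))" if "p \<in> \<O>" "q \<in> \<O>" for p q
    by (intro linear_over_add linear_over_scale linear_over_coord O_semiring that) auto
  have "a * (d * y + (- b) * z) + b * ((- c) * y + a * z) = (a * d - b * c) * y"
    "c * (d * y + (- b) * z) + d * ((- c) * y + a * z) = (a * d - b * c) * z"
    "d * (a * y + b * z) + (- b) * (c * y + d * z) = (a * d - b * c) * y"
    "(- c) * (a * y + b * z) + a * (c * y + d * z) = (a * d - b * c) * z" for y z
    by (simp_all add: algebra_simps)
  note alg = this[unfolded det mult_1_left]
  note eqs = fun_upd_apply n_not_Suc_n n_not_Suc_n[symmetric] if_True if_False refl alg simp_thms
  consider "i = n" | "i = Suc n" | "i < n" using i by linarith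
  thus "linear_over \<O> (Suc (Suc n)) (\<lambda>x. (x(n := a * x n + b * x (Suc n), Suc n := c * x n + d * x (Suc n))) i) \<and>
    linear_over \<O> (Suc (Suc n)) (\<lambda>x. (x(n := d * x n + (- b) * x (Suc n), Suc n := (- c) * x n + a * x (Suc n))) i) \<and>
    (\<forall>x. ((x(n := d * x n + (- b) * x (Suc n), Suc n := (- c) * x n + a * x (Suc n)))
        (n := a * (x(n := d * x n + (- b) * x (Suc n), Suc n := (- c) * x n + a * x (Suc n))) n
            + b * (x(n := d * x n + (- b) * x (Suc n), Suc n := (- c) * x n + a * x (Suc n))) (Suc n),
         Suc n := c * (x(n := d * x n + (- b) * x (Suc n), Suc n := (- c) * x n + a * x (Suc n))) n
            + d * (x(n := d * x n + (- b) * x (Suc n), Suc n := (- c) * x n + a * x (Suc n))) (Suc n))) i = x i \<and>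
      ((x(n := a * x n + b * x (Suc n), Suc n := c * x n + d * x (Suc n)))
        (n := d * (x(n := a * x n + b * x (Suc n), Suc n := c * x n + d * x (Suc n))) n
            + (- b) * (x(n := a * x n + b * x (Suc n), Suc n := c * x n + d * x (Suc n))) (Suc n),
         Suc n := (- c) * (x(n := a * x n + b * x (Suc n), Suc n := c * x n + d * x (Suc n))) n
            + a * (x(n := a * x n + b * x (Suc n), Suc n := c * x n + d * x (Suc n))) (Suc n))) i = x i)"
  proof cases
    case 1
    show ?thesis unfolding 1 using lin[OF assms(1,2)] lin[OF assms(4) O_minus[OF assms(2)]] by (simp only: eqs)
  next
    case 2
    show ?thesis unfolding 2 using lin[OF assms(3,4)] lin[OF O_minus[OF assms(3)] assms(1)] by (simp only: eqs)
  next
    case 3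
    show ?thesis using 3 linear_over_coord[OF O_semiring i] by auto
  qed
qed

text \<open>Bezout matrices gather the coordinates of \<open>b\<close> one after another into a
  common divisor \<open>d\<close>, which makes \<open>b\<close> equal to \<open>d\<close> times the
  last vector of a lattice basis. The hypothesis on the class number enters the argument through
  these matrices.\<close>

lemma complete_to_basis:
  assumes "\<And>i. i < Suc n \<Longrightarrow> b i \<in> \<O>"
  shows "\<exists>f g d. aut (Suc n) f g \<and> d \<in> \<O> \<and> (\<forall>i<Suc n. b i = f (\<lambda>j. if j = n then d else 0) i)"
  using assms
proof (induction n)
  case 0
  show ?case
    by (rule exI[of _ "\<lambda>x. x"], rule exI[of _ "\<lambda>x. x"], rule exI[of _ "b 0"]) (use 0 in \<open>auto intro: aut_id\<close>)
next
  case (Suc n)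
  have "b i \<in> \<O>" if "i < Suc n" for i using that Suc.prems by auto
  then obtain f g d1 where f: "aut (Suc n) f g" "d1 \<in> \<O>" "\<And>i. i < Suc n \<Longrightarrow> b i = f (\<lambda>j. if j = n then d1 else 0) i"
    using Suc.IH by blast
  obtain d p q u v where bz: "d \<in> \<O>" "p \<in> \<O>" "q \<in> \<O>" "u \<in> \<O>" "v \<in> \<O>"
    "d1 = d * p" "b (Suc n) = d * q" "u * p + v * q = 1"
    using bezout[OF f(2), of "b (Suc n)"] Suc.prems by blast
  \<comment> \<open>The matrix with rows (v, p) and (- u, q) has determinant u * p + v * q = 1 and
    sends (0, d) to (d1, b (Suc n)).\<close>
  define m m' where "m = (\<lambda>x::nat\<Rightarrow>complex. x(n := v * x n + p * x (Suc n), Suc n := (- u) * x n + q * x (Suc n)))"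
    and "m' = (\<lambda>x::nat\<Rightarrow>complex. x(n := q * x n + (- p) * x (Suc n), Suc n := (- (- u)) * x n + v * x (Suc n)))"
  have m: "aut (Suc (Suc n)) m m'"
    unfolding m_def m'_def by (rule aut_two_by_two) (use bz O_minus in \<open>auto simp: algebra_simps\<close>)
  define F where "F = (\<lambda>x i. if i < Suc n then f x i else x i)"
  have mv: "m (\<lambda>j. if j = Suc n then d else 0) = (\<lambda>j. if j = n then d1 else if j = Suc n then b (Suc n) else 0)"
    by (auto simp: m_def bz mult.commute)
  have "b i = F (m (\<lambda>j. if j = Suc n then d else 0)) i" if i: "i < Suc (Suc n)" for i
  proof (cases "i < Suc n")
    case True
    have "f (\<lambda>j. if j = n then d1 else if j = Suc n then b (Suc n) else 0) i = f (\<lambda>j. if j = n then d1 else 0) i"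
      by (rule linear_over_cong[OF autD(1)[OF f(1) True]]) auto
    thus ?thesis using True f(3) unfolding F_def mv by simp
  next
    case False
    hence "i = Suc n" using i by simp
    thus ?thesis unfolding F_def mv by simp
  qed
  moreover have "\<exists>G. aut (Suc (Suc n)) (\<lambda>x. F (m x)) G"
    using aut_comp[OF aut_extend[OF f(1)] m] unfolding F_def by blast
  ultimately show ?case using bz(1) by blast
qed

end

section \<open>Hermite-Korkin-Zolotarev bases\<close>

context integral_field
begin

lemma common_denominator:
  assumes "finite S" "S \<subseteq> E" shows "\<exists>q>0. \<forall>x\<in>S. of_nat q * x \<in> \<O>"
  using assms
proof (induction S rule: finite_induct)
  case (insert x S)
  then obtain q where q: "q > 0" "\<forall>x\<in>S. of_nat q * x \<in> \<O>" by auto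
  obtain r where r: "r > 0" "of_nat r * x \<in> \<O>" using denominator insert by blast
  have "of_nat (q * r) * y \<in> \<O>" if "y \<in> insert x S" for y
  proof (cases "y = x")
    case True
    thus ?thesis using O_mult[OF O_of_nat[of q] r(2)] by (simp add: mult_ac)
  next
    case False
    hence "of_nat q * y \<in> \<O>" using q that by blast
    from O_mult[OF O_of_nat[of r] this] show ?thesis by (simp add: mult_ac)
  qed
  thus ?case using q(1) r(1) by (intro exI[of _ "q * r"]) auto
qed auto

lemma form_eval_integral:
  assumes "\<And>i j. i < n \<Longrightarrow> j < n \<Longrightarrow> a i j \<in> \<O>" "\<And>i. i < n \<Longrightarrow> x i \<in> \<O>"
  shows "form_eval n a x \<in> \<O>"
  unfolding form_eval_def by (intro subsemiring_sum O_semiring O_mult O_cnj) (auto intro: assms)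

lemma form_eval_vector_pos:
  assumes "pos_def_form E n a" "\<And>i. i < n \<Longrightarrow> x i \<in> E" "\<exists>i<n. x i \<noteq> 0"
  shows "Re (form_eval n a x) > 0"
  using assms unfolding pos_def_form_def vectors_def by blast

text \<open>The coefficients lie only in the field, because Schur complements leave the ring of
  integers. With a common denominator q, the values at integral vectors lie in (1 / q) Z, and
  well-ordering yields a minimum.\<close>

lemma ex_minimal_vector:
  assumes n: "n > 0" and herm: "hermitian_form E n a" and pd: "pos_def_form E n a"
  shows "\<exists>b. (\<forall>i<n. b i \<in> \<O>) \<and> (\<exists>i<n. b i \<noteq> 0) \<and>
    (\<forall>x. (\<forall>i<n. x i \<in> \<O>) \<longrightarrow> (\<exists>i<n. x i \<noteq> 0) \<longrightarrow> Re (form_eval n a b) \<le> Re (form_eval n a x))"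
proof -
  have "finite ((\<lambda>(i,j). a i j) ` ({..<n} \<times> {..<n}))" "(\<lambda>(i,j). a i j) ` ({..<n} \<times> {..<n}) \<subseteq> E"
    using herm unfolding hermitian_form_def by auto
  from common_denominator[OF this] obtain q where q: "q > 0" "\<And>i j. i < n \<Longrightarrow> j < n \<Longrightarrow> of_nat q * a i j \<in> \<O>"
    by force
  define P where "P x \<longleftrightarrow> (\<forall>i<n. x i \<in> \<O>) \<and> (\<exists>i<n. x i \<noteq> 0)" for x
  define m where "m x = nat \<lfloor>q * Re (form_eval n a x)\<rfloor>" for x
  have m: "real (m x) = q * Re (form_eval n a x)" if "P x" for x
  proof -
    have "form_eval n (\<lambda>i j. of_nat q * a i j) x = of_nat q * form_eval n a x"
      unfolding form_eval_def by (simp add: sum_distrib_left mult_ac)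
    moreover have "form_eval n (\<lambda>i j. of_nat q * a i j) x \<in> \<O>"
      using that q(2) unfolding P_def by (intro form_eval_integral) auto
    ultimately have "of_nat q * form_eval n a x \<in> \<int>"
      using Im_form_eval[OF herm, of x] by (intro O_real) auto
    then obtain k where "of_nat q * form_eval n a x = of_int k" by (auto elim: Ints_cases)
    hence "Re (of_nat q * form_eval n a x) = of_int k" by simp
    hence k: "q * Re (form_eval n a x) = of_int k" by simp
    have "Re (form_eval n a x) > 0"
      using that O_subset unfolding P_def by (intro form_eval_vector_pos[OF pd]) auto
    hence "q * Re (form_eval n a x) \<ge> 0" by simp
    thus ?thesis unfolding m_def k by simp
  qed
  have "P (\<lambda>_. 1)" using n O_1 unfolding P_def by auto
  from ex_has_least_nat[of P, OF this, of m]
  obtain b where b: "P b" "\<And>x. P x \<Longrightarrow> m b \<le> m x" by blast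
  have "Re (form_eval n a b) \<le> Re (form_eval n a x)" if "P x" for x
  proof -
    have "real (m b) \<le> real (m x)" using b(2)[OF that] by simp
    thus ?thesis using m[OF b(1)] m[OF that] q(1) by simp
  qed
  thus ?thesis using b(1) unfolding P_def by blast
qed

lemma schur_complement:
  assumes herm: "hermitian_form E (Suc n) a" and pd: "pos_def_form E (Suc n) a"
  shows "\<exists>\<alpha> t a1. \<alpha> > 0 \<and> a n n = of_real \<alpha> \<and> (\<forall>j<n. t j \<in> E) \<and>
    hermitian_form E n a1 \<and> pos_def_form E n a1 \<and>
    (\<forall>x. form_eval (Suc n) a x = of_real (\<alpha> * (cmod (x n + (\<Sum>j<n. t j * x j)))\<^sup>2) + form_eval n a1 x)"
proof -
  have aE: "a i j \<in> E" if "i < Suc n" "j < Suc n" for i j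
    using herm that unfolding hermitian_form_def by blast
  have aH: "a i j = cnj (a j i)" if "i < Suc n" "j < Suc n" for i j
    using herm that unfolding hermitian_form_def by blast
  define \<alpha> where "\<alpha> = Re (a n n)"
  have "cnj (a n n) = a n n" by (rule aH[symmetric]) auto
  hence "Im (a n n) = 0" by (simp add: complex_eq_iff)
  hence ann: "a n n = of_real \<alpha>" unfolding \<alpha>_def by (simp add: complex_eq_iff)
  have "Re (form_eval (Suc n) a (\<lambda>j. if j = n then 1 else 0)) > 0"
    by (rule form_eval_vector_pos[OF pd]) (auto simp: E_0 E_1)
  hence pos: "\<alpha> > 0" unfolding \<alpha>_def by (subst (asm) form_eval_unit) auto
  define t where "t j = a j n / a n n" for j
  define a1 where "a1 i j = a i j - a i n * a n j / a n n" for i j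
  have tE: "t j \<in> E" if "j < n" for j
    unfolding t_def using that by (intro E_divide aE) auto
  have eq: "form_eval (Suc n) a x = of_real (\<alpha> * (cmod (x n + (\<Sum>j<n. t j * x j)))\<^sup>2) + form_eval n a1 x" for x
  proof -
    have "form_eval (Suc n) a x = a n n * ((x n + (\<Sum>j<n. t j * x j)) * cnj (x n + (\<Sum>j<n. t j * x j))) + form_eval n a1 x"
      unfolding t_def a1_def by (rule form_eval_complete_square[OF aH]) (use ann pos in auto)
    thus ?thesis by (simp only: ann of_real_mult complex_norm_square)
  qed
  have herm1: "hermitian_form E n a1"
    unfolding hermitian_form_def
  proof (intro allI impI conjI)
    fix i j assume ij: "i < n" "j < n"
    show "a1 i j \<in> E" unfolding a1_def using ij by (intro E_diff E_divide E_mult aE) auto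
    have "cnj (a j i) = a i j" "cnj (a j n) = a n j" "cnj (a n i) = a i n" "cnj (a n n) = a n n"
      using ij by (auto intro!: aH[symmetric])
    thus "a1 i j = cnj (a1 j i)" unfolding a1_def by simp
  qed
  have pd1: "pos_def_form E n a1"
    unfolding pos_def_form_def vectors_def
  proof (intro ballI impI)
    fix x assume x: "x \<in> {x. \<forall>i<n. x i \<in> E}" "\<exists>i<n. x i \<noteq> 0"
    \<comment> \<open>The last coordinate is chosen to annihilate the completed square, so that the
      value of \<open>a\<close> at \<open>y\<close> is the value of the complement at
      \<open>x\<close>.\<close>
    define y where "y = x(n := - (\<Sum>j<n. t j * x j))"
    have s: "(\<Sum>j<n. t j * y j) = (\<Sum>j<n. t j * x j)" by (intro sum.cong) (auto simp: y_def)
    have "(\<Sum>j<n. t j * x j) \<in> E"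
      using x tE by (intro subsemiring_sum E_semiring E_mult) auto
    hence yE: "y i \<in> E" if "i < Suc n" for i
      using x that E_minus unfolding y_def by (auto simp: less_Suc_eq)
    have "\<exists>i<Suc n. y i \<noteq> 0" using x(2) unfolding y_def by (metis fun_upd_other less_SucI less_irrefl)
    hence "Re (form_eval (Suc n) a y) > 0" by (intro form_eval_vector_pos[OF pd] yE)
    moreover have "form_eval (Suc n) a y = form_eval n a1 y"
      unfolding eq s by (simp add: y_def)
    moreover have "form_eval n a1 y = form_eval n a1 x"
      by (rule form_eval_cong) (simp add: y_def)
    ultimately show "Re (form_eval n a1 x) > 0" by simp
  qed
  show ?thesis using pos ann tE herm1 pd1 eq by blast
qed

lemma pos_def_form_comp:
  assumes pd: "pos_def_form E n a" and f: "aut n f g"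
    and eq: "\<And>x. form_eval n a (f x) = form_eval n a' x"
  shows "pos_def_form E n a'"
  unfolding pos_def_form_def vectors_def
proof (intro ballI impI)
  fix x assume x: "x \<in> {x. \<forall>i<n. x i \<in> E}" "\<exists>i<n. x i \<noteq> 0"
  have "f x i \<in> E" if "i < n" for i
    using linear_over_mem[OF E_semiring linear_over_subset[OF autD(1)[OF f that] O_subset]] x(1) by blast
  thus "Re (form_eval n a' x) > 0"
    unfolding eq[symmetric] by (rule form_eval_vector_pos[OF pd _ aut_nonzero[OF f x(2)]])
qed

text \<open>The basis is indexed backwards: the shortest vector comes last, so that \<open>tri t\<close> is lower
  triangular and the successive projections are given by the first coordinates.  The maps \<open>f\<close> and \<open>g\<close>
  are mutually inverse changes of basis.\<close>

definition hkz_basis :: "nat \<Rightarrow> (nat \<Rightarrow> nat \<Rightarrow> complex) \<Rightarrow> ((nat \<Rightarrow> complex) \<Rightarrow> nat \<Rightarrow> complex) \<Rightarrow>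
    ((nat \<Rightarrow> complex) \<Rightarrow> nat \<Rightarrow> complex) \<Rightarrow> (nat \<Rightarrow> real) \<Rightarrow> (nat \<Rightarrow> nat \<Rightarrow> complex) \<Rightarrow> bool" where
  "hkz_basis n a f g h t \<longleftrightarrow> aut n f g \<and> (\<forall>i<n. h i > 0) \<and> (\<forall>i<n. \<forall>j<i. t i j \<in> E) \<and>
    (\<forall>x. form_eval n a (f x) = of_real (diag_eval n h t x)) \<and>
    (\<forall>k<n. \<forall>x. (\<forall>i<n. x i \<in> \<O>) \<longrightarrow> (\<exists>i\<le>k. x i \<noteq> 0) \<longrightarrow> h k \<le> diag_eval (Suc k) h t x)"

lemma hkz_basisD:
  assumes "hkz_basis n a f g h t"
  shows "aut n f g" "i < n \<Longrightarrow> h i > 0" "i < n \<Longrightarrow> j < i \<Longrightarrow> t i j \<in> E"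
    "form_eval n a (f x) = of_real (diag_eval n h t x)"
    "k < n \<Longrightarrow> (\<forall>i<n. x i \<in> \<O>) \<Longrightarrow> (\<exists>i\<le>k. x i \<noteq> 0) \<Longrightarrow> h k \<le> diag_eval (Suc k) h t x"
  using assms unfolding hkz_basis_def by simp_all

text \<open>A shortest vector becomes the last basis vector, and the Schur complement is the form on
  the lattice projected along it, to which the induction hypothesis applies. Minimality at k < n
  involves only the coordinates up to k and is inherited.\<close>

theorem ex_hkz_basis:
  assumes "hermitian_form E n a" "pos_def_form E n a"
  shows "\<exists>f g h t. hkz_basis n a f g h t"
  using assms
proof (induction n arbitrary: a)
  case 0
  show ?case
    by (rule exI[of _ "\<lambda>x. x"], rule exI[of _ "\<lambda>x. x"], rule exI, rule exI)
       (auto simp: hkz_basis_def aut_id form_eval_def diag_eval_def)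
next
  case (Suc n)
  obtain b where b: "\<And>i. i < Suc n \<Longrightarrow> b i \<in> \<O>" "\<exists>i<Suc n. b i \<noteq> 0"
    "\<And>x. (\<forall>i<Suc n. x i \<in> \<O>) \<Longrightarrow> (\<exists>i<Suc n. x i \<noteq> 0) \<Longrightarrow> Re (form_eval (Suc n) a b) \<le> Re (form_eval (Suc n) a x)"
    using ex_minimal_vector[OF _ Suc.prems] by blast
  obtain f0 g0 d where f0: "aut (Suc n) f0 g0" "d \<in> \<O>" "\<And>i. i < Suc n \<Longrightarrow> b i = f0 (\<lambda>j. if j = n then d else 0) i"
    using complete_to_basis[of n b, OF b(1)] by blast
  have "d \<noteq> 0"
  proof
    assume "d = 0"
    hence "b i = 0" if "i < Suc n" for i
      using linear_over_zero[OF autD(1)[OF f0(1) that], of "\<lambda>j. if j = n then d else 0"] f0(3)[OF that] by simp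
    thus False using b(2) by blast
  qed
  hence d1: "cmod d \<ge> 1" by (rule O_norm[OF f0(2)])
  have "\<exists>a0. (\<forall>i<Suc n. \<forall>j<Suc n. a0 i j \<in> E \<and> a0 i j = cnj (a0 j i)) \<and>
      (\<forall>x. form_eval (Suc n) a (f0 x) = form_eval (Suc n) a0 x)"
  proof (rule form_eval_comp[OF E_semiring E_cnj])
    show "a i j \<in> E \<and> a i j = cnj (a j i)" if "i < Suc n" "j < Suc n" for i j
      using Suc.prems(1) that unfolding hermitian_form_def by blast
    show "linear_over E (Suc n) (\<lambda>x. f0 x i)" if "i < Suc n" for i
      by (rule linear_over_subset[OF autD(1)[OF f0(1) that] O_subset])
  qed
  then obtain a0 where a0: "\<And>i j. i < Suc n \<Longrightarrow> j < Suc n \<Longrightarrow> a0 i j \<in> E \<and> a0 i j = cnj (a0 j i)"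
    "\<And>x. form_eval (Suc n) a (f0 x) = form_eval (Suc n) a0 x"
    by blast
  have herm0: "hermitian_form E (Suc n) a0" using a0(1) unfolding hermitian_form_def by blast
  have pd0: "pos_def_form E (Suc n) a0" by (rule pos_def_form_comp[OF Suc.prems(2) f0(1) a0(2)])
  obtain \<alpha> s a1 where sc: "\<alpha> > 0" "a0 n n = of_real \<alpha>" "\<And>j. j < n \<Longrightarrow> s j \<in> E"
    "hermitian_form E n a1" "pos_def_form E n a1"
    "\<And>x. form_eval (Suc n) a0 x = of_real (\<alpha> * (cmod (x n + (\<Sum>j<n. s j * x j)))\<^sup>2) + form_eval n a1 x"
    using schur_complement[OF herm0 pd0] by blast
  \<comment> \<open>The minimum is attained at \<open>d\<close> times the last basis vector, where
    the value is \<alpha> |d|^2 with |d| >= 1. Hence \<alpha>, the value at the basis vector itself,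
    is a lower bound too.\<close>
  have min0: "\<alpha> \<le> Re (form_eval (Suc n) a0 x)" if x: "\<forall>i<Suc n. x i \<in> \<O>" "\<exists>i<Suc n. x i \<noteq> 0" for x
  proof -
    have "form_eval (Suc n) a b = form_eval (Suc n) a (f0 (\<lambda>j. if j = n then d else 0))"
      by (rule form_eval_cong) (rule f0(3))
    also have "\<dots> = of_real \<alpha> * (d * cnj d)"
      unfolding a0(2) sc(2)[symmetric] by (rule form_eval_unit) simp
    also have "\<dots> = of_real (\<alpha> * (cmod d)\<^sup>2)" by (simp only: of_real_mult complex_norm_square)
    finally have "Re (form_eval (Suc n) a b) = \<alpha> * (cmod d)\<^sup>2" by simp
    moreover have "\<alpha> * 1 \<le> \<alpha> * (cmod d)\<^sup>2" using d1 sc(1) by (intro mult_left_mono) auto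
    moreover have "Re (form_eval (Suc n) a b) \<le> Re (form_eval (Suc n) a (f0 x))"
      using aut_mem[OF f0(1)] aut_nonzero[OF f0(1) x(2)] x(1) by (intro b(3)) auto
    ultimately show ?thesis unfolding a0(2) by simp
  qed
  obtain f1 g1 h t where "hkz_basis n a1 f1 g1 h t"
    using Suc.IH[OF sc(4,5)] by blast
  note ih = hkz_basisD[OF this]
  define F where "F = (\<lambda>x i. if i < n then f1 x i else x i)"
  define G where "G = (\<lambda>x i. if i < n then g1 x i else x i)"
  have F: "aut (Suc n) F G" unfolding F_def G_def by (rule aut_extend[OF ih(1)])
  \<comment> \<open>The change of basis \<open>f1\<close> mixes the first n coordinates, so the
    coefficients \<open>s\<close> of the last square are rewritten in the new coordinates;
    \<open>c\<close> becomes row n of \<open>t'\<close>.\<close>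
  have "linear_over E n (\<lambda>x. \<Sum>j<n. s j * f1 x j)"
  proof (rule linear_over_sum[OF E_semiring])
    fix j assume "j \<in> {..<n}"
    hence j: "j < n" by simp
    show "linear_over E n (\<lambda>x. s j * f1 x j)"
      by (rule linear_over_scale[OF E_semiring linear_over_subset[OF autD(1)[OF ih(1) j] O_subset] sc(3)[OF j]])
  qed
  then obtain c where c: "\<And>j. j < n \<Longrightarrow> c j \<in> E" "\<And>x. (\<Sum>j<n. s j * f1 x j) = (\<Sum>j<n. c j * x j)"
    unfolding linear_over_def fun_eq_iff by blast
  define h' where "h' = h(n := \<alpha>)"
  define t' where "t' = t(n := c)"
  have low: "diag_eval k h' t' x = diag_eval k h t x" if "k \<le> n" for k x
    by (rule diag_eval_cong) (use that in \<open>auto simp: h'_def t'_def\<close>)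
  have eq0: "form_eval (Suc n) a0 (F x) = of_real (diag_eval (Suc n) h' t' x)" for x
  proof -
    have "(\<Sum>j<n. s j * F x j) = (\<Sum>j<n. c j * x j)" unfolding c(2)[symmetric] by (simp add: F_def)
    hence "F x n + (\<Sum>j<n. s j * F x j) = tri t' x n" by (simp add: F_def tri_def t'_def)
    moreover have "form_eval n a1 (F x) = form_eval n a1 (f1 x)"
      by (rule form_eval_cong) (simp add: F_def)
    ultimately have "form_eval (Suc n) a0 (F x) = of_real (\<alpha> * (cmod (tri t' x n))\<^sup>2) + of_real (diag_eval n h t x)"
      unfolding sc(6) ih(4) by simp
    also have "\<dots> = of_real (diag_eval n h' t' x + \<alpha> * (cmod (tri t' x n))\<^sup>2)"
      by (simp add: low)
    also have "diag_eval n h' t' x + \<alpha> * (cmod (tri t' x n))\<^sup>2 = diag_eval (Suc n) h' t' x"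
      by (simp add: diag_eval_def h'_def)
    finally show ?thesis .
  qed
  have "aut (Suc n) (\<lambda>x. f0 (F x)) (\<lambda>x. G (g0 x))" by (rule aut_comp[OF f0(1) F])
  moreover have "\<forall>i<Suc n. h' i > 0" using ih(2) sc(1) by (simp add: h'_def less_Suc_eq)
  moreover have "\<forall>i<Suc n. \<forall>j<i. t' i j \<in> E" using ih(3) c(1) by (simp add: t'_def less_Suc_eq)
  moreover have "\<forall>x. form_eval (Suc n) a (f0 (F x)) = of_real (diag_eval (Suc n) h' t' x)"
    unfolding a0(2) eq0 by simp
  moreover have "\<forall>k<Suc n. \<forall>x. (\<forall>i<Suc n. x i \<in> \<O>) \<longrightarrow> (\<exists>i\<le>k. x i \<noteq> 0) \<longrightarrow> h' k \<le> diag_eval (Suc k) h' t' x"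
  proof (intro allI impI)
    fix k x assume k: "k < Suc n" and x: "\<forall>i<Suc n. x i \<in> \<O>" "\<exists>i\<le>k. x i \<noteq> 0"
    show "h' k \<le> diag_eval (Suc k) h' t' x"
    proof (cases "k = n")
      case True
      have "\<alpha> \<le> Re (form_eval (Suc n) a0 (F x))"
        using x True aut_mem[OF F] by (intro min0 aut_nonzero[OF F]) (auto simp: less_Suc_eq_le)
      thus ?thesis unfolding eq0 using True by (simp add: h'_def)
    next
      case False
      hence "k < n" using k by simp
      moreover have "\<forall>i<n. x i \<in> \<O>" using x(1) by simp
      ultimately have "h k \<le> diag_eval (Suc k) h t x" using x(2) by (intro ih(5))
      thus ?thesis using \<open>k < n\<close> by (simp add: low) (simp add: h'_def)
    qed
  qed
  ultimately show ?case
    unfolding hkz_basis_def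
    by (intro exI[of _ "\<lambda>x. f0 (F x)"] exI[of _ "\<lambda>x. G (g0 x)"] exI[of _ h'] exI[of _ t'] conjI)
qed

end

section \<open>Minkowski bounds for the Gram-Schmidt lengths\<close>

lemma sum_lessThan_split:
  fixes g :: "nat \<Rightarrow> 'a :: comm_monoid_add"
  shows "(\<Sum>q<a + b. g q) = (\<Sum>q<a. g q) + (\<Sum>q<b. g (a + q))"
  by (induction b) (simp_all add: add.assoc)

lemma tri_diff: "tri t (\<lambda>i. x i - y i) i = tri t x i - tri t y i"
  by (simp add: tri_def algebra_simps sum_subtractf)

lemma same_cell_dist:
  assumes "l > 0" "\<lfloor>Re z / l\<rfloor> = \<lfloor>Re z' / l\<rfloor>" "\<lfloor>Im z / l\<rfloor> = \<lfloor>Im z' / l\<rfloor>"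
  shows "cmod (z - z') \<le> 2 * l"
proof -
  have *: "\<bar>a - b\<bar> \<le> l" if "\<lfloor>a / l\<rfloor> = \<lfloor>b / l\<rfloor>" for a b :: real
  proof -
    have "a / l - b / l < 1" "b / l - a / l < 1" using that by linarith+
    hence "a - b < l" "b - a < l" using assms(1) by (simp_all add: field_simps)
    thus ?thesis by linarith
  qed
  have "cmod (z - z') \<le> \<bar>Re (z - z')\<bar> + \<bar>Im (z - z')\<bar>" by (rule cmod_le)
  also have "\<dots> \<le> 2 * l" using *[OF assms(2)] *[OF assms(3)] by simp
  finally show ?thesis .
qed

text \<open>The new term exceeds the new mean by at most g, so passing from index k to k + 1 raises
  the running mean by at most g / (k + 1). The resulting harmonic sum is the source of one of the
  two factors ln n in the exponent; the other is g itself.\<close>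

lemma average_growth_bound:
  fixes u :: "nat \<Rightarrow> real"
  assumes g: "g \<ge> 0" and le: "\<And>k. k \<le> N \<Longrightarrow> u k \<le> g + (\<Sum>i\<le>k. u i) / (real k + 1)"
    and k: "k \<le> N"
  shows "u k \<le> u 0 + g * (1 + harm k)"
proof -
  have avg: "(\<Sum>i\<le>k. u i) / (real k + 1) \<le> u 0 + g * harm k" if "k \<le> N" for k
    using that
  proof (induction k)
    case 0
    show ?case by (simp add: harm_def)
  next
    case (Suc k)
    define S where "S = (\<Sum>i\<le>k. u i)"
    have "u (Suc k) \<le> g + (S + u (Suc k)) / (real k + 2)"
      using le[OF Suc.prems] by (simp add: S_def add.commute)
    hence "(real k + 2) * u (Suc k) \<le> (real k + 2) * g + (S + u (Suc k))"
      by (simp add: field_simps)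
    hence "(real k + 1) * (S + u (Suc k)) \<le> (real k + 2) * (S + g)"
      by (simp add: algebra_simps)
    hence "(S + u (Suc k)) / (real k + 2) \<le> (S + g) / (real k + 1)"
      by (simp add: divide_simps mult.commute)
    also have "\<dots> = S / (real k + 1) + g * (1 / (real k + 1))" by (simp add: add_divide_distrib)
    also have "\<dots> \<le> u 0 + g * harm k + g * (1 / (real k + 1))"
      using Suc unfolding S_def by simp
    also have "\<dots> = u 0 + g * harm (Suc k)" by (simp add: harm_Suc field_simps)
    finally show ?case by (simp add: S_def add.commute)
  qed
  show ?thesis using le[OF k] avg[OF k] by (simp add: algebra_simps)
qed

context integral_field
begin

text \<open>Real multiples of field elements are what can be rounded uniformly: over the rationals
  they lie on the real line, where the integers are dense enough, unlike in the complex
  plane.\<close>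

lemma rounding_integer:
  assumes "x \<in> E" shows "\<exists>c\<in>\<O>. cmod (of_real r * x - c) \<le> \<rho>"
proof -
  obtain m m' where m: "cmod (of_real r * x - (of_int m + of_int m' * w)) \<le> \<rho>"
    using rounding[OF assms] by blast
  have "of_int m + of_int m' * w \<in> \<O>" by (intro O_add O_mult O_of_int w_O)
  thus ?thesis using m by blast
qed

lemma tri_mem:
  assumes "\<And>j. j < i \<Longrightarrow> t i j \<in> E" "\<And>j. x j \<in> E" shows "tri t x i \<in> E"
  unfolding tri_def using assms by (intro E_add subsemiring_sum E_semiring E_mult) auto

text \<open>By triangularity, coordinate n can be rounded once the earlier ones are fixed, as in the
  nearest plane procedure.\<close>

lemma tri_approx:
  assumes "\<And>i j. i < n \<Longrightarrow> j < i \<Longrightarrow> t i j \<in> E" "\<And>i. z i \<in> E"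
  shows "\<exists>x. (\<forall>i. x i \<in> \<O>) \<and> (\<forall>i<n. cmod (tri t x i - z i) \<le> \<rho>)"
  using assms(1)
proof (induction n)
  case 0
  show ?case using O_0 by (intro exI[of _ "\<lambda>_. 0"]) auto
next
  case (Suc n)
  then obtain x where x: "\<And>i. x i \<in> \<O>" "\<And>i. i < n \<Longrightarrow> cmod (tri t x i - z i) \<le> \<rho>"
    by (auto simp: less_Suc_eq)
  have "z n - (\<Sum>j<n. t n j * x j) \<in> E"
    using assms(2) Suc.prems[of n] x(1) O_subset
    by (intro E_diff subsemiring_sum E_semiring E_mult) auto
  from rounding_integer[OF this, of 1] obtain c where c: "c \<in> \<O>" "cmod (z n - (\<Sum>j<n. t n j * x j) - c) \<le> \<rho>"
    by auto
  define y where "y = x(n := c)"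
  have "cmod (tri t y i - z i) \<le> \<rho>" if "i < Suc n" for i
  proof (cases "i = n")
    case True
    have "(\<Sum>j<n. t n j * y j) = (\<Sum>j<n. t n j * x j)" by (intro sum.cong) (auto simp: y_def)
    hence "tri t y i - z i = - (z n - (\<Sum>j<n. t n j * x j) - c)"
      using True by (simp add: tri_def y_def)
    thus ?thesis using c(2) by (simp only: norm_minus_cancel)
  next
    case False
    hence "tri t y i = tri t x i" using that by (intro tri_cong) (auto simp: y_def)
    thus ?thesis using x(2)[of i] False that by simp
  qed
  moreover have "y i \<in> \<O>" for i using x(1) c(1) by (simp add: y_def)
  ultimately show ?case by blast
qed

text \<open>Four times the factor 9 \<rho>^2 in the radius D of
  \<open>minkowski_linear_forms\<close>; the four comes from \<open>few_cells\<close>.\<close>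

definition \<kappa> :: real where "\<kappa> = 36 * \<rho>\<^sup>2"

lemma kappa_ge_1: "\<kappa> \<ge> 1"
proof -
  have "1\<^sup>2 \<le> \<rho>\<^sup>2" using rho_ge_1 by (intro power_mono) auto
  thus ?thesis by (simp add: \<kappa>_def)
qed

text \<open>Pigeonhole principle: a large box contains more lattice points than cells of the required
  size.\<close>

lemma minkowski_linear_forms:
  assumes n: "n > 0" and t: "\<And>i j. i < n \<Longrightarrow> j < i \<Longrightarrow> t i j \<in> E"
    and l: "\<And>i. i < n \<Longrightarrow> l i > 0" and prod: "(\<Prod>i<n. l i) \<ge> \<kappa> ^ n"
  shows "\<exists>x. (\<forall>i. x i \<in> \<O>) \<and> (\<exists>i<n. x i \<noteq> 0) \<and> (\<forall>i<n. cmod (tri t x i) \<le> 2 * l i)"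
proof -
  \<comment> \<open>Large enough that every \<open>l i\<close> is at most D, which
    \<open>few_cells\<close> requires.\<close>
  define L where "L = nat \<lceil>\<Sum>i<n. l i\<rceil> + 1"
  \<comment> \<open>Since N > 2 \<rho>, the targets N * \<mu> of different \<mu> are more than two
    rounding errors apart, so they receive different lattice points.\<close>
  define N where "N = nat \<lceil>2 * \<rho>\<rceil> + 1"
  \<comment> \<open>Bounds all values \<open>tri t (X \<mu>) i\<close>: the target has size at most
    4 \<rho> * 2 \<rho> * L, and the rounding error \<rho> is at most \<rho>^2 * L.\<close>
  define D where "D = 9 * \<rho>\<^sup>2 * L"
  have L1: "real L \<ge> 1" by (simp add: L_def)
  have N1: "real N > 2 * \<rho>" "real N \<le> 4 * \<rho>" using rho_ge_1 unfolding N_def by linarith+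
  have rho2: "\<rho> \<le> \<rho>\<^sup>2" "1 \<le> \<rho>\<^sup>2" using rho_ge_1 by (simp_all add: self_le_power)
  have lD: "l i \<le> D" if "i < n" for i
  proof -
    have "l i \<le> (\<Sum>i<n. l i)" using that l by (intro member_le_sum) (auto intro: less_imp_le)
    also have "\<dots> \<le> real L" unfolding L_def by linarith
    also have "real L = 1 * real L" by simp
    also have "\<dots> \<le> (9 * \<rho>\<^sup>2) * real L" using rho2 by (intro mult_right_mono) auto
    finally show ?thesis by (simp add: D_def)
  qed
  obtain Z where Z: "Z \<subseteq> \<O>" "finite Z" "card Z = (2 * L + 1) ^ \<delta>" "\<And>z. z \<in> Z \<Longrightarrow> cmod z \<le> 2 * \<rho> * L"
    using many_integers[of L] by blast
  define M where "M = PiE {..<n} (\<lambda>_. Z)"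
  have "\<forall>\<mu>\<in>M. \<exists>x. (\<forall>i. x i \<in> \<O>) \<and> (\<forall>i<n. cmod (tri t x i - of_nat N * \<mu> i) \<le> \<rho>)"
  proof
    fix \<mu> assume that: "\<mu> \<in> M"
    define z where "z i = (if i < n then of_nat N * \<mu> i else 0)" for i
    have "z i \<in> E" for i
    proof (cases "i < n")
      case True
      hence "\<mu> i \<in> \<O>" using that Z(1) unfolding M_def by auto
      thus ?thesis using O_mult[OF O_of_nat] O_subset True unfolding z_def by auto
    qed (auto simp: z_def E_0)
    from tri_approx[of n t z, OF t this]
    show "\<exists>x. (\<forall>i. x i \<in> \<O>) \<and> (\<forall>i<n. cmod (tri t x i - of_nat N * \<mu> i) \<le> \<rho>)"
      unfolding z_def by auto
  qed
  from bchoice[OF this] obtain X where X: "\<And>\<mu> i. \<mu> \<in> M \<Longrightarrow> X \<mu> i \<in> \<O>"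
    "\<And>\<mu> i. \<mu> \<in> M \<Longrightarrow> i < n \<Longrightarrow> cmod (tri t (X \<mu>) i - of_nat N * \<mu> i) \<le> \<rho>" by blast
  define cell where "cell i z = (\<lfloor>Re z / l i\<rfloor>, \<lfloor>Im z / l i\<rfloor>)" for i z
  define B where "B = PiE {..<n} (\<lambda>i. cell i ` {z\<in>E. cmod z \<le> D})"
  define C where "C \<mu> = (\<lambda>i\<in>{..<n}. cell i (tri t (X \<mu>) i))" for \<mu>
  have fin: "finite (cell i ` {z\<in>E. cmod z \<le> D})" and
    cards: "real (card (cell i ` {z\<in>E. cmod z \<le> D})) \<le> (4 * D / l i) ^ \<delta>" if "i < n" for i
    using few_cells[OF l[OF that] lD[OF that]] unfolding cell_def by auto
  have finB: "finite B" unfolding B_def using fin by (intro finite_PiE) auto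
  have CM: "C ` M \<subseteq> B"
  proof
    fix c assume "c \<in> C ` M"
    then obtain \<mu> where \<mu>: "\<mu> \<in> M" "c = C \<mu>" by blast
    have "tri t (X \<mu>) i \<in> E \<and> cmod (tri t (X \<mu>) i) \<le> D" if i: "i < n" for i
    proof
      show "tri t (X \<mu>) i \<in> E" using t[OF i] X(1)[OF \<mu>(1)] O_subset by (intro tri_mem) auto
      have "\<mu> i \<in> Z" using \<mu>(1) i unfolding M_def by auto
      hence "cmod (of_nat N * \<mu> i) \<le> 4 * \<rho> * (2 * \<rho> * L)"
        using N1(2) Z(4) rho_ge_1 unfolding norm_mult by (intro mult_mono) auto
      moreover have "cmod (tri t (X \<mu>) i) \<le> cmod (tri t (X \<mu>) i - of_nat N * \<mu> i) + cmod (of_nat N * \<mu> i)"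
        by (metis add.commute diff_add_cancel norm_triangle_ineq)
      moreover have "cmod (tri t (X \<mu>) i - of_nat N * \<mu> i) \<le> \<rho>" by (rule X(2)[OF \<mu>(1) i])
      moreover have "\<rho> \<le> \<rho>\<^sup>2 * L" using mult_mono[OF rho2(1) L1] rho_ge_1 by simp
      ultimately show "cmod (tri t (X \<mu>) i) \<le> D"
        unfolding D_def by (simp add: power2_eq_square)
    qed
    thus "c \<in> B" unfolding \<mu>(2) C_def B_def by auto
  qed
  \<comment> \<open>Per dimension there are at most \<kappa> * L / l i cells against 2 * L + 1
    integers. The lower bound on the product of the \<open>l i\<close> absorbs \<kappa> ^ n, and L <
    2 * L + 1 makes the comparison strict.\<close>
  have "real (card B) = (\<Prod>i<n. real (card (cell i ` {z\<in>E. cmod z \<le> D})))"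
    unfolding B_def by (subst card_PiE) auto
  also have "\<dots> \<le> (\<Prod>i<n. (4 * D / l i) ^ \<delta>)" using cards by (intro prod_mono) auto
  also have "\<dots> = (\<Prod>i<n. 4 * D / l i) ^ \<delta>" by (rule prod_power_distrib[symmetric])
  also have "(\<Prod>i<n. 4 * D / l i) = (4 * D) ^ n / (\<Prod>i<n. l i)" by (simp add: prod_dividef)
  also have "4 * D = \<kappa> * L" by (simp add: D_def \<kappa>_def)
  also have "((\<kappa> * L) ^ n / (\<Prod>i<n. l i)) ^ \<delta> \<le> (real L ^ n) ^ \<delta>"
  proof (rule power_mono)
    have pos: "(\<Prod>i<n. l i) > 0" using l by (intro prod_pos) auto
    have "(\<kappa> * L) ^ n \<le> real L ^ n * (\<Prod>i<n. l i)"
      using mult_left_mono[OF prod, of "real L ^ n"] by (simp add: power_mult_distrib mult.commute)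
    thus "(\<kappa> * L) ^ n / (\<Prod>i<n. l i) \<le> real L ^ n" using pos by (simp add: divide_simps)
    show "0 \<le> (\<kappa> * L) ^ n / (\<Prod>i<n. l i)" using pos kappa_ge_1 by auto
  qed
  also have "\<dots> < ((2 * real L + 1) ^ n) ^ \<delta>"
    using n dim_pos by (intro power_strict_mono) auto
  also have "\<dots> = real (card M)"
    unfolding M_def using Z(2,3) by (subst card_PiE) (auto simp: power_mult[symmetric] mult.commute add.commute)
  finally have "card B < card M" by simp
  hence "\<not> inj_on C M" using card_inj_on_le[OF _ CM finB] by auto
  then obtain \<mu> \<nu> where mn: "\<mu> \<in> M" "\<nu> \<in> M" "\<mu> \<noteq> \<nu>" "C \<mu> = C \<nu>" unfolding inj_on_def by blast
  define x where "x i = X \<mu> i - X \<nu> i" for i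
  have tx: "tri t x i = tri t (X \<mu>) i - tri t (X \<nu>) i" for i
    unfolding x_def by (rule tri_diff)
  have "x i \<in> \<O>" for i unfolding x_def by (intro O_diff X mn)
  moreover have "cmod (tri t x i) \<le> 2 * l i" if i: "i < n" for i
  proof -
    have "cell i (tri t (X \<mu>) i) = cell i (tri t (X \<nu>) i)"
      using fun_cong[OF mn(4), of i] i unfolding C_def by simp
    thus ?thesis unfolding tx cell_def by (intro same_cell_dist l i) auto
  qed
  moreover have "\<exists>i<n. x i \<noteq> 0"
  proof (rule ccontr)
    assume "\<not> ?thesis"
    hence x0: "x i = 0" if "i < n" for i using that by blast
    obtain i where i: "i < n" "\<mu> i \<noteq> \<nu> i"
      using mn(1-3) unfolding M_def by (metis PiE_ext lessThan_iff)
    have "tri t x i = 0" unfolding tri_def using x0 i(1) by simp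
    hence eq: "tri t (X \<mu>) i = tri t (X \<nu>) i" unfolding tx by simp
    have "\<mu> i \<in> \<O>" "\<nu> i \<in> \<O>" using mn(1,2) i(1) Z(1) unfolding M_def by auto
    hence "cmod (\<mu> i - \<nu> i) \<ge> 1" using i(2) by (intro O_norm O_diff) auto
    hence "real N * 1 \<le> real N * cmod (\<mu> i - \<nu> i)" by (intro mult_left_mono) auto
    also have "\<dots> = cmod (of_nat N * \<mu> i - of_nat N * \<nu> i)"
      by (metis norm_mult norm_of_nat right_diff_distrib)
    also have "of_nat N * \<mu> i - of_nat N * \<nu> i
        = (tri t (X \<nu>) i - of_nat N * \<nu> i) - (tri t (X \<mu>) i - of_nat N * \<mu> i)"
      using eq by simp
    also have "cmod \<dots> \<le> cmod (tri t (X \<nu>) i - of_nat N * \<nu> i) + cmod (tri t (X \<mu>) i - of_nat N * \<mu> i)"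
      by (rule norm_triangle_ineq4)
    also have "\<dots> \<le> \<rho> + \<rho>"
      by (intro add_mono X(2) mn i)
    finally show False using N1(1) by simp
  qed
  ultimately show ?thesis by blast
qed

text \<open>A Hermite-type bound, linear in n. The half-widths \<open>l i\<close> make all terms h i
  * (l i)^2 equal, and taking the 2n-th root of the product of the \<open>h i\<close> for P gives
  the box exactly the size that Minkowski's theorem asks for.\<close>

lemma short_vector:
  assumes n: "n > 0" and t: "\<And>i j. i < n \<Longrightarrow> j < i \<Longrightarrow> t i j \<in> E" and h: "\<And>i. i < n \<Longrightarrow> h i > 0"
  shows "\<exists>x. (\<forall>i. x i \<in> \<O>) \<and> (\<exists>i<n. x i \<noteq> 0) \<and>
    diag_eval n h t x \<le> 4 * real n * \<kappa>\<^sup>2 * (\<Prod>i<n. h i) powr (1 / real n)"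
proof -
  define P where "P = (\<Prod>i<n. h i) powr (1 / (2 * real n))"
  define l where "l i = \<kappa> * P / sqrt (h i)" for i
  have pos: "(\<Prod>i<n. h i) > 0" using h by (intro prod_pos) auto
  have P: "P > 0" unfolding P_def by (subst powr_gt_zero) (use pos in linarith)
  have sqrt_prod: "sqrt (\<Prod>i<k. h i) = (\<Prod>i<k. sqrt (h i))" for k
    by (induction k) (simp_all add: real_sqrt_mult)
  have "P ^ n = P powr n" using P by (simp add: powr_realpow)
  also have "\<dots> = (\<Prod>i<n. h i) powr (1/2)" unfolding P_def powr_powr using n by simp
  also have "\<dots> = (\<Prod>i<n. sqrt (h i))" using pos by (simp add: powr_half_sqrt sqrt_prod less_imp_le)
  finally have Pn: "P ^ n = (\<Prod>i<n. sqrt (h i))" .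
  have "(\<Prod>i<n. l i) = \<kappa> ^ n * (P ^ n / (\<Prod>i<n. sqrt (h i)))"
    unfolding l_def by (simp add: prod_dividef power_mult_distrib)
  also have "P ^ n / (\<Prod>i<n. sqrt (h i)) = 1"
    using P unfolding Pn[symmetric] by simp
  finally have prod: "(\<Prod>i<n. l i) \<ge> \<kappa> ^ n" by simp
  have lpos: "l i > 0" if "i < n" for i unfolding l_def using P h[OF that] kappa_ge_1 by simp
  obtain x where x: "\<And>i. x i \<in> \<O>" "\<exists>i<n. x i \<noteq> 0" "\<And>i. i < n \<Longrightarrow> cmod (tri t x i) \<le> 2 * l i"
    using minkowski_linear_forms[of n t l, OF n t lpos prod] by blast
  have "diag_eval n h t x \<le> (\<Sum>i<n. 4 * \<kappa>\<^sup>2 * P\<^sup>2)"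
    unfolding diag_eval_def
  proof (rule sum_mono)
    fix i assume "i \<in> {..<n}"
    hence i: "i < n" by simp
    have "h i * (cmod (tri t x i))\<^sup>2 \<le> h i * (2 * l i)\<^sup>2"
      using x(3)[OF i] h[OF i] by (intro mult_left_mono power_mono) auto
    also have "\<dots> = 4 * \<kappa>\<^sup>2 * P\<^sup>2"
      using h[OF i] unfolding l_def by (simp add: power_mult_distrib power_divide)
    finally show "h i * (cmod (tri t x i))\<^sup>2 \<le> 4 * \<kappa>\<^sup>2 * P\<^sup>2" .
  qed
  also have "\<dots> = 4 * real n * \<kappa>\<^sup>2 * P\<^sup>2" by simp
  also have "P\<^sup>2 = P powr 2" using P by simp
  also have "\<dots> = (\<Prod>i<n. h i) powr (1 / real n)" unfolding P_def powr_powr by simp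
  finally show ?thesis using x(1,2) by blast
qed

text \<open>Minimality at index j + m is tested on vectors that vanish below j. For these the first
  j squares disappear, so a short vector of the block is a competitor.\<close>

lemma hkz_block:
  assumes hkz: "hkz_basis n a f g h t" and k: "j + m < n"
  shows "h (j + m) \<le> 4 * real (Suc m) * \<kappa>\<^sup>2 * (\<Prod>i<Suc m. h (j + i)) powr (1 / real (Suc m))"
proof -
  define h' where "h' i = h (j + i)" for i
  define t' where "t' i q = t (j + i) (j + q)" for i q
  have "h' i > 0" if "i < Suc m" for i unfolding h'_def using that k by (intro hkz_basisD(2)[OF hkz]) auto
  moreover have "t' i q \<in> E" if "i < Suc m" "q < i" for i q
    unfolding t'_def using that k by (intro hkz_basisD(3)[OF hkz]) auto
  ultimately obtain x' where x': "\<And>i. x' i \<in> \<O>" "\<exists>i<Suc m. x' i \<noteq> 0"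
    "diag_eval (Suc m) h' t' x' \<le> 4 * real (Suc m) * \<kappa>\<^sup>2 * (\<Prod>i<Suc m. h' i) powr (1 / real (Suc m))"
    using short_vector[of "Suc m" t' h'] by blast
  define x where "x i = (if i < j then 0 else x' (i - j))" for i
  have low: "tri t x i = 0" if "i < j" for i using that by (simp add: tri_def x_def)
  have high: "tri t x (j + i) = tri t' x' i" for i
    unfolding tri_def sum_lessThan_split by (simp add: x_def t'_def)
  have "diag_eval (j + Suc m) h t x = diag_eval (Suc m) h' t' x'"
    unfolding diag_eval_def sum_lessThan_split by (simp add: low high h'_def del: sum.lessThan_Suc)
  moreover have "h (j + m) \<le> diag_eval (Suc (j + m)) h t x"
  proof (rule hkz_basisD(5)[OF hkz k])
    show "\<forall>i<n. x i \<in> \<O>" using x'(1) O_0 by (simp add: x_def)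
    obtain i where "i < Suc m" "x' i \<noteq> 0" using x'(2) by blast
    thus "\<exists>i\<le>j + m. x i \<noteq> 0" by (intro exI[of _ "j + i"]) (simp add: x_def)
  qed
  ultimately show ?thesis using x'(3) by (simp add: h'_def)
qed

text \<open>The classical n^(O(ln n)) bound for Korkin-Zolotarev bases. In logarithms,
  \<open>hkz_block\<close> says that each term exceeds the mean of the terms from j up to it by at
  most ln (4 n \<kappa>^2), and 1 + harm N is at most 2 + ln n. The bound is one-sided: nothing
  prevents \<open>h\<close> from dropping sharply between j and k.\<close>

lemma hkz_growth:
  assumes hkz: "hkz_basis n a f g h t" and jk: "j \<le> k" "k < n"
  shows "h k \<le> h j * exp (ln (4 * real n * \<kappa>\<^sup>2) * (2 + ln n))"
proof -
  define c where "c = ln (4 * real n * \<kappa>\<^sup>2)"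
  define N where "N = k - j"
  define u where "u i = ln (h (j + i))" for i
  have n1: "real n \<ge> 1" using jk by simp
  have k1: "1 \<le> \<kappa>\<^sup>2" using kappa_ge_1 by simp
  have arg1: "4 * real n * \<kappa>\<^sup>2 \<ge> 1" using mult_mono[OF n1 k1] by simp
  have c0: "c \<ge> 0" unfolding c_def using arg1 by simp
  have hpos: "h i > 0" if "i < n" for i using hkz_basisD(2)[OF hkz that] .
  have "u i \<le> c + (\<Sum>q\<le>i. u q) / (real i + 1)" if i: "i \<le> N" for i
  proof -
    have lt: "j + i < n" using i jk unfolding N_def by simp
    have hq: "h (j + q) > 0" if "q \<in> {..<Suc i}" for q using lt that by (intro hpos) auto
    have ppos: "(\<Prod>q<Suc i. h (j + q)) > 0" by (rule prod_pos) (use hq in blast)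
    have pw: "(\<Prod>q<Suc i. h (j + q)) powr (1 / real (Suc i)) > 0"
      by (subst powr_gt_zero) (use ppos in linarith)
    have "h (j + i) \<le> 4 * real (Suc i) * \<kappa>\<^sup>2 * (\<Prod>q<Suc i. h (j + q)) powr (1 / real (Suc i))"
      by (rule hkz_block[OF hkz lt])
    also have "\<dots> \<le> 4 * real n * \<kappa>\<^sup>2 * (\<Prod>q<Suc i. h (j + q)) powr (1 / real (Suc i))"
      using lt by (intro mult_right_mono) auto
    finally have "u i \<le> ln (4 * real n * \<kappa>\<^sup>2 * (\<Prod>q<Suc i. h (j + q)) powr (1 / real (Suc i)))"
      unfolding u_def using hpos[OF lt] by (intro ln_mono) auto
    also have "\<dots> = c + ln ((\<Prod>q<Suc i. h (j + q)) powr (1 / real (Suc i)))"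
      unfolding c_def by (rule ln_mult_pos[OF _ pw]) (use arg1 in linarith)
    also have "ln ((\<Prod>q<Suc i. h (j + q)) powr (1 / real (Suc i))) = ln (\<Prod>q<Suc i. h (j + q)) / (real i + 1)"
      unfolding ln_powr by (simp only: of_nat_Suc add.commute times_divide_eq_left mult_1_left)
    also have "ln (\<Prod>q<Suc i. h (j + q)) = (\<Sum>q<Suc i. u q)"
      unfolding u_def by (rule ln_prod[OF finite_lessThan]) (rule less_imp_neq[THEN not_sym, OF hq])
    finally show ?thesis by (simp add: lessThan_Suc_atMost)
  qed
  from average_growth_bound[OF c0 this, of N N] have "u N \<le> u 0 + c * (1 + harm N)" by simp
  also have "harm N \<le> 1 + ln (real n)"
  proof (cases "N = 0")
    case True
    thus ?thesis using n1 by (simp add: harm_def)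
  next
    case False
    then obtain M where M: "N = Suc M" by (cases N) auto
    have "harm (Suc M) - ln (real (Suc M)) \<le> harm (Suc 0) - ln (real (Suc 0))"
      using decseqD[OF decseq_harm_diff_ln, of 0 M] by simp
    hence "harm N \<le> ln (real N) + 1" by (simp add: M harm_def)
    also have "ln (real N) \<le> ln (real n)" using False jk unfolding N_def by (intro ln_mono) auto
    finally show ?thesis by simp
  qed
  finally have "u N \<le> u 0 + c * (2 + ln (real n))" using c0 by (simp add: mult_left_mono)
  hence "ln (h k) \<le> ln (h j) + c * (2 + ln (real n))" using jk(1) by (simp add: u_def N_def)
  hence "exp (ln (h k)) \<le> exp (ln (h j) + c * (2 + ln (real n)))" by simp
  thus ?thesis using hpos[OF jk(2)] hpos[of j] jk by (simp add: exp_add c_def)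
qed

end

section \<open>Seysen reduction of unipotent matrices\<close>

lemma linear_over_plus:
  assumes "linear_over S n \<phi>" shows "\<phi> (\<lambda>i. x i + y i) = \<phi> x + \<phi> y"
  using assms by (elim linear_overE) (simp add: algebra_simps sum.distrib)

context integral_field
begin

lemma linear_over_tri:
  assumes "\<And>j. j < i \<Longrightarrow> t i j \<in> E" "i < n"
  shows "linear_over E n (\<lambda>x. tri t x i)"
  unfolding tri_def
proof (intro linear_over_add linear_over_sum E_semiring linear_over_coord assms(2))
  fix j assume "j \<in> {..<i}"
  thus "linear_over E n (\<lambda>x. t i j * x j)"
    using assms by (intro linear_over_scale linear_over_coord E_semiring) auto
qed

lemma tri_inverse:
  assumes "\<And>i j. i < n \<Longrightarrow> j < i \<Longrightarrow> t i j \<in> E"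
  shows "\<exists>r. (\<forall>i<n. linear_over E n (\<lambda>y. r y i)) \<and> (\<forall>y. \<forall>i<n. tri t (r y) i = y i)"
  using assms
proof (induction n)
  case (Suc n)
  have "\<exists>r. (\<forall>i<n. linear_over E n (\<lambda>y. r y i)) \<and> (\<forall>y. \<forall>i<n. tri t (r y) i = y i)"
    by (rule Suc.IH) (use Suc.prems in auto)
  then obtain r where r: "\<And>i. i < n \<Longrightarrow> linear_over E n (\<lambda>y. r y i)" "\<And>y i. i < n \<Longrightarrow> tri t (r y) i = y i"
    by blast
  define r' where "r' y i = (if i < n then r y i else y n + (- 1) * (\<Sum>j<n. t n j * r y j))" for y i
  have "linear_over E (Suc n) (\<lambda>y. r' y i)" if "i < Suc n" for i
  proof (cases "i < n")
    case True
    thus ?thesis using linear_over_mono[OF E_semiring r(1)[OF True], of "Suc n"] by (simp add: r'_def)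
  next
    case False
    have "linear_over E n (\<lambda>y. \<Sum>j<n. t n j * r y j)"
      by (rule linear_over_sum[OF E_semiring], rule linear_over_scale[OF E_semiring])
         (use r(1) Suc.prems in auto)
    hence "linear_over E (Suc n) (\<lambda>y. \<Sum>j<n. t n j * r y j)"
      by (rule linear_over_mono[OF E_semiring]) simp
    hence "linear_over E (Suc n) (\<lambda>y. y n + (- 1) * (\<Sum>j<n. t n j * r y j))"
      by (intro linear_over_add[OF E_semiring] linear_over_scale[OF E_semiring] linear_over_coord[OF E_semiring])
         (auto intro: E_minus E_1)
    thus ?thesis using False by (simp add: r'_def)
  qed
  moreover have "tri t (r' y) i = y i" if "i < Suc n" for y i
  proof (cases "i < n")
    case True
    have "tri t (r' y) i = tri t (r y) i" by (rule tri_cong) (use True in \<open>auto simp: r'_def\<close>)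
    thus ?thesis using r(2)[OF True] by simp
  next
    case False
    hence i: "i = n" using that by simp
    have "(\<Sum>j<n. t n j * r' y j) = (\<Sum>j<n. t n j * r y j)" by (intro sum.cong) (auto simp: r'_def)
    thus ?thesis unfolding i tri_def by (simp add: r'_def)
  qed
  ultimately show ?case by blast
qed auto

text \<open>The matrix of \<open>tri t\<close> after \<open>u\<close> and its inverse both have
  operator norm at most C for the maximum norm, so a basis and its dual are controlled
  together.\<close>

definition reducing :: "nat \<Rightarrow> (nat \<Rightarrow> nat \<Rightarrow> complex) \<Rightarrow> real \<Rightarrow> ((nat \<Rightarrow> complex) \<Rightarrow> nat \<Rightarrow> complex) \<Rightarrow>
    ((nat \<Rightarrow> complex) \<Rightarrow> nat \<Rightarrow> complex) \<Rightarrow> bool" where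
  "reducing n t C u v \<longleftrightarrow> aut n u v \<and>
    (\<forall>x M. (\<forall>i<n. cmod (x i) \<le> M) \<longrightarrow> (\<forall>i<n. cmod (tri t (u x) i) \<le> C * M)) \<and>
    (\<forall>x M. (\<forall>i<n. cmod (tri t (u x) i) \<le> M) \<longrightarrow> (\<forall>i<n. cmod (x i) \<le> C * M))"

lemma reducingD:
  assumes "reducing n t C u v"
  shows "aut n u v" "(\<And>i. i < n \<Longrightarrow> cmod (x i) \<le> M) \<Longrightarrow> i < n \<Longrightarrow> cmod (tri t (u x) i) \<le> C * M"
    "(\<And>i. i < n \<Longrightarrow> cmod (tri t (u x) i) \<le> M) \<Longrightarrow> i < n \<Longrightarrow> cmod (x i) \<le> C * M"
  using assms unfolding reducing_def by blast+

text \<open>Seysen's block step: after rounding the off-diagonal block relative to the reduced second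
  diagonal block, both the matrix and its inverse grow by the same factor only.\<close>

lemma reducing_block:
  assumes t: "\<And>i j. i < p + m \<Longrightarrow> j < i \<Longrightarrow> t i j \<in> E"
    and r1: "reducing p t C u1 v1" and r2: "reducing m (\<lambda>i j. t (p + i) (p + j)) C u2 v2"
    and C: "C \<ge> 1"
  shows "\<exists>u v. reducing (p + m) t (C * (1 + real p * \<rho>)) u v"
proof -
  define t2 where "t2 = (\<lambda>i j. t (p + i) (p + j))"
  define hi where "hi = (\<lambda>(x::nat\<Rightarrow>complex) i. x (p + i))"
  note a1 = reducingD(1)[OF r1] and a2 = reducingD(1)[OF r2]
  have t2E: "t2 i j \<in> E" if "i < m" "j < i" for i j unfolding t2_def using that by (intro t) auto
  obtain r where r: "\<And>i. i < m \<Longrightarrow> linear_over E m (\<lambda>y. r y i)" "\<And>y i. i < m \<Longrightarrow> tri t2 (r y) i = y i"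
    using tri_inverse[of m t2, OF t2E] by blast
  have linE: "linear_over E n (\<lambda>x. f x i)" if "aut n f g" "i < n" for n f g i
    by (rule linear_over_subset[OF autD(1)[OF that] O_subset])
  \<comment> \<open>In block notation \<Phi> is T21 U1, and the matrix W obtained below is (T2
    U2)^(-1) T21 U1, the off-diagonal block as seen from the reduced second block.\<close>
  define \<Phi> where "\<Phi> z i = (\<Sum>j<p. t (p + i) j * u1 z j)" for z i
  have \<Phi>: "linear_over E p (\<lambda>z. \<Phi> z i)" if "i < m" for i
    unfolding \<Phi>_def
  proof (rule linear_over_sum[OF E_semiring])
    fix j assume "j \<in> {..<p}"
    hence j: "j < p" by simp
    show "linear_over E p (\<lambda>x. t (p + i) j * u1 x j)"
      by (rule linear_over_scale[OF E_semiring linE[OF a1 j]]) (use t that j in auto)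
  qed
  have W: "linear_over E p (\<lambda>z. v2 (r (\<Phi> z)) i)" if i: "i < m" for i
    by (rule linear_over_comp[OF E_semiring linE[OF aut_sym[OF a2] i]],
        rule linear_over_comp[OF E_semiring r(1)], assumption, rule \<Phi>)
  have "\<forall>i. \<exists>W. i < m \<longrightarrow> (\<forall>j<p. W j \<in> E) \<and> (\<forall>z. v2 (r (\<Phi> z)) i = (\<Sum>j<p. W j * z j))"
    using W unfolding linear_over_def fun_eq_iff by blast
  from choice[OF this] obtain W where W: "\<And>i j. i < m \<Longrightarrow> j < p \<Longrightarrow> W i j \<in> E"
    "\<And>i z. i < m \<Longrightarrow> v2 (r (\<Phi> z)) i = (\<Sum>j<p. W i j * z j)" by blast
  have "\<forall>i j. \<exists>c. i < m \<longrightarrow> j < p \<longrightarrow> c \<in> \<O> \<and> cmod (W i j - c) \<le> \<rho>"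
    using rounding_integer[OF W(1), of _ _ 1] by auto
  then obtain c where c: "\<And>i j. i < m \<Longrightarrow> j < p \<Longrightarrow> c i j \<in> \<O>" "\<And>i j. i < m \<Longrightarrow> j < p \<Longrightarrow> cmod (W i j - c i j) \<le> \<rho>"
    by metis
  define y where "y z i = z (p + i) + (\<Sum>j<p. - c i j * z j)" for z i
  define U where "U z i = (if i < p then u1 z i else u2 (y z) (i - p))" for z i
  define V where "V x i = (if i < p then v1 x i else v2 (hi x) (i - p) + (\<Sum>j<p. c (i - p) j * v1 x j))" for x i
  \<comment> \<open>What remains of W after the automorphism has removed its rounding
    \<open>c\<close>; its entries are at most \<rho>.\<close>
  define F where "F z i = (\<Sum>j<p. (W i j - c i j) * z j)" for z i
  have ylin: "linear_over \<O> (p + m) (\<lambda>z. y z i)" if i: "i < m" for i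
    unfolding y_def
  proof (intro linear_over_add linear_over_sum O_semiring)
    show "linear_over \<O> (p + m) (\<lambda>x. x (p + i))" using i by (intro linear_over_coord O_semiring) auto
    fix j assume j: "j \<in> {..<p}"
    show "linear_over \<O> (p + m) (\<lambda>x. - c i j * x j)"
      by (rule linear_over_scale[OF O_semiring linear_over_coord[OF O_semiring]]) (use j i c O_minus in auto)
  qed
  have hilin: "linear_over \<O> (p + m) (\<lambda>z. hi z i)" if "i < m" for i
    unfolding hi_def using that by (intro linear_over_coord O_semiring) auto
  have lin1: "linear_over \<O> (p + m) (\<lambda>z. f z i)" if "aut p f g" "i < p" for f g i
    by (rule linear_over_mono[OF O_semiring autD(1)[OF that]]) simp
  have aut: "aut (p + m) U V"
    unfolding aut_def
  proof (intro allI impI conjI)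
    fix i assume i: "i < p + m"
    show "linear_over \<O> (p + m) (\<lambda>x. U x i)"
    proof (cases "i < p")
      case True
      thus ?thesis unfolding U_def using lin1[OF a1] by simp
    next
      case False
      hence "i - p < m" using i by simp
      from linear_over_comp[OF O_semiring autD(1)[OF a2 this] ylin] show ?thesis
        unfolding U_def using False by simp
    qed
    show "linear_over \<O> (p + m) (\<lambda>x. V x i)"
    proof (cases "i < p")
      case True
      thus ?thesis unfolding V_def using lin1[OF aut_sym[OF a1]] by simp
    next
      case False
      hence ip: "i - p < m" using i by simp
      have "linear_over \<O> (p + m) (\<lambda>x. \<Sum>j<p. c (i - p) j * v1 x j)"
      proof (rule linear_over_sum[OF O_semiring])
        fix j assume "j \<in> {..<p}"
        thus "linear_over \<O> (p + m) (\<lambda>x. c (i - p) j * v1 x j)"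
          using c(1)[OF ip] lin1[OF aut_sym[OF a1]] by (intro linear_over_scale[OF O_semiring]) auto
      qed
      from linear_over_add[OF O_semiring linear_over_comp[OF O_semiring autD(2)[OF a2 ip] hilin] this]
      show ?thesis unfolding V_def using False by simp
    qed
    fix x
    have u1V: "u1 (V x) j = x j" if "j < p" for j
      using linear_over_cong[OF autD(1)[OF a1 that], of "V x" "v1 x"] autD(3)[OF a1 that] by (simp add: V_def)
    have v1U: "v1 (U x) j = x j" if "j < p" for j
      using linear_over_cong[OF autD(2)[OF a1 that], of "U x" "u1 x"] autD(4)[OF a1 that] by (simp add: U_def)
    show "U (V x) i = x i"
    proof (cases "i < p")
      case True
      thus ?thesis using u1V by (simp add: U_def)
    next
      case False
      hence ip: "i - p < m" using i by simp
      have "y (V x) q = v2 (hi x) q" for q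
        unfolding y_def by (simp add: V_def sum_negf)
      hence "y (V x) = v2 (hi x)" by blast
      thus ?thesis using False autD(3)[OF a2 ip, of "hi x"] by (simp add: U_def hi_def)
    qed
    show "V (U x) i = x i"
    proof (cases "i < p")
      case True
      thus ?thesis using v1U by (simp add: V_def)
    next
      case False
      hence ip: "i - p < m" using i by simp
      have "hi (U x) = u2 (y x)" unfolding hi_def U_def by simp
      hence "v2 (hi (U x)) (i - p) = y x (i - p)" using autD(4)[OF a2 ip] by simp
      moreover have "(\<Sum>j<p. c (i - p) j * v1 (U x) j) = (\<Sum>j<p. c (i - p) j * x j)"
        by (intro sum.cong) (use v1U in auto)
      ultimately show ?thesis using False by (simp add: V_def y_def sum_negf)
    qed
  qed
  have low: "tri t (U z) i = tri t (u1 z) i" if "i < p" for z i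
    by (rule tri_cong) (use that in \<open>auto simp: U_def\<close>)
  \<comment> \<open>The new matrix is the block diagonal matrix of T1 U1 and T2 U2 times a unipotent
    one with the single block F. The inverse of the latter has the block - F, hence the same factor
    1 + p * \<rho> for the matrix and its inverse.\<close>
  have high: "tri t (U z) (p + i) = tri t2 (u2 (\<lambda>q. z (p + q) + F z q)) i" if i: "i < m" for z i
  proof -
    have lin: "linear_over E m (\<lambda>x. tri t2 (u2 x) i)"
      by (rule linear_over_comp[OF E_semiring linear_over_tri[of i t2 m] linE[OF a2]]) (use i t2E in auto)
    have "(\<lambda>q. z (p + q) + F z q) = (\<lambda>q. y z q + (\<Sum>j<p. W q j * z j))"
      unfolding F_def y_def by (auto simp: algebra_simps sum_subtractf sum_negf)
    hence "tri t2 (u2 (\<lambda>q. z (p + q) + F z q)) i = tri t2 (u2 (y z)) i + tri t2 (u2 (\<lambda>q. \<Sum>j<p. W q j * z j)) i"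
      using linear_over_plus[OF lin, of "y z" "\<lambda>q. \<Sum>j<p. W q j * z j"] by simp
    also have "tri t2 (u2 (\<lambda>q. \<Sum>j<p. W q j * z j)) i = tri t2 (u2 (v2 (r (\<Phi> z)))) i"
      by (rule linear_over_cong[OF lin]) (simp add: W(2))
    also have "\<dots> = tri t2 (r (\<Phi> z)) i"
      by (rule tri_cong) (use i autD(3)[OF a2] in auto)
    also have "\<dots> = \<Phi> z i" by (rule r(2)[OF i])
    also have "tri t2 (u2 (y z)) i + \<Phi> z i = tri t (U z) (p + i)"
      unfolding tri_def sum_lessThan_split by (simp add: \<Phi>_def U_def t2_def)
    finally show ?thesis by simp
  qed
  have Fbound: "cmod (F z i) \<le> real p * \<rho> * M" if i: "i < m" and z: "\<And>j. j < p \<Longrightarrow> cmod (z j) \<le> M" for z i M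
  proof -
    have "cmod (F z i) \<le> (\<Sum>j<p. \<rho> * M)"
      unfolding F_def
    proof (rule order.trans[OF norm_sum sum_mono])
      fix j assume "j \<in> {..<p}"
      hence j: "j < p" by simp
      have "0 \<le> M" using z[OF j] norm_ge_zero order.trans by blast
      thus "cmod ((W i j - c i j) * z j) \<le> \<rho> * M"
        unfolding norm_mult using c(2)[OF i j] z[OF j] rho_ge_1 by (intro mult_mono) auto
    qed
    thus ?thesis by simp
  qed
  have C1: "C * M \<le> C * (1 + real p * \<rho>) * M" if "M \<ge> 0" for M
  proof -
    have "C * 1 \<le> C * (1 + real p * \<rho>)" using C rho_ge_1 by (intro mult_left_mono) auto
    thus ?thesis using that by (intro mult_right_mono) auto
  qed
  have "cmod (tri t (U x) i) \<le> C * (1 + real p * \<rho>) * M"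
    if x: "\<And>i. i < p + m \<Longrightarrow> cmod (x i) \<le> M" and i: "i < p + m" for x M i
  proof (cases "i < p")
    case True
    have "0 \<le> M" using x[OF i] norm_ge_zero order.trans by blast
    have "cmod (tri t (u1 x) i) \<le> C * M" by (rule reducingD(2)[OF r1 _ True]) (use x in auto)
    thus ?thesis using C1[OF \<open>0 \<le> M\<close>] low[OF True] by simp
  next
    case False
    hence ip: "i - p < m" "p + (i - p) = i" using i by auto
    have "cmod (tri t2 (u2 (\<lambda>q. x (p + q) + F x q)) (i - p)) \<le> C * (M + real p * \<rho> * M)"
      unfolding t2_def
    proof (rule reducingD(2)[OF r2 _ ip(1)])
      fix q assume q: "q < m"
      show "cmod (x (p + q) + F x q) \<le> M + real p * \<rho> * M"
        using x[of "p + q"] q Fbound[OF q, of x M] x by (intro order.trans[OF norm_triangle_ineq] add_mono) auto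
    qed
    thus ?thesis using high[OF ip(1), of x] ip(2) by (simp add: algebra_simps)
  qed
  moreover have "cmod (x i) \<le> C * (1 + real p * \<rho>) * M"
    if x: "\<And>i. i < p + m \<Longrightarrow> cmod (tri t (U x) i) \<le> M" and i: "i < p + m" for x M i
  proof -
    have M: "0 \<le> M" using x[OF i] norm_ge_zero order.trans by blast
    have lo: "cmod (x j) \<le> C * M" if "j < p" for j
    proof (rule reducingD(3)[OF r1 _ that])
      fix q assume "q < p"
      thus "cmod (tri t (u1 x) q) \<le> M" using x[of q] low[of q x] by simp
    qed
    show ?thesis
    proof (cases "i < p")
      case True
      thus ?thesis using lo[OF True] C1[OF M] by simp
    next
      case False
      hence ip: "i - p < m" "p + (i - p) = i" using i by auto
      have "cmod (x (p + (i - p)) + F x (i - p)) \<le> C * M"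
      proof (rule reducingD(3)[OF r2 _ ip(1)])
        fix q assume q: "q < m"
        show "cmod (tri (\<lambda>i j. t (p + i) (p + j)) (u2 (\<lambda>q. x (p + q) + F x q)) q) \<le> M"
          using x[of "p + q"] q high[OF q, of x] unfolding t2_def by simp
      qed
      moreover have "cmod (F x (i - p)) \<le> real p * \<rho> * (C * M)" by (rule Fbound[OF ip(1) lo])
      moreover have "cmod (x i) \<le> cmod (x (p + (i - p)) + F x (i - p)) + cmod (F x (i - p))"
        unfolding ip(2) by (metis add_diff_cancel_right' norm_triangle_ineq4)
      ultimately show ?thesis by (simp add: algebra_simps)
    qed
  qed
  ultimately have "reducing (p + m) t (C * (1 + real p * \<rho>)) U V"
    unfolding reducing_def using aut by blast
  thus ?thesis by blast
qed

lemma reducing_mono: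
  assumes "reducing n t C u v" "C \<le> C'" shows "reducing n t C' u v"
proof -
  have le: "C * M \<le> C' * M" if "M \<ge> 0" for M using assms(2) that by (rule mult_right_mono)
  have nn: "M \<ge> 0" if "cmod z \<le> M" for z M using that norm_ge_zero order.trans by blast
  show ?thesis
    using reducingD[OF assms(1)] le nn unfolding reducing_def by (meson order.trans)
qed

text \<open>Halving costs one factor per level, not one per coordinate, and k is about log n. The
  number N bounds the block lengths on all levels at once; the second block may be empty.\<close>

theorem ex_reducing:
  assumes "n \<le> 2 ^ k" "2 ^ k \<le> N" "\<And>i j. i < n \<Longrightarrow> j < i \<Longrightarrow> t i j \<in> E"
  shows "\<exists>u v. reducing n t ((1 + real N * \<rho>) ^ k) u v"
  using assms
proof (induction k arbitrary: n t)
  case 0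
  have "tri t x i = x i" if "i < n" for x i
  proof -
    have "i = 0" using that 0(1) by simp
    thus ?thesis by (simp add: tri_def)
  qed
  hence "reducing n t 1 (\<lambda>x. x) (\<lambda>x. x)"
    unfolding reducing_def by (simp add: aut_id)
  thus ?case by auto
next
  case (Suc k)
  define p where "p = min n (2 ^ k)"
  define m where "m = n - p"
  have pm: "p + m = n" "p \<le> 2 ^ k" "m \<le> 2 ^ k" using Suc.prems(1) unfolding p_def m_def by auto
  have kN: "2 ^ k \<le> N" using Suc.prems(2) by simp
  let ?C = "(1 + real N * \<rho>) ^ k"
  have "1 \<le> 1 + real N * \<rho>" using rho_ge_1 by simp
  hence C1: "?C \<ge> 1" by (rule one_le_power)
  obtain u1 v1 where r1: "reducing p t ?C u1 v1"
    using Suc.IH[OF pm(2) kN, of t] Suc.prems(3) pm(1) by auto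
  obtain u2 v2 where r2: "reducing m (\<lambda>i j. t (p + i) (p + j)) ?C u2 v2"
    using Suc.IH[OF pm(3) kN, of "\<lambda>i j. t (p + i) (p + j)"] Suc.prems(3) pm(1) by auto
  have "t i j \<in> E" if "i < p + m" "j < i" for i j using Suc.prems(3) that pm(1) by auto
  from reducing_block[OF this r1 r2 C1] obtain u v where
    r: "reducing n t (?C * (1 + real p * \<rho>)) u v" unfolding pm(1) by blast
  have "real p \<le> real N" using pm(2) kN by simp
  hence "?C * (1 + real p * \<rho>) \<le> ?C * (1 + real N * \<rho>)"
    using C1 rho_ge_1 by (intro mult_left_mono add_left_mono mult_right_mono) auto
  from reducing_mono[OF r this] show ?case by (auto simp: mult.commute)
qed

end

section \<open>Sums of norms\<close>

text \<open>Polarization with the coefficient pairs (1, 1) and (\<i>, 1) at the indices i and j.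
  Agreement at all complex vectors is assumed, so \<i> is available over the rationals as
  well.\<close>

lemma form_eval_coefficients:
  assumes eq: "\<And>x. form_eval n a x = form_eval n b x" and ij: "i < n" "j < n"
  shows "a i j = b i j"
proof -
  have two: "form_eval n c (\<lambda>k. (if k = i then p else 0) + (if k = j then q else 0))
      = c i i * p * cnj p + c i j * p * cnj q + c j i * q * cnj p + c j j * q * cnj q" for c p q
  proof -
    have "form_eval n c (\<lambda>k. (if k = i then p else 0) + (if k = j then q else 0))
      = (\<Sum>k<n. \<Sum>l<n. (if l = i then (if k = i then c i i * p * cnj p else 0) else 0)
          + (if l = j then (if k = i then c i j * p * cnj q else 0) else 0)
          + (if l = i then (if k = j then c j i * q * cnj p else 0) else 0)
          + (if l = j then (if k = j then c j j * q * cnj q else 0) else 0))"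
      unfolding form_eval_def by (intro sum.cong[OF refl]) (auto simp: algebra_simps)
    thus ?thesis using ij by (simp add: sum.distrib)
  qed
  have ii: "a i i = b i i" and jj: "a j j = b j j"
    using eq[of "\<lambda>k. if k = i then 1 else 0"] eq[of "\<lambda>k. if k = j then 1 else 0"] ij
    by (simp_all add: form_eval_unit)
  have s1: "a i j + a j i = b i j + b j i"
    using two[of a 1 1] two[of b 1 1] eq[of "\<lambda>k. (if k = i then 1 else 0) + (if k = j then 1 else 0)"] ii jj
    by simp
  have "\<i> * (a i j - a j i) = \<i> * (b i j - b j i)"
    using two[of a \<i> 1] two[of b \<i> 1] eq[of "\<lambda>k. (if k = i then \<i> else 0) + (if k = j then 1 else 0)"] ii jj
    by (simp add: algebra_simps)
  hence s2: "a i j - a j i = b i j - b j i" by (simp only: mult_cancel_left) simp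
  have "2 * a i j = (a i j + a j i) + (a i j - a j i)" by simp
  also have "\<dots> = 2 * b i j" unfolding s1 s2 by simp
  finally show ?thesis by simp
qed

lemma form_eval_gram:
  "form_eval n (\<lambda>j k. \<Sum>i<r. B i j * cnj (B i k)) x = (\<Sum>i<r. (\<Sum>j<n. B i j * x j) * cnj (\<Sum>j<n. B i j * x j))"
proof -
  have "(\<Sum>i<r. (\<Sum>j<n. B i j * x j) * cnj (\<Sum>j<n. B i j * x j))
      = (\<Sum>i<r. \<Sum>j<n. \<Sum>k<n. B i j * cnj (B i k) * x j * cnj (x k))"
    by (intro sum.cong[OF refl]) (simp add: sum_product mult_ac)
  also have "\<dots> = (\<Sum>j<n. \<Sum>i<r. \<Sum>k<n. B i j * cnj (B i k) * x j * cnj (x k))" by (rule sum.swap)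
  also have "\<dots> = (\<Sum>j<n. \<Sum>k<n. \<Sum>i<r. B i j * cnj (B i k) * x j * cnj (x k))"
    by (rule sum.cong[OF refl]) (rule sum.swap)
  also have "\<dots> = form_eval n (\<lambda>j k. \<Sum>i<r. B i j * cnj (B i k)) x"
    unfolding form_eval_def by (simp add: sum_distrib_right)
  finally show ?thesis by simp
qed

context integral_field
begin

text \<open>Stronger than \<open>sum_of_norms\<close>: the identity holds at all complex vectors,
  and the linear forms are functions, so integral substitutions can be composed with it
  directly.\<close>

definition norm_sum :: "nat \<Rightarrow> ((nat \<Rightarrow> complex) \<Rightarrow> complex) \<Rightarrow> bool" where
  "norm_sum n Q \<longleftrightarrow> (\<exists>(r::nat) l. (\<forall>k<r. linear_over \<O> n (l k)) \<and> (\<forall>x. Q x = (\<Sum>k<r. l k x * cnj (l k x))))"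

lemma norm_sum_0: "norm_sum n (\<lambda>x. 0)"
  unfolding norm_sum_def by (intro exI[of _ 0]) auto

lemma norm_sum_norm: "linear_over \<O> n \<phi> \<Longrightarrow> norm_sum n (\<lambda>x. \<phi> x * cnj (\<phi> x))"
  unfolding norm_sum_def by (intro exI[of _ 1] exI[of _ "\<lambda>_. \<phi>"]) auto

lemma norm_sum_add:
  assumes "norm_sum n P" "norm_sum n Q" shows "norm_sum n (\<lambda>x. P x + Q x)"
proof -
  obtain r :: nat and l where 1: "\<And>k. k < r \<Longrightarrow> linear_over \<O> n (l k)" "\<And>x. P x = (\<Sum>k<r. l k x * cnj (l k x))"
    using assms(1) unfolding norm_sum_def by blast
  obtain r' :: nat and l' where 2: "\<And>k. k < r' \<Longrightarrow> linear_over \<O> n (l' k)" "\<And>x. Q x = (\<Sum>k<r'. l' k x * cnj (l' k x))"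
    using assms(2) unfolding norm_sum_def by blast
  define m where "m k = (if k < r then l k else l' (k - r))" for k
  have "linear_over \<O> n (m k)" if "k < r + r'" for k using 1(1) 2(1) that by (simp add: m_def)
  moreover have "P x + Q x = (\<Sum>k<r + r'. m k x * cnj (m k x))" for x
    unfolding 1(2) 2(2) sum_lessThan_split by (simp add: m_def)
  ultimately show ?thesis unfolding norm_sum_def by blast
qed

lemma norm_sum_sum:
  assumes "\<And>i. i \<in> I \<Longrightarrow> norm_sum n (Q i)" shows "norm_sum n (\<lambda>x. \<Sum>i\<in>I. Q i x)"
  using assms by (induction I rule: infinite_finite_induct) (auto intro: norm_sum_0 norm_sum_add)

lemma norm_sum_of_nat:
  assumes "norm_sum n Q" shows "norm_sum n (\<lambda>x. of_nat k * Q x)"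
  using norm_sum_sum[of "{..<k}" n "\<lambda>_. Q"] assms by simp

lemma norm_sum_comp:
  assumes "norm_sum n Q" "\<And>i. i < n \<Longrightarrow> linear_over \<O> m (\<lambda>x. f x i)"
  shows "norm_sum m (\<lambda>x. Q (f x))"
proof -
  obtain r :: nat and l where 1: "\<And>k. k < r \<Longrightarrow> linear_over \<O> n (l k)" "\<And>x. Q x = (\<Sum>k<r. l k x * cnj (l k x))"
    using assms(1) unfolding norm_sum_def by blast
  have "linear_over \<O> m (\<lambda>x. l k (f x))" if "k < r" for k
    by (rule linear_over_comp[OF O_semiring 1(1)[OF that] assms(2)])
  thus ?thesis unfolding norm_sum_def 1(2) by (intro exI[of _ r] exI[of _ "\<lambda>k x. l k (f x)"]) auto
qed

lemma norm_sum_mono: "norm_sum n Q \<Longrightarrow> n \<le> m \<Longrightarrow> norm_sum m Q"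
  by (rule norm_sum_comp[where f = "\<lambda>x. x"]) (auto intro: linear_over_coord O_semiring)

text \<open>These are k copies of the norm of \<open>x i + cnj e * x j\<close>.\<close>

lemma norm_sum_cross_unit:
  assumes e: "e \<in> \<O>" and ij: "i < n" "j < n"
  shows "norm_sum n (\<lambda>x. of_nat k * (e * x i * cnj (x j) + cnj e * x j * cnj (x i) + x i * cnj (x i)
    + e * cnj e * x j * cnj (x j)))"
proof (rule norm_sum_of_nat)
  have "linear_over \<O> n (\<lambda>x. x i + cnj e * x j)"
    using e ij by (intro linear_over_add linear_over_scale linear_over_coord O_semiring O_cnj)
  from norm_sum_norm[OF this]
  show "norm_sum n (\<lambda>x. e * x i * cnj (x j) + cnj e * x j * cnj (x i) + x i * cnj (x i) + e * cnj e * x j * cnj (x j))"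
    by (simp add: algebra_simps)
qed

text \<open>The norm of \<open>x i + cnj g * x j\<close> alone would cost |g|^2 at index j. Using
  many norms with bounded coefficients instead keeps the cost on both diagonal entries linear in
  |g|.\<close>

lemma norm_sum_cross:
  assumes g: "g \<in> \<O>" and ij: "i < n" "j < n"
  shows "\<exists>\<alpha> \<beta>. of_real \<alpha> \<in> \<O> \<and> of_real \<beta> \<in> \<O> \<and> \<alpha> \<le> (1 + \<rho>\<^sup>2) * (1 + cmod g) \<and> \<beta> \<le> (1 + \<rho>\<^sup>2) * (1 + cmod g) \<and>
    norm_sum n (\<lambda>x. g * x i * cnj (x j) + cnj g * x j * cnj (x i) + of_real \<alpha> * x i * cnj (x i) + of_real \<beta> * x j * cnj (x j))"
proof -
  have gE: "g \<in> E" using g O_subset by blast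
  from rounding[OF gE, of 1] obtain m m' where
    m: "\<bar>of_int m\<bar> \<le> cmod g" "\<bar>of_int m'\<bar> \<le> cmod g" "cmod (g - (of_int m + of_int m' * w)) \<le> \<rho>"
    by auto
  \<comment> \<open>The decomposition is g = k * e + k' * e' + r, where e is a sign, e' is a signed
    w, and k and k' are at most |g|.\<close>
  define r where "r = g - (of_int m + of_int m' * w)"
  define e e' where "e = (of_int (sgn m) :: complex)" and "e' = of_int (sgn m') * w"
  have mem: "e \<in> \<O>" "e' \<in> \<O>" "r \<in> \<O>"
    unfolding e_def e'_def r_def by (intro O_of_int O_mult O_add O_diff w_O g)+
  define k k' where "k = nat \<bar>m\<bar>" and "k' = nat \<bar>m'\<bar>"
  have kk: "of_nat k * e = of_int m" "of_nat k' * e' = of_int m' * w"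
  proof -
    have "int (nat \<bar>z\<bar>) * sgn z = z" for z by (simp add: abs_mult_sgn)
    hence *: "(of_nat (nat \<bar>z\<bar>) * of_int (sgn z) :: complex) = of_int z" for z
      by (metis of_int_mult of_int_of_nat_eq)
    show "of_nat k * e = of_int m" unfolding k_def e_def by (rule *)
    show "of_nat k' * e' = of_int m' * w" unfolding k'_def e'_def mult.assoc[symmetric] * by (rule refl)
  qed
  hence kk': "of_nat k * cnj e = of_int m" "of_nat k' * cnj e' = of_int m' * cnj w"
    by (metis complex_cnj_mult complex_cnj_of_nat complex_cnj_of_int)+
  define \<alpha> where "\<alpha> = real k + real k' + 1"
  define \<beta> where "\<beta> = real k * (cmod e)\<^sup>2 + real k' * (cmod e')\<^sup>2 + (cmod r)\<^sup>2"
  have \<alpha>c: "of_real \<alpha> = (of_nat k + of_nat k' + 1 :: complex)" by (simp add: \<alpha>_def)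
  have \<beta>c: "of_real \<beta> = of_nat k * (e * cnj e) + of_nat k' * (e' * cnj e') + r * cnj r"
    unfolding \<beta>_def complex_norm_square[symmetric] by simp
  have "norm_sum n (\<lambda>x. of_nat k * (e * x i * cnj (x j) + cnj e * x j * cnj (x i) + x i * cnj (x i) + e * cnj e * x j * cnj (x j))
    + of_nat k' * (e' * x i * cnj (x j) + cnj e' * x j * cnj (x i) + x i * cnj (x i) + e' * cnj e' * x j * cnj (x j))
    + of_nat 1 * (r * x i * cnj (x j) + cnj r * x j * cnj (x i) + x i * cnj (x i) + r * cnj r * x j * cnj (x j)))"
    by (intro norm_sum_add norm_sum_cross_unit mem ij)
  moreover have "(\<lambda>x. of_nat k * (e * x i * cnj (x j) + cnj e * x j * cnj (x i) + x i * cnj (x i) + e * cnj e * x j * cnj (x j))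
    + of_nat k' * (e' * x i * cnj (x j) + cnj e' * x j * cnj (x i) + x i * cnj (x i) + e' * cnj e' * x j * cnj (x j))
    + of_nat 1 * (r * x i * cnj (x j) + cnj r * x j * cnj (x i) + x i * cnj (x i) + r * cnj r * x j * cnj (x j)))
    = (\<lambda>x. g * x i * cnj (x j) + cnj g * x j * cnj (x i) + of_real \<alpha> * x i * cnj (x i) + of_real \<beta> * x j * cnj (x j))"
  proof
    fix x :: "nat \<Rightarrow> complex"
    have g1: "g = of_nat k * e + of_nat k' * e' + r" unfolding kk r_def by simp
    have g2: "cnj g = of_nat k * cnj e + of_nat k' * cnj e' + cnj r" unfolding g1 by simp
    show "of_nat k * (e * x i * cnj (x j) + cnj e * x j * cnj (x i) + x i * cnj (x i) + e * cnj e * x j * cnj (x j))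
    + of_nat k' * (e' * x i * cnj (x j) + cnj e' * x j * cnj (x i) + x i * cnj (x i) + e' * cnj e' * x j * cnj (x j))
    + of_nat 1 * (r * x i * cnj (x j) + cnj r * x j * cnj (x i) + x i * cnj (x i) + r * cnj r * x j * cnj (x j))
    = g * x i * cnj (x j) + cnj g * x j * cnj (x i) + of_real \<alpha> * x i * cnj (x i) + of_real \<beta> * x j * cnj (x j)"
      unfolding \<alpha>c \<beta>c g2 by (subst g1) (simp add: algebra_simps)
  qed
  ultimately have ns: "norm_sum n (\<lambda>x. g * x i * cnj (x j) + cnj g * x j * cnj (x i) + of_real \<alpha> * x i * cnj (x i) + of_real \<beta> * x j * cnj (x j))"
    by simp
  have k_le: "real k \<le> cmod g" "real k' \<le> cmod g" using m(1,2) unfolding k_def k'_def by auto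
  have rho2: "1 \<le> \<rho>\<^sup>2" using rho_ge_1 by (simp add: one_le_power)
  have e1: "(cmod e)\<^sup>2 \<le> 1" unfolding e_def by (simp add: sgn_if)
  have "cmod e' \<le> \<rho>" unfolding e'_def using w_le rho_ge_1 by (simp add: norm_mult sgn_if)
  hence e2: "(cmod e')\<^sup>2 \<le> \<rho>\<^sup>2" by (intro power_mono) auto
  have r2: "(cmod r)\<^sup>2 \<le> \<rho>\<^sup>2" using m(3) unfolding r_def by (intro power_mono) auto
  have "\<alpha> \<le> 2 * (1 + cmod g)" using k_le unfolding \<alpha>_def by simp
  also have "\<dots> \<le> (1 + \<rho>\<^sup>2) * (1 + cmod g)" using rho2 by (intro mult_right_mono) auto
  finally have \<alpha>: "\<alpha> \<le> (1 + \<rho>\<^sup>2) * (1 + cmod g)" .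
  have "real k * (cmod e)\<^sup>2 \<le> cmod g * 1" "real k' * (cmod e')\<^sup>2 \<le> cmod g * \<rho>\<^sup>2"
    using k_le e1 e2 by (intro mult_mono; simp)+
  hence "\<beta> \<le> cmod g + cmod g * \<rho>\<^sup>2 + \<rho>\<^sup>2" using r2 unfolding \<beta>_def by linarith
  also have "\<dots> \<le> (1 + \<rho>\<^sup>2) * (1 + cmod g)" by (simp add: algebra_simps)
  finally have \<beta>: "\<beta> \<le> (1 + \<rho>\<^sup>2) * (1 + cmod g)" .
  have "of_real \<alpha> \<in> \<O>" "of_real \<beta> \<in> \<O>"
    unfolding \<alpha>c \<beta>c by (intro O_add O_mult O_of_nat O_cnj O_1 mem)+
  thus ?thesis using \<alpha> \<beta> ns by blast
qed

lemma norm_sum_square: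
  assumes c: "of_real c \<in> \<O>" "c \<ge> 0" and i: "i < n"
  shows "norm_sum n (\<lambda>x. of_real c * (x i * cnj (x i)))"
proof -
  have "of_real c \<in> (\<int> :: complex set)" using c(1) by (intro O_real) auto
  then obtain z where "of_real c = (of_int z :: complex)" by (auto elim: Ints_cases)
  hence z: "c = of_int z" by (metis of_real_eq_iff of_real_of_int_eq)
  hence "of_real c = (of_nat (nat z) :: complex)" using c(2) by simp
  thus ?thesis using norm_sum_of_nat[OF norm_sum_norm[OF linear_over_coord[OF O_semiring i]], of "nat z"] by simp
qed

text \<open>Each pair of indices draws at most K = (1 + \<rho>^2) (1 + \<eta>) from either of its
  diagonal entries, by \<open>norm_sum_cross\<close>. Peeling off the last variable lowers the other
  diagonal entries by at most K, which the induction allows. What the last entry retains is a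
  nonnegative rational integer, hence a sum of squares.\<close>

lemma norm_sum_diag_dominant:
  assumes "\<And>i j. i < n \<Longrightarrow> j < n \<Longrightarrow> G i j \<in> \<O> \<and> G i j = cnj (G j i)"
    "\<And>i j. i < n \<Longrightarrow> j < n \<Longrightarrow> i \<noteq> j \<Longrightarrow> cmod (G i j) \<le> \<eta>"
    "\<And>i. i < n \<Longrightarrow> Re (G i i) \<ge> real n * ((1 + \<rho>\<^sup>2) * (1 + \<eta>))" "\<eta> \<ge> 0"
  shows "norm_sum n (form_eval n G)"
  using assms(1-3)
proof (induction n arbitrary: G)
  case 0
  thus ?case using norm_sum_0 by (simp add: form_eval_def fun_eq_iff)
next
  case (Suc n)
  define K where "K = (1 + \<rho>\<^sup>2) * (1 + \<eta>)"
  have K0: "K \<ge> 0" unfolding K_def using assms(4) by simp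
  have GO: "G i j \<in> \<O>" if "i < Suc n" "j < Suc n" for i j using Suc.prems(1)[OF that] by blast
  have Gh: "G i j = cnj (G j i)" if "i < Suc n" "j < Suc n" for i j using Suc.prems(1)[OF that] by blast
  define cross where "cross j p \<longleftrightarrow> of_real (fst p) \<in> \<O> \<and> of_real (snd p) \<in> \<O> \<and> fst p \<le> K \<and> snd p \<le> K \<and>
    norm_sum (Suc n) (\<lambda>x. G j n * x j * cnj (x n) + cnj (G j n) * x n * cnj (x j) + of_real (fst p) * x j * cnj (x j) + of_real (snd p) * x n * cnj (x n))" for j and p :: "real \<times> real"
  have "\<exists>p. cross j p" if j: "j < n" for j
  proof -
    have "cmod (G j n) \<le> \<eta>" using Suc.prems(2)[of j n] j by simp
    hence le: "(1 + \<rho>\<^sup>2) * (1 + cmod (G j n)) \<le> K" unfolding K_def by (intro mult_left_mono) auto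
    have "G j n \<in> \<O>" "j < Suc n" "n < Suc n" using j GO by auto
    from norm_sum_cross[OF this] obtain a b where
      "of_real a \<in> \<O>" "of_real b \<in> \<O>" "a \<le> (1 + \<rho>\<^sup>2) * (1 + cmod (G j n))" "b \<le> (1 + \<rho>\<^sup>2) * (1 + cmod (G j n))"
      "norm_sum (Suc n) (\<lambda>x. G j n * x j * cnj (x n) + cnj (G j n) * x n * cnj (x j) + of_real a * x j * cnj (x j) + of_real b * x n * cnj (x n))"
      by blast
    hence "cross j (a, b)" unfolding cross_def using le by simp
    thus ?thesis by blast
  qed
  then obtain p where p: "\<And>j. j < n \<Longrightarrow> cross j (p j)" by metis
  define \<alpha> \<beta> where "\<alpha> j = fst (p j)" and "\<beta> j = snd (p j)" for j
  have ab: "of_real (\<alpha> j) \<in> \<O>" "of_real (\<beta> j) \<in> \<O>" "\<alpha> j \<le> K" "\<beta> j \<le> K"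
    "norm_sum (Suc n) (\<lambda>x. G j n * x j * cnj (x n) + cnj (G j n) * x n * cnj (x j)
        + of_real (\<alpha> j) * x j * cnj (x j) + of_real (\<beta> j) * x n * cnj (x n))" if "j < n" for j
    using p[OF that] unfolding cross_def \<alpha>_def \<beta>_def by blast+
  define G' where "G' i j = (if i = j then G i i - of_real (\<alpha> i) else G i j)" for i j
  have "norm_sum n (form_eval n G')"
  proof (rule Suc.IH)
    fix i j assume ij: "i < n" "j < n"
    hence G: "G i j \<in> \<O>" "G i j = cnj (G j i)" by (auto intro: GO Gh)
    show "G' i j \<in> \<O> \<and> G' i j = cnj (G' j i)"
    proof (cases "i = j")
      case True
      have "G i i - of_real (\<alpha> i) \<in> \<O>" using G ab(1)[OF ij(1)] True by (intro O_diff) auto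
      moreover have "G i i = cnj (G i i)" using G True by simp
      hence "G i i - of_real (\<alpha> i) = cnj (G i i - of_real (\<alpha> i))" by (metis complex_cnj_complex_of_real complex_cnj_diff)
      ultimately show ?thesis using True by (simp only: G'_def simp_thms if_True)
    next
      case False
      thus ?thesis using G by (simp only: G'_def if_False simp_thms False not_sym)
    qed
  next
    fix i j assume "i < n" "j < n" "i \<noteq> j"
    thus "cmod (G' i j) \<le> \<eta>" using Suc.prems(2)[of i j] by (simp add: G'_def)
  next
    fix i assume i: "i < n"
    have "real (Suc n) * K \<le> Re (G i i)" using Suc.prems(3)[of i] i unfolding K_def by simp
    thus "real n * ((1 + \<rho>\<^sup>2) * (1 + \<eta>)) \<le> Re (G' i i)"
      using ab(3)[OF i] unfolding K_def[symmetric] by (simp add: G'_def algebra_simps)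
  qed
  hence ns1: "norm_sum (Suc n) (form_eval n G')" by (rule norm_sum_mono) simp
  define c where "c = Re (G n n) - (\<Sum>j<n. \<beta> j)"
  have "cnj (G n n) = G n n" by (rule Gh[symmetric]) auto
  hence "Im (G n n) = 0" by (simp add: complex_eq_iff)
  hence Gnn: "G n n = of_real (Re (G n n))" by (simp add: complex_eq_iff)
  hence cc: "of_real c = G n n - (\<Sum>j<n. of_real (\<beta> j))" unfolding c_def by simp
  have "of_real c \<in> \<O>" unfolding cc by (intro O_diff GO subsemiring_sum O_semiring ab) auto
  moreover have "c \<ge> 0"
  proof -
    have "(\<Sum>j<n. \<beta> j) \<le> (\<Sum>j<n. K)" using ab(4) by (intro sum_mono) auto
    also have "\<dots> \<le> real (Suc n) * K" using K0 by (simp add: algebra_simps)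
    also have "\<dots> \<le> Re (G n n)" using Suc.prems(3)[of n] unfolding K_def by simp
    finally show ?thesis unfolding c_def by simp
  qed
  ultimately have ns2: "norm_sum (Suc n) (\<lambda>x. of_real c * (x n * cnj (x n)))" by (rule norm_sum_square) simp
  have ns3: "norm_sum (Suc n) (\<lambda>x. \<Sum>j<n. G j n * x j * cnj (x n) + cnj (G j n) * x n * cnj (x j)
        + of_real (\<alpha> j) * x j * cnj (x j) + of_real (\<beta> j) * x n * cnj (x n))"
    by (rule norm_sum_sum) (use ab(5) in auto)
  have "form_eval (Suc n) G x = form_eval n G' x + (\<Sum>j<n. G j n * x j * cnj (x n) + cnj (G j n) * x n * cnj (x j)
        + of_real (\<alpha> j) * x j * cnj (x j) + of_real (\<beta> j) * x n * cnj (x n)) + of_real c * (x n * cnj (x n))" for x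
  proof -
    have "form_eval n G' x = (\<Sum>i<n. \<Sum>j<n. G i j * x i * cnj (x j) - (if j = i then of_real (\<alpha> i) * x i * cnj (x i) else 0))"
      unfolding form_eval_def by (intro sum.cong[OF refl]) (auto simp: G'_def algebra_simps)
    also have "\<dots> = form_eval n G x - (\<Sum>i<n. of_real (\<alpha> i) * x i * cnj (x i))"
      unfolding form_eval_def by (simp add: sum_subtractf)
    finally have 1: "form_eval n G' x = form_eval n G x - (\<Sum>i<n. of_real (\<alpha> i) * x i * cnj (x i))" .
    have 2: "(\<Sum>j<n. G j n * x j * cnj (x n) + G n j * x n * cnj (x j))
        = (\<Sum>j<n. G j n * x j * cnj (x n) + cnj (G j n) * x n * cnj (x j))"
    proof (intro sum.cong[OF refl])
      fix j assume "j \<in> {..<n}"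
      hence "G n j = cnj (G j n)" by (intro Gh) auto
      thus "G j n * x j * cnj (x n) + G n j * x n * cnj (x j) = G j n * x j * cnj (x n) + cnj (G j n) * x n * cnj (x j)"
        by (simp only:)
    qed
    show ?thesis
      unfolding form_eval_Suc 1 2 cc by (simp add: sum.distrib sum_distrib_right sum_distrib_left algebra_simps)
  qed
  hence "form_eval (Suc n) G = (\<lambda>x. form_eval n G' x + (\<Sum>j<n. G j n * x j * cnj (x n) + cnj (G j n) * x n * cnj (x j)
        + of_real (\<alpha> j) * x j * cnj (x j) + of_real (\<beta> j) * x n * cnj (x n)) + of_real c * (x n * cnj (x n)))" by blast
  thus ?case using norm_sum_add[OF norm_sum_add[OF ns1 ns3] ns2] by simp
qed

end

section \<open>Rounding a positive definite form\<close>

text \<open>At the least index with a nonzero coordinate, triangularity gives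
  \<open>tri t x i = x i\<close>.\<close>

lemma diag_eval_pos:
  assumes h: "\<And>i. i < n \<Longrightarrow> h i > 0" and x: "\<exists>i<n. x i \<noteq> 0"
  shows "diag_eval n h t x > 0"
proof -
  define i where "i = (LEAST i. i < n \<and> x i \<noteq> 0)"
  have i: "i < n" "x i \<noteq> 0" using LeastI_ex[OF x] unfolding i_def by auto
  have "x j = 0" if "j < i" for j
    using not_less_Least[of j "\<lambda>i. i < n \<and> x i \<noteq> 0"] that i(1) unfolding i_def by auto
  hence "tri t x i = x i" by (simp add: tri_def)
  hence "0 < h i * (cmod (tri t x i))\<^sup>2" using i h by simp
  also have "\<dots> \<le> diag_eval n h t x"
    unfolding diag_eval_def using i(1) by (intro member_le_sum) (auto intro!: mult_nonneg_nonneg less_imp_le[OF h])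
  finally show ?thesis .
qed

lemma tri_unit_last: "i < n \<Longrightarrow> tri t (\<lambda>j. if j = n then d else 0) i = 0"
  "tri t (\<lambda>j. if j = n then d else 0) n = d"
  by (simp_all add: tri_def)

context integral_field
begin

lemma gram_rounding_error:
  assumes B: "\<And>i. i < r \<Longrightarrow> cmod (B i j) \<le> q" "\<And>i. i < r \<Longrightarrow> cmod (B i k) \<le> q"
    and M: "\<And>i. i < r \<Longrightarrow> cmod (B i j - M i j) \<le> \<rho>" "\<And>i. i < r \<Longrightarrow> cmod (B i k - M i k) \<le> \<rho>"
  shows "cmod ((\<Sum>i<r. B i j * cnj (B i k)) - (\<Sum>i<r. M i j * cnj (M i k))) \<le> real r * (2 * \<rho> * q + \<rho>\<^sup>2)"
proof -
  have "(\<Sum>i<r. B i j * cnj (B i k)) - (\<Sum>i<r. M i j * cnj (M i k))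
      = (\<Sum>i<r. B i j * cnj (B i k - M i k) + (B i j - M i j) * cnj (B i k)
          - (B i j - M i j) * cnj (B i k - M i k))"
    unfolding sum_subtractf[symmetric] by (intro sum.cong[OF refl]) (simp add: algebra_simps)
  also have "cmod \<dots> \<le> (\<Sum>i<r. 2 * \<rho> * q + \<rho>\<^sup>2)"
  proof (rule order.trans[OF norm_sum sum_mono])
    fix i assume "i \<in> {..<r}"
    hence i: "i < r" by simp
    have q: "q \<ge> 0" using B(1)[OF i] norm_ge_zero order.trans by blast
    have r0: "\<rho> \<ge> 0" using rho_ge_1 by simp
    have m1: "cmod (B i j * cnj (B i k - M i k)) \<le> q * \<rho>"
      unfolding norm_mult complex_mod_cnj by (intro mult_mono B M i q norm_ge_zero)
    have m2: "cmod ((B i j - M i j) * cnj (B i k)) \<le> \<rho> * q"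
      unfolding norm_mult complex_mod_cnj by (intro mult_mono B M i r0 norm_ge_zero)
    have m3: "cmod ((B i j - M i j) * cnj (B i k - M i k)) \<le> \<rho> * \<rho>"
      unfolding norm_mult complex_mod_cnj by (intro mult_mono B M i r0 norm_ge_zero)
    have "cmod (B i j * cnj (B i k - M i k) + (B i j - M i j) * cnj (B i k) - (B i j - M i j) * cnj (B i k - M i k))
      \<le> cmod (B i j * cnj (B i k - M i k)) + cmod ((B i j - M i j) * cnj (B i k)) + cmod ((B i j - M i j) * cnj (B i k - M i k))"
      by (rule order.trans[OF norm_triangle_ineq4 add_right_mono[OF norm_triangle_ineq]])
    also have "\<dots> \<le> q * \<rho> + \<rho> * q + \<rho> * \<rho>" by (intro add_mono m1 m2 m3)
    also have "\<dots> = 2 * \<rho> * q + \<rho>\<^sup>2" by (simp add: power2_eq_square)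
    finally show "cmod (B i j * cnj (B i k - M i k) + (B i j - M i j) * cnj (B i k) - (B i j - M i j) * cnj (B i k - M i k))
      \<le> 2 * \<rho> * q + \<rho>\<^sup>2" .
  qed
  also have "\<dots> = real r * (2 * \<rho> * q + \<rho>\<^sup>2)" by simp
  finally show ?thesis .
qed

text \<open>A Cholesky factorization taken from the Gram-Schmidt decomposition. The entries of B are
  square roots of the \<open>h i\<close> times field elements, which is why \<open>rounding\<close>
  speaks of real multiples.\<close>

lemma pos_def_gram:
  assumes "hermitian_form E n p" "pos_def_form E n p"
  shows "\<exists>B M. (\<forall>j<n. \<forall>k<n. p j k = (\<Sum>i<n. B i j * cnj (B i k))) \<and>
    (\<forall>i<n. \<forall>j<n. M i j \<in> \<O> \<and> cmod (B i j - M i j) \<le> \<rho>)"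
proof -
  obtain f g h t where hkz: "hkz_basis n p f g h t" using ex_hkz_basis[OF assms] by blast
  note aut = hkz_basisD(1)[OF hkz]
  have lin: "linear_over E n (\<lambda>x. tri t (g x) i)" if "i < n" for i
    by (rule linear_over_comp[OF E_semiring linear_over_tri[of i t n] linear_over_subset[OF autD(2)[OF aut] O_subset]])
       (use that hkz_basisD(3)[OF hkz] in auto)
  have "\<forall>i. \<exists>b. i < n \<longrightarrow> (\<forall>j<n. b j \<in> E) \<and> (\<forall>x. tri t (g x) i = (\<Sum>j<n. b j * x j))"
    using lin unfolding linear_over_def fun_eq_iff by blast
  from choice[OF this] obtain b where b: "\<And>i j. i < n \<Longrightarrow> j < n \<Longrightarrow> b i j \<in> E"
    "\<And>i x. i < n \<Longrightarrow> tri t (g x) i = (\<Sum>j<n. b i j * x j)" by blast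
  define B where "B i j = of_real (sqrt (h i)) * b i j" for i j
  have "form_eval n p x = form_eval n (\<lambda>j k. \<Sum>i<n. B i j * cnj (B i k)) x" for x
  proof -
    have "form_eval n p x = form_eval n p (f (g x))"
      by (rule form_eval_cong) (rule autD(3)[OF aut, symmetric])
    also have "\<dots> = of_real (diag_eval n h t (g x))" by (rule hkz_basisD(4)[OF hkz])
    also have "\<dots> = (\<Sum>i<n. (\<Sum>j<n. B i j * x j) * cnj (\<Sum>j<n. B i j * x j))"
      unfolding diag_eval_def of_real_sum
    proof (intro sum.cong[OF refl])
      fix i assume "i \<in> {..<n}"
      hence i: "i < n" by simp
      have eq: "(\<Sum>j<n. B i j * x j) = of_real (sqrt (h i)) * tri t (g x) i"
        unfolding b(2)[OF i] B_def by (simp add: sum_distrib_left mult_ac)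
      have "(cmod (of_real (sqrt (h i)) * tri t (g x) i))\<^sup>2 = h i * (cmod (tri t (g x) i))\<^sup>2"
        using hkz_basisD(2)[OF hkz i] by (simp add: norm_mult power_mult_distrib)
      thus "of_real (h i * (cmod (tri t (g x) i))\<^sup>2) = (\<Sum>j<n. B i j * x j) * cnj (\<Sum>j<n. B i j * x j)"
        unfolding eq by (metis complex_norm_square)
    qed
    also have "\<dots> = form_eval n (\<lambda>j k. \<Sum>i<n. B i j * cnj (B i k)) x" by (rule form_eval_gram[symmetric])
    finally show ?thesis .
  qed
  hence "p j k = (\<Sum>i<n. B i j * cnj (B i k))" if "j < n" "k < n" for j k
    using form_eval_coefficients[of n p "\<lambda>j k. \<Sum>i<n. B i j * cnj (B i k)" j k] that by simp
  moreover have "\<forall>i j. \<exists>c. i < n \<longrightarrow> j < n \<longrightarrow> c \<in> \<O> \<and> cmod (B i j - c) \<le> \<rho>"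
  proof (intro allI)
    fix i j
    show "\<exists>c. i < n \<longrightarrow> j < n \<longrightarrow> c \<in> \<O> \<and> cmod (B i j - c) \<le> \<rho>"
      using rounding_integer[OF b(1), of i j "sqrt (h i)"] unfolding B_def by blast
  qed
  then obtain M where "\<And>i j. i < n \<Longrightarrow> j < n \<Longrightarrow> M i j \<in> \<O> \<and> cmod (B i j - M i j) \<le> \<rho>" by metis
  ultimately show ?thesis by blast
qed

text \<open>Put q = sqrt (s R) and N = n \<rho>^2. The left side is at most 3 N * 4 N q, and the
  right side equals q^2 / R^2. So q >= 12 N^2 R^2 suffices, which squared is s >= 144 N^4
  R^3.\<close>

lemma scale_bound_arith:
  assumes n: "(n::real) \<ge> 1" and R: "R \<ge> 1" and s: "s \<ge> 144 * n ^ 4 * \<rho> ^ 8 * R ^ 3"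
  shows "n * ((1 + \<rho>\<^sup>2) * (1 + n * (2 * \<rho> * sqrt (s * R) + \<rho>\<^sup>2))) + n * (2 * \<rho> * sqrt (s * R) + \<rho>\<^sup>2) + 1 \<le> s / R"
proof -
  define q where "q = sqrt (s * R)"
  define N where "N = n * \<rho>\<^sup>2"
  define \<eta> where "\<eta> = n * (2 * \<rho> * q + \<rho>\<^sup>2)"
  have r2: "\<rho> \<le> \<rho>\<^sup>2" "1 \<le> \<rho>\<^sup>2" using rho_ge_1 by (simp_all add: self_le_power)
  have N1: "N \<ge> 1" unfolding N_def using mult_mono[OF n r2(2)] n by simp
  have "N ^ 4 = n ^ 4 * \<rho> ^ 8" unfolding N_def power_mult_distrib power_mult[symmetric] by simp
  hence s': "s \<ge> 144 * N ^ 4 * R ^ 3" using s by simp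
  have "(12 * N\<^sup>2 * R\<^sup>2)\<^sup>2 = 144 * N ^ 4 * R ^ 3 * R" by (simp add: power_mult_distrib power4_eq_xxxx power2_eq_square power3_eq_cube)
  also have "\<dots> \<le> s * R" using s' R by (intro mult_right_mono) auto
  finally have q: "12 * N\<^sup>2 * R\<^sup>2 \<le> q" unfolding q_def by (rule real_le_rsqrt)
  have "1 \<le> N\<^sup>2" "1 \<le> R\<^sup>2" using N1 R by (simp_all add: one_le_power)
  hence "1 \<le> 12 * N\<^sup>2 * R\<^sup>2" using mult_mono[of 1 "12 * N\<^sup>2" 1 "R\<^sup>2"] by simp
  hence q1: "q \<ge> 1" using q by linarith
  have "n * (2 * \<rho> * q) \<le> n * (2 * \<rho>\<^sup>2 * q)" using r2 q1 n by (intro mult_left_mono mult_right_mono) auto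
  moreover have "n * \<rho>\<^sup>2 * 1 \<le> n * \<rho>\<^sup>2 * q" using q1 n by (intro mult_left_mono) auto
  ultimately have eta: "\<eta> \<le> 3 * N * q" unfolding \<eta>_def N_def by (simp add: algebra_simps)
  have eta0: "0 \<le> \<eta>" unfolding \<eta>_def using n rho_ge_1 q1 by simp
  have Nq: "1 \<le> N * q" using mult_mono[OF N1 q1] N1 by simp
  have "n * (1 + \<rho>\<^sup>2) \<le> 2 * N" unfolding N_def using r2 n by (simp add: algebra_simps)
  hence "n * (1 + \<rho>\<^sup>2) * (1 + \<eta>) \<le> 2 * N * (1 + \<eta>)" using eta0 by (intro mult_right_mono) auto
  hence "n * ((1 + \<rho>\<^sup>2) * (1 + \<eta>)) + \<eta> + 1 \<le> (2 * N + 1) * (1 + \<eta>)" by (simp add: algebra_simps)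
  also have "\<dots> \<le> (3 * N) * (4 * (N * q))" using N1 eta eta0 Nq by (intro mult_mono) auto
  also have "\<dots> = (12 * N\<^sup>2 * R\<^sup>2) * q / R\<^sup>2" using R by (simp add: power2_eq_square field_simps)
  also have "\<dots> \<le> q * q / R\<^sup>2" using q q1 R by (intro divide_right_mono mult_right_mono) auto
  also have "q * q = s * R"
  proof -
    have "0 \<le> 144 * N ^ 4 * R ^ 3" using N1 R by simp
    hence "0 \<le> s" using s' by linarith
    thus ?thesis unfolding q_def using R by simp
  qed
  also have "s * R / R\<^sup>2 = s / R" using R by (simp add: power2_eq_square field_simps)
  finally show ?thesis unfolding \<eta>_def q_def .
qed

lemma norm_sum_if_bounded:
  assumes n: "n > 0"
    and a: "\<And>i j. i < n \<Longrightarrow> j < n \<Longrightarrow> a i j \<in> \<O> \<and> a i j = cnj (a j i)"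
    and R: "R \<ge> 1" and diag: "\<And>j. j < n \<Longrightarrow> Re (a j j) \<le> R"
    and lower: "\<And>x. (\<Sum>i<n. (cmod (x i))\<^sup>2) \<le> R * Re (form_eval n a x)"
    and s: "real s \<ge> 144 * real n ^ 4 * \<rho> ^ 8 * R ^ 3"
  shows "norm_sum n (form_eval n (\<lambda>i j. of_nat s * a i j))"
proof -
  \<comment> \<open>The largest integer strictly below s / R: strictness keeps \<open>p\<close>
    positive definite, and at most 1 is lost on the diagonal.\<close>
  define d where "d = nat (\<lceil>real s / R\<rceil> - 1)"
  define q where "q = sqrt (real s * R)"
  define \<eta> where "\<eta> = real n * (2 * \<rho> * q + \<rho>\<^sup>2)"
  define p where "p i j = of_nat s * a i j - (if i = j then of_nat d else 0)" for i j
  have n1: "real n \<ge> 1" using n by simp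
  have ar: "real n * ((1 + \<rho>\<^sup>2) * (1 + \<eta>)) + \<eta> + 1 \<le> real s / R"
    unfolding \<eta>_def q_def by (rule scale_bound_arith[OF n1 R s])
  have eta0: "\<eta> \<ge> 0" unfolding \<eta>_def q_def using rho_ge_1 R by simp
  have pos: "real n * ((1 + \<rho>\<^sup>2) * (1 + \<eta>)) \<ge> 0" using eta0 by simp
  have sR: "real s / R \<ge> 1" using ar eta0 pos by linarith
  have d: "real d < real s / R" "real s / R - 1 \<le> real d"
    using sR unfolding d_def by linarith+
  have aO: "a i j \<in> \<O>" and ah: "a i j = cnj (a j i)" if "i < n" "j < n" for i j using a[OF that] by auto
  have ph: "p i j \<in> E \<and> p i j = cnj (p j i)" if ij: "i < n" "j < n" for i j
  proof
    have "(if i = j then of_nat d else 0) \<in> \<O>" by (auto intro: O_of_nat O_0)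
    hence "p i j \<in> \<O>" unfolding p_def by (intro O_diff O_mult O_of_nat aO ij)
    thus "p i j \<in> E" using O_subset by blast
    have "a i j = cnj (a j i)" by (rule ah[OF ij])
    hence "cnj (a j i) = a i j" by (rule sym)
    thus "p i j = cnj (p j i)" unfolding p_def by auto
  qed
  have peval: "form_eval n p x = of_nat s * form_eval n a x - of_real (real d * (\<Sum>i<n. (cmod (x i))\<^sup>2))" for x
  proof -
    have "form_eval n p x = (\<Sum>i<n. \<Sum>j<n. of_nat s * (a i j * x i * cnj (x j)) - (if j = i then of_nat d * (x i * cnj (x i)) else 0))"
      unfolding form_eval_def p_def by (intro sum.cong[OF refl]) (auto simp: algebra_simps)
    also have "\<dots> = of_nat s * form_eval n a x - (\<Sum>i<n. of_nat d * (x i * cnj (x i)))"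
      unfolding form_eval_def by (simp add: sum_subtractf sum_distrib_left)
    also have "(\<Sum>i<n. of_nat d * (x i * cnj (x i))) = of_real (real d * (\<Sum>i<n. (cmod (x i))\<^sup>2))"
      unfolding complex_norm_square[symmetric] by (simp add: sum_distrib_left)
    finally show ?thesis .
  qed
  have pd: "pos_def_form E n p"
    unfolding pos_def_form_def
  proof (intro ballI impI)
    fix x :: "nat \<Rightarrow> complex" assume "\<exists>i<n. x i \<noteq> 0"
    then obtain i where i: "i < n" "x i \<noteq> 0" by blast
    have "0 < (cmod (x i))\<^sup>2" using i by simp
    also have "\<dots> \<le> (\<Sum>i<n. (cmod (x i))\<^sup>2)" using i(1) by (intro member_le_sum) auto
    finally have S: "(\<Sum>i<n. (cmod (x i))\<^sup>2) > 0" .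
    have "real d * (\<Sum>i<n. (cmod (x i))\<^sup>2) < real s / R * (\<Sum>i<n. (cmod (x i))\<^sup>2)"
      using d(1) S by (rule mult_strict_right_mono)
    also have "\<dots> \<le> real s / R * (R * Re (form_eval n a x))"
      using lower R by (intro mult_left_mono) auto
    also have "\<dots> = real s * Re (form_eval n a x)" using R by simp
    finally show "Re (form_eval n p x) > 0" unfolding peval by simp
  qed
  have herm: "hermitian_form E n p" unfolding hermitian_form_def using ph by blast
  from pos_def_gram[OF herm pd] obtain B M where
    "\<forall>j<n. \<forall>k<n. p j k = (\<Sum>i<n. B i j * cnj (B i k))" "\<forall>i<n. \<forall>j<n. M i j \<in> \<O> \<and> cmod (B i j - M i j) \<le> \<rho>"
    by (elim exE conjE)
  hence BM: "\<And>j k. j < n \<Longrightarrow> k < n \<Longrightarrow> p j k = (\<Sum>i<n. B i j * cnj (B i k))"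
    "\<And>i j. i < n \<Longrightarrow> j < n \<Longrightarrow> M i j \<in> \<O>" "\<And>i j. i < n \<Longrightarrow> j < n \<Longrightarrow> cmod (B i j - M i j) \<le> \<rho>"
    by simp_all
  \<comment> \<open>The squares of the entries in column j of B add up to the diagonal entry
    \<open>p j j\<close>, which is at most s * R.\<close>
  have Bq: "cmod (B i j) \<le> q" if ij: "i < n" "j < n" for i j
  proof -
    have "(cmod (B i j))\<^sup>2 \<le> (\<Sum>i<n. (cmod (B i j))\<^sup>2)" using ij by (intro member_le_sum) auto
    also have "complex_of_real (\<Sum>i<n. (cmod (B i j))\<^sup>2) = p j j"
      unfolding BM(1)[OF ij(2) ij(2)] by (simp only: of_real_sum complex_norm_square)
    hence "(\<Sum>i<n. (cmod (B i j))\<^sup>2) = Re (p j j)" by (metis Re_complex_of_real)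
    also have "\<dots> \<le> real s * Re (a j j)" unfolding p_def by simp
    also have "\<dots> \<le> real s * R" using diag[OF ij(2)] by (intro mult_left_mono) auto
    finally show ?thesis unfolding q_def by (rule real_le_rsqrt)
  qed
  \<comment> \<open>The integral remainder after the norms of the rounded forms are removed. It is d
    times the identity plus an error matrix with entries at most \<eta>, hence diagonally
    dominant.\<close>
  define G where "G j k = of_nat s * a j k - (\<Sum>i<n. M i j * cnj (M i k))" for j k
  define Er where "Er j k = (\<Sum>i<n. B i j * cnj (B i k)) - (\<Sum>i<n. M i j * cnj (M i k))" for j k
  have Er: "cmod (Er j k) \<le> \<eta>" if "j < n" "k < n" for j k
    unfolding Er_def \<eta>_def by (rule gram_rounding_error) (use that Bq BM(3) in auto)
  have GE: "G j k = (if j = k then of_nat d else 0) + Er j k" if "j < n" "k < n" for j k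
    unfolding G_def Er_def BM(1)[OF that, symmetric] p_def by simp
  have "norm_sum n (form_eval n G)"
  proof (rule norm_sum_diag_dominant[where \<eta> = \<eta>])
    fix i j assume ij: "i < n" "j < n"
    have "G i j \<in> \<O>"
      unfolding G_def by (intro O_diff O_mult O_of_nat aO ij subsemiring_sum O_semiring O_cnj BM(2)) (use ij in auto)
    moreover have "cnj (a j i) = a i j" by (rule ah[OF ij, symmetric])
    hence "G i j = cnj (G j i)" unfolding G_def by (simp add: mult.commute)
    ultimately show "G i j \<in> \<O> \<and> G i j = cnj (G j i)" ..
  next
    fix i j assume "i < n" "j < n" "i \<noteq> j"
    thus "cmod (G i j) \<le> \<eta>" using Er[of i j] by (simp add: GE)
  next
    fix i assume i: "i < n"
    have "\<bar>Re (Er i i)\<bar> \<le> \<eta>" using Er[OF i i] abs_Re_le_cmod order.trans by blast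
    hence "Re (G i i) \<ge> real d - \<eta>" unfolding GE[OF i i] by simp
    thus "real n * ((1 + \<rho>\<^sup>2) * (1 + \<eta>)) \<le> Re (G i i)" using ar d(2) by linarith
  qed (rule eta0)
  moreover have "norm_sum n (\<lambda>x. \<Sum>i<n. (\<Sum>j<n. M i j * x j) * cnj (\<Sum>j<n. M i j * x j))"
  proof (intro norm_sum_sum norm_sum_norm)
    fix i assume "i \<in> {..<n}"
    thus "linear_over \<O> n (\<lambda>x. \<Sum>j<n. M i j * x j)" using BM(2) by (intro linear_overI[where c = "M i"]) auto
  qed
  ultimately have "norm_sum n (\<lambda>x. form_eval n G x + (\<Sum>i<n. (\<Sum>j<n. M i j * x j) * cnj (\<Sum>j<n. M i j * x j)))"
    by (rule norm_sum_add)
  moreover have "form_eval n G x + (\<Sum>i<n. (\<Sum>j<n. M i j * x j) * cnj (\<Sum>j<n. M i j * x j))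
      = form_eval n (\<lambda>i j. of_nat s * a i j) x" for x
    unfolding form_eval_gram[symmetric] form_eval_def G_def sum.distrib[symmetric]
    by (intro sum.cong[OF refl]) (simp add: algebra_simps)
  ultimately show ?thesis by simp
qed

end

section \<open>Reduction to balanced forms\<close>

lemma ex_power_of_two_between:
  assumes "n > 0" shows "\<exists>k. n \<le> 2 ^ k \<and> 2 ^ k \<le> 2 * (n::nat)"
proof -
  define k where "k = (LEAST k. n \<le> 2 ^ k)"
  have "n \<le> 2 ^ n" by (simp add: less_imp_le)
  hence 1: "n \<le> 2 ^ k" unfolding k_def by (rule LeastI)
  have "2 ^ k \<le> 2 * n"
  proof (cases k)
    case 0
    thus ?thesis using assms by simp
  next
    case (Suc j)
    hence "\<not> n \<le> 2 ^ j" using not_less_Least[of j "\<lambda>k. n \<le> 2 ^ k"] unfolding k_def by simp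
    thus ?thesis unfolding Suc by simp
  qed
  thus ?thesis using 1 by blast
qed

lemma form_eval_scale: "form_eval n (\<lambda>i j. c * a i j) x = c * form_eval n a x"
  unfolding form_eval_def by (simp add: sum_distrib_left mult_ac)

context integral_field
begin

text \<open>A bound for R = n e C^2 in \<open>norm_sum_reduced\<close>, with e from
  \<open>hkz_growth\<close> and C = (1 + 2 n \<rho>) ^ k from \<open>ex_reducing\<close>, where k is
  at most ln (2 n) / ln 2. The argument is real so that it can later be K (ln s)^2.\<close>

definition reduction_bound :: "real \<Rightarrow> real" where
  "reduction_bound x = x * exp (ln (4 * x * \<kappa>\<^sup>2) * (2 + ln x)) * (exp (ln (2 * x) / ln 2 * ln (1 + 2 * x * \<rho>)))\<^sup>2"

definition scale_bound :: "real \<Rightarrow> real" where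
  "scale_bound x = 144 * x ^ 4 * \<rho> ^ 8 * reduction_bound x ^ 3"

text \<open>Since \<open>hkz_growth\<close> bounds h k by h j only for j <= k, the hypothesis on h 0
  bounds all \<open>h i\<close> from above. From below they are bounded because h (n - 1), the value
  at the last basis vector, is a positive rational integer.\<close>

lemma norm_sum_reduced:
  assumes n: "n > 0"
    and a: "\<And>i j. i < n \<Longrightarrow> j < n \<Longrightarrow> a i j \<in> \<O> \<and> a i j = cnj (a j i)"
    and hkz: "hkz_basis n a f g h t" and h0: "h 0 \<le> 1" and s: "real s \<ge> scale_bound n"
  shows "norm_sum n (form_eval n (\<lambda>i j. of_nat s * a i j))"
proof -
  define e where "e = exp (ln (4 * real n * \<kappa>\<^sup>2) * (2 + ln n))"
  have n1: "real n \<ge> 1" using n by simp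
  have "1 \<le> \<kappa>\<^sup>2" using kappa_ge_1 by simp
  hence "1 \<le> 4 * real n * \<kappa>\<^sup>2" using mult_mono[OF n1, of 1 "\<kappa>\<^sup>2"] by simp
  hence e1: "e \<ge> 1" unfolding e_def using n1 by simp
  note aut = hkz_basisD(1)[OF hkz]
  have hpos: "h i > 0" if "i < n" for i using hkz_basisD(2)[OF hkz that] .
  have hup: "h i \<le> e" if "i < n" for i
  proof -
    have "h i \<le> h 0 * e" unfolding e_def using hkz_growth[OF hkz, of 0 i] that by simp
    also have "\<dots> \<le> 1 * e" using h0 e1 by (intro mult_right_mono) auto
    finally show ?thesis by simp
  qed
  define m where "m = n - 1"
  have m: "m < n" "n = Suc m" using n unfolding m_def by auto
  define x0 where "x0 = (\<lambda>j. if j = m then (1::complex) else 0)"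
  have "diag_eval n h t x0 = h m"
    unfolding diag_eval_def m(2) x0_def by (simp add: tri_unit_last)
  hence hm: "form_eval n a (f x0) = of_real (h m)" using hkz_basisD(4)[OF hkz, of x0] by simp
  have "form_eval n a (f x0) \<in> \<O>"
    by (rule form_eval_integral, rule a[THEN conjunct1], assumption+, rule aut_mem[OF aut])
       (simp_all add: x0_def O_0 O_1)
  hence "of_real (h m) \<in> (\<int> :: complex set)" unfolding hm by (intro O_real) auto
  then obtain z where "of_real (h m) = (of_int z :: complex)" by (auto elim: Ints_cases)
  hence z: "h m = of_int z" by (metis of_real_eq_iff of_real_of_int_eq)
  hence hm1: "h m \<ge> 1" using hpos[OF m(1)] by simp
  have hlow: "1 \<le> e * h i" if "i < n" for i
  proof -
    have "h m \<le> h i * e" unfolding e_def using that m by (intro hkz_growth[OF hkz]) auto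
    thus ?thesis using hm1 by (simp add: mult.commute)
  qed
  obtain k where k: "n \<le> 2 ^ k" "2 ^ k \<le> 2 * n" using ex_power_of_two_between[OF n] by blast
  define C where "C = (1 + real (2 * n) * \<rho>) ^ k"
  have base: "1 + real (2 * n) * \<rho> \<ge> 1" using rho_ge_1 by simp
  hence C1: "C \<ge> 1" unfolding C_def by (rule one_le_power)
  obtain u v where red: "reducing n t C u v"
    using ex_reducing[OF k, of t] hkz_basisD(3)[OF hkz] unfolding C_def by blast
  note aut2 = reducingD(1)[OF red]
  have autc: "aut n (\<lambda>x. f (u x)) (\<lambda>x. v (g x))" by (rule aut_comp[OF aut aut2])
  have "\<exists>a'. (\<forall>i<n. \<forall>j<n. a' i j \<in> \<O> \<and> a' i j = cnj (a' j i)) \<and> (\<forall>x. form_eval n a (f (u x)) = form_eval n a' x)"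
    by (rule form_eval_comp[OF O_semiring O_cnj a autD(1)[OF autc]])
  then obtain a' where a': "\<And>i j. i < n \<Longrightarrow> j < n \<Longrightarrow> a' i j \<in> \<O> \<and> a' i j = cnj (a' j i)"
    "\<And>x. form_eval n a (f (u x)) = form_eval n a' x" by blast
  have ev: "form_eval n a' x = of_real (\<Sum>i<n. h i * (cmod (tri t (u x) i))\<^sup>2)" for x
    unfolding a'(2)[symmetric] hkz_basisD(4)[OF hkz] diag_eval_def ..
  \<comment> \<open>One constant for both estimates. Unit vectors have images with entries at most
    C, so diagonal coefficients are at most n e C^2; the inverse bound gives |x i|^2 <= C^2 e f(x),
    summed over n coordinates.\<close>
  define R where "R = real n * e * C\<^sup>2"
  have C2: "1 \<le> C\<^sup>2" using C1 by (simp add: one_le_power)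
  have "1 \<le> real n * e" using mult_mono[OF n1 e1] n1 by simp
  hence R1: "R \<ge> 1" unfolding R_def using mult_mono[OF _ C2, of 1 "real n * e"] by simp
  have diag: "Re (a' j j) \<le> R" if j: "j < n" for j
  proof -
    define y where "y = (\<lambda>i. if i = j then (1::complex) else 0)"
    have "Re (a' j j) = Re (form_eval n a' y)" unfolding y_def form_eval_unit[OF j] by simp
    also have "\<dots> = (\<Sum>i<n. h i * (cmod (tri t (u y) i))\<^sup>2)" unfolding ev by simp
    also have "\<dots> \<le> (\<Sum>i<n. e * C\<^sup>2)"
    proof (rule sum_mono)
      fix i assume "i \<in> {..<n}"
      hence i: "i < n" by simp
      have "cmod (tri t (u y) i) \<le> C * 1" by (rule reducingD(2)[OF red _ i]) (simp add: y_def)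
      thus "h i * (cmod (tri t (u y) i))\<^sup>2 \<le> e * C\<^sup>2"
        using hup[OF i] e1 by (intro mult_mono power_mono) auto
    qed
    finally show ?thesis by (simp add: R_def)
  qed
  have lower: "(\<Sum>i<n. (cmod (x i))\<^sup>2) \<le> R * Re (form_eval n a' x)" for x
  proof -
    define M where "M = sqrt (e * (\<Sum>i<n. h i * (cmod (tri t (u x) i))\<^sup>2))"
    have hs: "0 \<le> (\<Sum>i<n. h i * (cmod (tri t (u x) i))\<^sup>2)"
      by (intro sum_nonneg mult_nonneg_nonneg) (auto intro: less_imp_le[OF hpos])
    have M2: "M\<^sup>2 = e * (\<Sum>i<n. h i * (cmod (tri t (u x) i))\<^sup>2)" unfolding M_def using hs e1 by simp
    have "cmod (tri t (u x) i) \<le> M" if i: "i < n" for i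
      unfolding M_def
    proof (rule real_le_rsqrt)
      have "1 * (cmod (tri t (u x) i))\<^sup>2 \<le> (e * h i) * (cmod (tri t (u x) i))\<^sup>2"
        by (intro mult_right_mono hlow i) auto
      also have "\<dots> = e * (h i * (cmod (tri t (u x) i))\<^sup>2)" by simp
      also have "\<dots> \<le> e * (\<Sum>i<n. h i * (cmod (tri t (u x) i))\<^sup>2)"
        using e1 i by (intro mult_left_mono member_le_sum) (auto intro!: mult_nonneg_nonneg less_imp_le[OF hpos])
      finally show "(cmod (tri t (u x) i))\<^sup>2 \<le> e * (\<Sum>i<n. h i * (cmod (tri t (u x) i))\<^sup>2)" by simp
    qed
    hence "cmod (x i) \<le> C * M" if "i < n" for i by (rule reducingD(3)[OF red _ that])
    hence "(\<Sum>i<n. (cmod (x i))\<^sup>2) \<le> (\<Sum>i<n. (C * M)\<^sup>2)" by (intro sum_mono power_mono) auto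
    also have "\<dots> = R * (\<Sum>i<n. h i * (cmod (tri t (u x) i))\<^sup>2)"
      by (simp add: power_mult_distrib M2 R_def)
    finally show ?thesis unfolding ev by simp
  qed
  have "R \<le> reduction_bound n"
  proof -
    have "real k * ln 2 = ln (2 ^ k)" by (simp add: ln_realpow)
    also have "\<dots> \<le> ln (2 * real n)"
    proof (rule ln_mono)
      have "real (2 ^ k) \<le> real (2 * n)" using k(2) by (simp only: of_nat_le_iff)
      thus "2 ^ k \<le> 2 * real n" by simp
    qed (use n1 in auto)
    finally have "real k \<le> ln (2 * real n) / ln 2" by (simp add: pos_le_divide_eq)
    hence "real k * ln (1 + 2 * real n * \<rho>) \<le> ln (2 * real n) / ln 2 * ln (1 + 2 * real n * \<rho>)"
      using base by (intro mult_right_mono) auto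
    moreover have "C = exp (real k * ln (1 + 2 * real n * \<rho>))"
    proof -
      have "1 + 2 * real n * \<rho> > 0" using rho_ge_1 by (intro add_pos_nonneg) auto
      thus ?thesis unfolding C_def by (simp add: exp_of_nat_mult)
    qed
    ultimately have "C \<le> exp (ln (2 * real n) / ln 2 * ln (1 + 2 * real n * \<rho>))" by simp
    hence "C\<^sup>2 \<le> (exp (ln (2 * real n) / ln 2 * ln (1 + 2 * real n * \<rho>)))\<^sup>2" using C1 by (intro power_mono) auto
    thus ?thesis unfolding R_def reduction_bound_def e_def[symmetric] using e1 by (intro mult_left_mono) auto
  qed
  hence "R ^ 3 \<le> reduction_bound n ^ 3" using R1 by (intro power_mono) auto
  hence "144 * real n ^ 4 * \<rho> ^ 8 * R ^ 3 \<le> scale_bound n"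
    unfolding scale_bound_def using rho_ge_1 by (intro mult_left_mono) auto
  hence sR: "real s \<ge> 144 * real n ^ 4 * \<rho> ^ 8 * R ^ 3" using s by linarith
  have ns: "norm_sum n (form_eval n (\<lambda>i j. of_nat s * a' i j))"
    by (rule norm_sum_if_bounded[OF n a'(1) R1 diag lower sR])
  have "norm_sum n (\<lambda>x. form_eval n (\<lambda>i j. of_nat s * a' i j) (v (g x)))"
    by (rule norm_sum_comp[OF ns autD(2)[OF autc]])
  moreover have "form_eval n (\<lambda>i j. of_nat s * a' i j) (v (g x)) = form_eval n (\<lambda>i j. of_nat s * a i j) x" for x
  proof -
    have "form_eval n a' (v (g x)) = form_eval n a (f (u (v (g x))))" by (rule a'(2)[symmetric])
    also have "\<dots> = form_eval n a x" by (rule form_eval_cong) (rule autD(3)[OF autc])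
    finally show ?thesis unfolding form_eval_scale by simp
  qed
  ultimately show ?thesis by simp
qed

text \<open>In the coordinates y = g x the first square is h 0 |y 0|^2. If h 0 > 1, subtracting the
  norm of the integral linear form y 0 only replaces h 0 by h 0 - 1, so the form stays positive
  definite and its trace drops by at least 1; s copies of that norm join the sum.\<close>

theorem norm_sum_scaled:
  assumes n: "n > 0" and s: "real s \<ge> scale_bound n"
    and "\<And>i j. i < n \<Longrightarrow> j < n \<Longrightarrow> a i j \<in> \<O> \<and> a i j = cnj (a j i)" and "pos_def_form E n a"
  shows "norm_sum n (form_eval n (\<lambda>i j. of_nat s * a i j))"
  using assms(3,4)
proof (induction "nat \<lfloor>\<Sum>i<n. Re (a i i)\<rfloor>" arbitrary: a rule: less_induct)
  case (less a)
  have herm: "hermitian_form E n a"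
    unfolding hermitian_form_def using less.prems(1) O_subset by blast
  obtain f g h t where hkz: "hkz_basis n a f g h t" using ex_hkz_basis[OF herm less.prems(2)] by blast
  note aut = hkz_basisD(1)[OF hkz]
  show ?case
  proof (cases "h 0 \<le> 1")
    case True
    show ?thesis by (rule norm_sum_reduced[OF n less.prems(1) hkz True s])
  next
    case False
    have lin: "linear_over \<O> n (\<lambda>x. g x 0)" by (rule autD(2)[OF aut n])
    then obtain c where c: "\<And>j. j < n \<Longrightarrow> c j \<in> \<O>" "\<And>x. g x 0 = (\<Sum>j<n. c j * x j)"
      unfolding linear_over_def fun_eq_iff by blast
    define a2 where "a2 i j = a i j - c i * cnj (c j)" for i j
    have gram: "form_eval n (\<lambda>i j. c i * cnj (c j)) x = g x 0 * cnj (g x 0)" for x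
      using form_eval_gram[where n = n and r = "1::nat" and B = "\<lambda>_. c" and x = x] unfolding c(2) by simp
    have ev2: "form_eval n a2 x = form_eval n a x - g x 0 * cnj (g x 0)" for x
      unfolding gram[symmetric] by (simp add: form_eval_def a2_def algebra_simps sum_subtractf)
    have a2: "a2 i j \<in> \<O> \<and> a2 i j = cnj (a2 j i)" if ij: "i < n" "j < n" for i j
    proof
      show "a2 i j \<in> \<O>" unfolding a2_def by (intro O_diff O_mult O_cnj c(1) ij less.prems(1)[OF ij, THEN conjunct1])
      have "a i j = cnj (a j i)" using less.prems(1)[OF ij] by blast
      hence "cnj (a j i) = a i j" by (rule sym)
      thus "a2 i j = cnj (a2 j i)" unfolding a2_def by (simp add: mult.commute)
    qed
    have pd2: "pos_def_form E n a2"
      unfolding pos_def_form_def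
    proof (intro ballI impI)
      fix x :: "nat \<Rightarrow> complex" assume x: "\<exists>i<n. x i \<noteq> 0"
      have "form_eval n a x = form_eval n a (f (g x))"
        by (rule form_eval_cong) (rule autD(3)[OF aut, symmetric])
      also have "\<dots> = of_real (diag_eval n h t (g x))" by (rule hkz_basisD(4)[OF hkz])
      finally have "form_eval n a2 x = of_real (diag_eval n h t (g x) - (cmod (g x 0))\<^sup>2)"
        unfolding ev2 by (simp only: of_real_diff complex_norm_square)
      moreover have "diag_eval n h t (g x) - (cmod (g x 0))\<^sup>2 = diag_eval n (h(0 := h 0 - 1)) t (g x)"
      proof -
        obtain m where m: "n = Suc m" using n by (cases n) auto
        show ?thesis unfolding diag_eval_def m sum.lessThan_Suc_shift
          by (simp add: tri_def algebra_simps)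
      qed
      moreover have "diag_eval n (h(0 := h 0 - 1)) t (g x) > 0"
        using False hkz_basisD(2)[OF hkz] aut_nonzero[OF aut_sym[OF aut] x] by (intro diag_eval_pos) auto
      ultimately show "Re (form_eval n a2 x) > 0" by simp
    qed
    have "\<exists>j<n. c j \<noteq> 0"
    proof (rule ccontr)
      assume "\<not> ?thesis"
      hence "g (f (\<lambda>_. 1)) 0 = 0" unfolding c(2) by (intro sum.neutral) auto
      thus False using autD(4)[OF aut n, of "\<lambda>_. 1"] by simp
    qed
    then obtain j where j: "j < n" "c j \<noteq> 0" by blast
    have "1 \<le> (cmod (c j))\<^sup>2" using O_norm[OF c(1)[OF j(1)] j(2)] by (simp add: one_le_power)
    also have "\<dots> \<le> (\<Sum>i<n. (cmod (c i))\<^sup>2)" using j(1) by (intro member_le_sum) auto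
    finally have c1: "1 \<le> (\<Sum>i<n. (cmod (c i))\<^sup>2)" .
    have "Re (a2 i i) = Re (a i i) - (cmod (c i))\<^sup>2" for i
    proof -
      have "a2 i i = a i i - of_real ((cmod (c i))\<^sup>2)" unfolding a2_def by (simp only: complex_norm_square)
      thus ?thesis by simp
    qed
    hence tr: "(\<Sum>i<n. Re (a2 i i)) = (\<Sum>i<n. Re (a i i)) - (\<Sum>i<n. (cmod (c i))\<^sup>2)"
      by (simp add: sum_subtractf)
    have "0 \<le> (\<Sum>i<n. Re (a2 i i))"
    proof (rule sum_nonneg)
      fix i assume "i \<in> {..<n}"
      hence i: "i < n" by simp
      have "Re (form_eval n a2 (\<lambda>j. if j = i then 1 else 0)) > 0"
        by (rule form_eval_vector_pos[OF pd2]) (use i E_0 E_1 in auto)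
      thus "0 \<le> Re (a2 i i)" unfolding form_eval_unit[OF i] by simp
    qed
    hence "nat \<lfloor>\<Sum>i<n. Re (a2 i i)\<rfloor> < nat \<lfloor>\<Sum>i<n. Re (a i i)\<rfloor>" using tr c1 by linarith
    from less.hyps[OF this a2 pd2]
    have "norm_sum n (form_eval n (\<lambda>i j. of_nat s * a2 i j))" .
    hence "norm_sum n (\<lambda>x. form_eval n (\<lambda>i j. of_nat s * a2 i j) x + of_nat s * (g x 0 * cnj (g x 0)))"
      by (intro norm_sum_add norm_sum_of_nat norm_sum_norm lin)
    moreover have "form_eval n (\<lambda>i j. of_nat s * a2 i j) x + of_nat s * (g x 0 * cnj (g x 0))
        = form_eval n (\<lambda>i j. of_nat s * a i j) x" for x
      unfolding form_eval_scale ev2 by (simp add: algebra_simps)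
    ultimately show ?thesis by simp
  qed
qed

end

section \<open>The lower bound\<close>

context integral_field
begin

lemma scale_bound_mono:
  assumes "1 \<le> x" "x \<le> y" shows "scale_bound x \<le> scale_bound y"
proof -
  have k: "\<kappa>\<^sup>2 \<ge> 1" using kappa_ge_1 by simp
  have "1 \<le> 4 * x * \<kappa>\<^sup>2" using mult_mono[of 1 "4 * x" 1 "\<kappa>\<^sup>2"] assms k by simp
  moreover have "4 * x * \<kappa>\<^sup>2 \<le> 4 * y * \<kappa>\<^sup>2" using assms by (intro mult_right_mono) auto
  ultimately have 1: "0 \<le> ln (4 * x * \<kappa>\<^sup>2)" "ln (4 * x * \<kappa>\<^sup>2) \<le> ln (4 * y * \<kappa>\<^sup>2)"
    by (simp_all add: ln_mono)
  have "0 \<le> 2 * x * \<rho>" "2 * x * \<rho> \<le> 2 * y * \<rho>" using assms rho_ge_1 by (auto intro: mult_right_mono)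
  hence "1 \<le> 1 + 2 * x * \<rho>" "1 + 2 * x * \<rho> \<le> 1 + 2 * y * \<rho>" by linarith+
  hence 2: "0 \<le> ln (1 + 2 * x * \<rho>)" "ln (1 + 2 * x * \<rho>) \<le> ln (1 + 2 * y * \<rho>)"
    by (intro ln_ge_zero ln_mono; linarith)+
  have 3: "0 \<le> ln x" "ln x \<le> ln y" "0 \<le> ln (2 * x) / ln 2" "ln (2 * x) / ln 2 \<le> ln (2 * y) / ln 2"
    using assms by (auto intro!: divide_right_mono)
  have 4: "ln (4 * x * \<kappa>\<^sup>2) * (2 + ln x) \<le> ln (4 * y * \<kappa>\<^sup>2) * (2 + ln y)"
    using 1 3(1,2) by (intro mult_mono) linarith+
  have 5: "ln (2 * x) / ln 2 * ln (1 + 2 * x * \<rho>) \<le> ln (2 * y) / ln 2 * ln (1 + 2 * y * \<rho>)"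
    using 2 3(3,4) by (intro mult_mono) linarith+
  have "reduction_bound x \<le> reduction_bound y"
    unfolding reduction_bound_def
    by (intro mult_mono power_mono assms iffD2[OF exp_le_cancel_iff 4] iffD2[OF exp_le_cancel_iff 5])
       (use assms in simp_all)
  moreover have "0 \<le> reduction_bound x" unfolding reduction_bound_def using assms by simp
  ultimately have "reduction_bound x \<le> reduction_bound y" "0 \<le> reduction_bound x" .
  thus ?thesis unfolding scale_bound_def using assms rho_ge_1 by (intro mult_mono power_mono) auto
qed

text \<open>For n below K (ln s)^2 the bound is exp (O((ln ln s)^2)), which is s^(o(1)).
  Monotonicity reduces all n to this one real endpoint.\<close>

lemma eventually_scale_bound_le:
  assumes "K \<ge> 0"
  shows "\<forall>\<^sub>F s in sequentially. \<forall>n\<ge>1. real n < K * (ln (real s))\<^sup>2 \<longrightarrow> scale_bound (real n) \<le> real s"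
proof (cases "K = 0")
  case True
  thus ?thesis by simp
next
  case False
  hence K: "K > 0" using assms by simp
  have pos: "\<rho> > 0" "\<kappa> > 0" using rho_ge_1 kappa_ge_1 by auto
  have "\<forall>\<^sub>F x in at_top. scale_bound (K * (ln x)\<^sup>2) \<le> x"
    unfolding scale_bound_def reduction_bound_def using K pos by real_asymp
  hence "\<forall>\<^sub>F s in sequentially. scale_bound (K * (ln (real s))\<^sup>2) \<le> real s"
    by (rule eventually_compose_filterlim[OF _ filterlim_real_sequentially])
  thus ?thesis
  proof eventually_elim
    case (elim s)
    show ?case
    proof (intro allI impI)
      fix n :: nat assume "n \<ge> 1" "real n < K * (ln (real s))\<^sup>2"
      hence "scale_bound (real n) \<le> scale_bound (K * (ln (real s))\<^sup>2)" by (intro scale_bound_mono) auto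
      thus "scale_bound (real n) \<le> real s" using elim by linarith
    qed
  qed
qed

lemma norm_sum_imp_sum_of_norms:
  assumes "\<O> = ring_of_integers E" "norm_sum n (form_eval n a)"
  shows "sum_of_norms E n a"
proof -
  obtain r :: nat and l where l: "\<And>k. k < r \<Longrightarrow> linear_over \<O> n (l k)"
    "\<And>x. form_eval n a x = (\<Sum>k<r. l k x * cnj (l k x))"
    using assms(2) unfolding norm_sum_def by blast
  have "\<forall>k. \<exists>c. k < r \<longrightarrow> (\<forall>j<n. c j \<in> \<O>) \<and> (\<forall>x. l k x = (\<Sum>j<n. c j * x j))"
    using l(1) unfolding linear_over_def fun_eq_iff by blast
  from choice[OF this] obtain c where c: "\<And>k j. k < r \<Longrightarrow> j < n \<Longrightarrow> c k j \<in> \<O>"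
    "\<And>k x. k < r \<Longrightarrow> l k x = (\<Sum>j<n. c k j * x j)" by blast
  have "form_eval n a x = (\<Sum>k<r. norm_linear_form n (c k) x)" for x
    unfolding l(2) norm_linear_form_def by (intro sum.cong[OF refl]) (simp add: c(2))
  thus ?thesis unfolding sum_of_norms_def using c(1) assms(1) by blast
qed

text \<open>If some dimension has a counterexample, the infimum is attained at some n. There
  \<open>norm_sum_scaled\<close> forces s < scale_bound n, hence n >= K (ln s)^2. Otherwise the
  infimum is infinite.\<close>

lemma phi_star_lower_bound:
  assumes O: "\<O> = ring_of_integers E" and K: "K \<ge> 0"
  shows "\<forall>\<^sub>F s in sequentially. ereal (K * (ln (real s))\<^sup>2) \<le> ereal_of_enat (phi_star E s)"
  using eventually_scale_bound_le[OF K]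
proof eventually_elim
  case (elim s)
  define S where "S = {enat n | n. n \<ge> 1 \<and> (\<exists>a. hermitian_form E n a \<and> integral_form E n a \<and> pos_def_form E n a \<and>
             \<not> sum_of_norms E n (\<lambda>i j. of_nat s * a i j))}"
  have phi: "phi_star E s = Inf S" unfolding phi_star_def S_def ..
  show ?case
  proof (cases "S = {}")
    case True
    thus ?thesis unfolding phi by (simp add: top_enat_def)
  next
    case False
    then obtain y where "y \<in> S" by blast
    hence "Inf S \<in> S" by (rule wellorder_InfI)
    then obtain n a where n: "Inf S = enat n" "n \<ge> 1" and a: "hermitian_form E n a" "integral_form E n a" "pos_def_form E n a"
      "\<not> sum_of_norms E n (\<lambda>i j. of_nat s * a i j)" unfolding S_def by auto
    have "\<not> scale_bound (real n) \<le> real s"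
    proof
      assume s: "scale_bound (real n) \<le> real s"
      have "norm_sum n (form_eval n (\<lambda>i j. of_nat s * a i j))"
      proof (rule norm_sum_scaled)
        show "n > 0" using n(2) by simp
        show "scale_bound (real n) \<le> real s" by (rule s)
        show "a i j \<in> \<O> \<and> a i j = cnj (a j i)" if "i < n" "j < n" for i j
          using a(1,2) that unfolding hermitian_form_def integral_form_def O by blast
      qed (rule a(3))
      thus False using norm_sum_imp_sum_of_norms[OF O] a(4) by blast
    qed
    hence "K * (ln (real s))\<^sup>2 \<le> real n" using elim n(2) by (meson not_le)
    thus ?thesis unfolding phi n(1) by simp
  qed
qed

end

section \<open>Rounding and counting cells; the rational instance\<close>

lemma truncate_toward_zero: "\<exists>m::int. \<bar>of_int m\<bar> \<le> \<bar>y::real\<bar> \<and> \<bar>y - of_int m\<bar> \<le> 1"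
proof (cases "y \<ge> 0")
  case True
  \<comment> \<open>Truncation toward zero keeps |m| <= |y|, so that the multiplicities in
    \<open>norm_sum_cross\<close> are at most |g|.\<close>
  have "0 \<le> real_of_int \<lfloor>y\<rfloor>" using True by simp
  hence "\<bar>of_int \<lfloor>y\<rfloor>\<bar> \<le> \<bar>y\<bar>" "\<bar>y - of_int \<lfloor>y\<rfloor>\<bar> \<le> 1" by linarith+
  thus ?thesis by blast
next
  case False
  have "real_of_int \<lceil>y\<rceil> \<le> 0" using False by simp
  hence "\<bar>of_int \<lceil>y\<rceil>\<bar> \<le> \<bar>y\<bar>" "\<bar>y - of_int \<lceil>y\<rceil>\<bar> \<le> 1" using False by linarith+
  thus ?thesis by blast
qed

lemma cell_index_bounds:
  assumes "0 < l" "l \<le> D" "\<bar>u\<bar> \<le> D" shows "\<lfloor>u / l\<rfloor> \<in> {- \<lfloor>D / l\<rfloor> - 1 .. \<lfloor>D / l\<rfloor>}"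
proof -
  have "(- D) / l \<le> u / l" "u / l \<le> D / l" using assms by (intro divide_right_mono; linarith)+
  hence "\<lfloor>- (D / l)\<rfloor> \<le> \<lfloor>u / l\<rfloor>" "\<lfloor>u / l\<rfloor> \<le> \<lfloor>D / l\<rfloor>" by (simp_all add: floor_mono)
  moreover have "- \<lfloor>D / l\<rfloor> - 1 \<le> \<lfloor>- (D / l)\<rfloor>"
    unfolding floor_minus using ceiling_diff_floor_le_1[of "D / l"] by linarith
  ultimately have "- \<lfloor>D / l\<rfloor> - 1 \<le> \<lfloor>u / l\<rfloor>" "\<lfloor>u / l\<rfloor> \<le> \<lfloor>D / l\<rfloor>" by linarith+
  thus ?thesis by simp
qed

text \<open>There are 2 * floor (D / l) + 2 indices, and D / l >= 1 absorbs the summand 2. This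
  produces the four in \<open>few_cells\<close>.\<close>

lemma card_cell_indices:
  assumes "0 < l" "l \<le> D" shows "real (card {- \<lfloor>D / l\<rfloor> - 1 .. \<lfloor>D / l\<rfloor>}) \<le> 4 * D / l"
proof -
  have "1 \<le> D / l" using assms by simp
  hence "1 \<le> \<lfloor>D / l\<rfloor>" by simp
  hence "real (card {- \<lfloor>D / l\<rfloor> - 1 .. \<lfloor>D / l\<rfloor>}) = 2 * real_of_int \<lfloor>D / l\<rfloor> + 2" by simp
  also have "\<dots> \<le> 4 * (D / l)" using \<open>1 \<le> D / l\<close> by linarith
  finally show ?thesis by simp
qed

lemma integral_field_Rats: "integral_field \<rat> \<int> 0 1 1"
proof
  show "subsemiring (\<rat> :: complex set)" "subsemiring (\<int> :: complex set)" by (auto simp: subsemiring_def)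
  show "(\<int> :: complex set) \<subseteq> \<rat>" by (rule Ints_subset_Rats)
  show "cnj x \<in> \<rat>" if "x \<in> \<rat>" for x using that by (simp add: cnj_Rats)
  show "cnj x \<in> \<int>" if "x \<in> \<int>" for x using that by (auto elim: Ints_cases)
  show "\<exists>q>0. of_nat q * x \<in> \<int>" if "x \<in> \<rat>" for x :: complex
  proof -
    obtain a b where ab: "b > 0" "x = of_int a / of_int b" using \<open>x \<in> \<rat>\<close> by (auto elim: Rats_cases')
    have "(of_nat (nat b) :: complex) = of_int b" using ab(1) by simp
    hence "of_nat (nat b) * x = of_int a" using ab by (simp add: field_simps)
    thus ?thesis using ab(1) by (intro exI[of _ "nat b"]) simp
  qed
  show "\<exists>d\<in>\<int>. \<exists>p\<in>\<int>. \<exists>q\<in>\<int>. \<exists>u\<in>\<int>. \<exists>v\<in>\<int>. a = d * p \<and> b = d * q \<and> u * p + v * q = 1"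
    if ab: "a \<in> \<int>" "b \<in> \<int>" for a b :: complex
  proof -
    obtain i j where ij: "a = of_int i" "b = of_int j" using ab by (auto elim!: Ints_cases)
    show ?thesis
    proof (cases "i = 0 \<and> j = 0")
      case True
      thus ?thesis by (intro bexI[of _ 0] bexI[of _ 1]) (auto simp: ij intro!: bexI[of _ 0] bexI[of _ 1])
    next
      case False
      define d where "d = gcd i j"
      have d0: "d \<noteq> 0" using False by (simp add: d_def)
      obtain u v where uv: "u * i + v * j = d" using bezout_int[of i j] unfolding d_def by blast
      obtain p q where pq: "i = d * p" "j = d * q" unfolding d_def by (meson dvdE gcd_dvd1 gcd_dvd2)
      have "d * (u * p + v * q) = d * 1" using uv pq by (simp add: algebra_simps)
      hence "u * p + v * q = 1" using d0 by (simp only: mult_cancel_left) simp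
      hence "of_int u * of_int p + of_int v * of_int q = (1::complex)" by (metis of_int_1 of_int_add of_int_mult)
      moreover have "a = of_int d * of_int p" "b = of_int d * of_int q" unfolding ij pq by simp_all
      ultimately show ?thesis
        by (intro bexI[of _ "of_int d"] bexI[of _ "of_int p"] bexI[of _ "of_int q"] bexI[of _ "of_int u"] bexI[of _ "of_int v"]) auto
    qed
  qed
  show "\<exists>m m'. \<bar>of_int m\<bar> \<le> cmod (of_real r * x) \<and> \<bar>of_int m'\<bar> \<le> cmod (of_real r * x) \<and>
      cmod (of_real r * x - (of_int m + of_int m' * 0)) \<le> 1" if "x \<in> \<rat>" for r :: real and x
  proof -
    obtain a b where ab: "x = of_int a / of_int b" using \<open>x \<in> \<rat>\<close> by (auto elim: Rats_cases')
    define y where "y = r * (of_int a / of_int b)"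
    have y: "of_real r * x = of_real y" by (simp add: y_def ab)
    obtain m :: int where m: "\<bar>of_int m\<bar> \<le> \<bar>y\<bar>" "\<bar>y - of_int m\<bar> \<le> 1" using truncate_toward_zero by blast
    have "cmod (of_real y - of_int m) = \<bar>y - of_int m\<bar>"
      by (metis norm_of_real of_real_diff of_real_of_int_eq)
    thus ?thesis unfolding y using m by (intro exI[of _ m] exI[of _ 0]) simp
  qed
  show "\<exists>Z\<subseteq>\<int>. finite Z \<and> card Z = (2 * L + 1) ^ 1 \<and> (\<forall>z\<in>Z. cmod z \<le> 2 * 1 * real L)" for L
    by (intro exI[of _ "of_int ` {- int L .. int L}"]) (auto simp: card_image inj_on_def)
  show "finite ((\<lambda>z. (\<lfloor>Re z / l\<rfloor>, \<lfloor>Im z / l\<rfloor>)) ` {z \<in> \<rat>. cmod z \<le> D}) \<and>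
      real (card ((\<lambda>z. (\<lfloor>Re z / l\<rfloor>, \<lfloor>Im z / l\<rfloor>)) ` {z \<in> \<rat>. cmod z \<le> D})) \<le> (4 * D / l) ^ 1"
    if l: "0 < l" "l \<le> D" for l D :: real
  proof -
    let ?J = "{- \<lfloor>D / l\<rfloor> - 1 .. \<lfloor>D / l\<rfloor>}"
    \<comment> \<open>Rational points lie on the real axis, so a single row of cells is met and the
      exponent is 1.\<close>
    have sub: "(\<lambda>z. (\<lfloor>Re z / l\<rfloor>, \<lfloor>Im z / l\<rfloor>)) ` {z \<in> \<rat>. cmod z \<le> D} \<subseteq> ?J \<times> {0}"
    proof
      fix c assume "c \<in> (\<lambda>z. (\<lfloor>Re z / l\<rfloor>, \<lfloor>Im z / l\<rfloor>)) ` {z \<in> \<rat>. cmod z \<le> D}"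
      then obtain z where z: "z \<in> \<rat>" "cmod z \<le> D" "c = (\<lfloor>Re z / l\<rfloor>, \<lfloor>Im z / l\<rfloor>)" by blast
      have "Im z = 0" using cnj_Rats[OF z(1)] by (simp add: complex_eq_iff)
      moreover have "\<bar>Re z\<bar> \<le> D" using abs_Re_le_cmod[of z] z(2) by linarith
      ultimately show "c \<in> ?J \<times> {0}" unfolding z(3) using cell_index_bounds[OF l, of "Re z"] by simp
    qed
    have "real (card ((\<lambda>z. (\<lfloor>Re z / l\<rfloor>, \<lfloor>Im z / l\<rfloor>)) ` {z \<in> \<rat>. cmod z \<le> D})) \<le> real (card (?J \<times> {0::int}))"
      unfolding of_nat_le_iff by (rule card_mono[OF _ sub]) simp
    also have "\<dots> \<le> (4 * D / l) ^ 1" using card_cell_indices[OF l] by (simp add: card_cartesian_product)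
    finally show ?thesis using finite_subset[OF sub] by simp
  qed
qed auto

section \<open>Bezout identities from class number one; the imaginary quadratic instance\<close>

context imag_quad
begin

abbreviation "OE \<equiv> ring_of_integers E"

lemma OE_closed: "0 \<in> OE" "1 \<in> OE" "x \<in> OE \<Longrightarrow> y \<in> OE \<Longrightarrow> x + y \<in> OE" "x \<in> OE \<Longrightarrow> y \<in> OE \<Longrightarrow> x * y \<in> OE"
  "x \<in> OE \<Longrightarrow> - x \<in> OE" "x \<in> OE \<Longrightarrow> cnj x \<in> OE"
proof -
  show "0 \<in> OE" "1 \<in> OE" using order_Ints[of 0] order_Ints[of 1] order_subset by auto
  show "x \<in> OE \<Longrightarrow> y \<in> OE \<Longrightarrow> x + y \<in> OE" unfolding integers_iff by (simp add: E_add bounded_powers_add)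
  show "x \<in> OE \<Longrightarrow> y \<in> OE \<Longrightarrow> x * y \<in> OE" unfolding integers_iff by (simp add: E_mult bounded_powers_mult)
  show "x \<in> OE \<Longrightarrow> - x \<in> OE" unfolding ring_of_integers_def by (simp add: E_minus)
  show "x \<in> OE \<Longrightarrow> cnj x \<in> OE" unfolding ring_of_integers_def by (simp add: E_cnj)
qed

lemma ring_integer_ring: "ring (integer_ring E)"
proof (rule ringI)
  show "abelian_group (integer_ring E)"
  proof (rule abelian_groupI)
    fix x assume "x \<in> carrier (integer_ring E)"
    thus "\<exists>y\<in>carrier (integer_ring E). y \<oplus>\<^bsub>integer_ring E\<^esub> x = \<zero>\<^bsub>integer_ring E\<^esub>"
      by (intro bexI[of _ "- x"]) (simp_all add: integer_ring_def OE_closed)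
  qed (simp_all add: integer_ring_def OE_closed ac_simps)
  show "Group.monoid (integer_ring E)"
    by (rule Group.monoidI) (simp_all add: integer_ring_def OE_closed ac_simps)
qed (simp_all add: integer_ring_def algebra_simps)

lemma integer_ring_simps: "carrier (integer_ring E) = OE" "x \<otimes>\<^bsub>integer_ring E\<^esub> y = x * y"
  "x \<oplus>\<^bsub>integer_ring E\<^esub> y = x + y" "\<zero>\<^bsub>integer_ring E\<^esub> = 0"
  by (auto simp: integer_ring_def)

text \<open>The ideal generated by a and b lies in the only class, that of the whole ring, so
  \<alpha> I = \<beta> O for nonzero \<alpha> and \<beta>. Then \<beta> = \<alpha> g with g in I,
  and g generates I.\<close>

lemma bezout_integers:
  assumes cn: "class_number E = 1" and ab: "a \<in> OE" "b \<in> OE"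
  shows "\<exists>d\<in>OE. \<exists>p\<in>OE. \<exists>q\<in>OE. \<exists>u\<in>OE. \<exists>v\<in>OE. a = d * p \<and> b = d * q \<and> u * p + v * q = 1"
proof (cases "a = 0 \<and> b = 0")
  case True
  show ?thesis
    by (rule bexI[of _ 0], rule bexI[of _ 1], rule bexI[of _ 0], rule bexI[of _ 1], rule bexI[of _ 0])
       (use True in \<open>simp_all add: OE_closed\<close>)
next
  case False
  interpret R: ring "integer_ring E" by (rule ring_integer_ring)
  define I where "I = {x * a + y * b | x y. x \<in> OE \<and> y \<in> OE}"
  have I_I: "x * a + y * b \<in> I" if "x \<in> OE" "y \<in> OE" for x y using that unfolding I_def by blast
  have aI: "a \<in> I" and bI: "b \<in> I" using I_I[OF OE_closed(2,1)] I_I[OF OE_closed(1,2)] by auto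
  have mult: "c * z \<in> I" if c: "c \<in> OE" and z: "z \<in> I" for c z
  proof -
    obtain x y where xy: "x \<in> OE" "y \<in> OE" "z = x * a + y * b" using z unfolding I_def by blast
    have "c * z = (c * x) * a + (c * y) * b" by (simp add: xy algebra_simps)
    thus ?thesis using I_I[OF OE_closed(4)[OF c xy(1)] OE_closed(4)[OF c xy(2)]] by simp
  qed
  have sub: "I \<subseteq> OE"
  proof
    fix z assume "z \<in> I"
    then obtain x y where xy: "x \<in> OE" "y \<in> OE" "z = x * a + y * b" unfolding I_def by blast
    show "z \<in> OE" unfolding xy(3) by (intro OE_closed(3,4) xy ab)
  qed
  have "ideal I (integer_ring E)"
  proof (rule idealI[OF ring_integer_ring])
    show "subgroup I (add_monoid (integer_ring E))"
    proof
      show "I \<subseteq> carrier (add_monoid (integer_ring E))" using sub by (simp add: integer_ring_simps)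
      show "x \<otimes>\<^bsub>add_monoid (integer_ring E)\<^esub> y \<in> I" if x: "x \<in> I" and y: "y \<in> I" for x y
      proof -
        obtain x1 y1 where 1: "x1 \<in> OE" "y1 \<in> OE" "x = x1 * a + y1 * b" using x unfolding I_def by blast
        obtain x2 y2 where 2: "x2 \<in> OE" "y2 \<in> OE" "y = x2 * a + y2 * b" using y unfolding I_def by blast
        have "x + y = (x1 + x2) * a + (y1 + y2) * b" by (simp add: 1 2 algebra_simps)
        thus ?thesis using I_I[OF OE_closed(3)[OF 1(1) 2(1)] OE_closed(3)[OF 1(2) 2(2)]] by (simp add: integer_ring_simps)
      qed
      show "\<one>\<^bsub>add_monoid (integer_ring E)\<^esub> \<in> I" using I_I[OF OE_closed(1,1)] by (simp add: integer_ring_simps)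
      show "inv\<^bsub>add_monoid (integer_ring E)\<^esub> x \<in> I" if x: "x \<in> I" for x
      proof -
        have "x \<in> OE" using x sub by blast
        hence "\<ominus>\<^bsub>integer_ring E\<^esub> x = - x"
          by (intro R.minus_equality) (auto simp: integer_ring_simps OE_closed)
        moreover have "(- 1) * x \<in> I" by (rule mult[OF OE_closed(5)[OF OE_closed(2)] x])
        ultimately show ?thesis by (simp add: a_inv_def)
      qed
    qed
    show "x \<otimes>\<^bsub>integer_ring E\<^esub> z \<in> I" "z \<otimes>\<^bsub>integer_ring E\<^esub> x \<in> I"
      if "z \<in> I" "x \<in> carrier (integer_ring E)" for z x
      using mult[of x z] that by (simp_all add: integer_ring_simps mult.commute)
  qed
  moreover have "I \<noteq> {0}"
  proof
    assume I0: "I = {0}"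
    show False using aI bI False unfolding I0 by simp
  qed
  ultimately have IN: "I \<in> nonzero_ideals E" unfolding nonzero_ideals_def by blast
  have "ideal OE (integer_ring E)" using R.oneideal by (simp only: integer_ring_simps)
  moreover have "OE \<noteq> {0}"
  proof
    assume "OE = {0}"
    thus False using OE_closed(2) by simp
  qed
  ultimately have ON: "OE \<in> nonzero_ideals E" unfolding nonzero_ideals_def by blast
  have ref: "(OE, OE) \<in> ideal_equivalence E"
  proof -
    have "(1::complex) \<in> OE - {0}" using OE_closed(2) by simp
    thus ?thesis unfolding ideal_equivalence_def using ON by blast
  qed
  from cn obtain Y where Y: "nonzero_ideals E // ideal_equivalence E = {Y}"
    unfolding class_number_def by (auto simp: card_1_singleton_iff)
  \<comment> \<open>Both images are the single class Y. The ring is related to itself, so it lies in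
    Y and is therefore related to I.\<close>
  have "ideal_equivalence E `` {I} = Y" "ideal_equivalence E `` {OE} = Y"
    using quotientI[OF IN, of "ideal_equivalence E"] quotientI[OF ON, of "ideal_equivalence E"] unfolding Y by auto
  hence "(I, OE) \<in> ideal_equivalence E" using ref by blast
  then obtain \<alpha> \<beta> where al: "\<alpha> \<in> OE" "\<alpha> \<noteq> 0" "\<beta> \<in> OE" "\<beta> \<noteq> 0" "(*) \<alpha> ` I = (*) \<beta> ` OE"
    unfolding ideal_equivalence_def by blast
  have "\<beta> * 1 \<in> (*) \<beta> ` OE" using OE_closed(2) by blast
  then obtain g where g: "g \<in> I" "\<beta> = \<alpha> * g" unfolding al(5)[symmetric] by auto
  have g0: "g \<noteq> 0" using al(4) g(2) by auto
  have gen: "\<exists>c\<in>OE. z = g * c" if z: "z \<in> I" for z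
  proof -
    have "\<alpha> * z \<in> (*) \<beta> ` OE" using z al(5) by blast
    then obtain c where "c \<in> OE" "\<alpha> * z = \<alpha> * (g * c)" unfolding g(2) by (auto simp: mult.assoc)
    thus ?thesis using al(2) by auto
  qed
  obtain p q where pq: "p \<in> OE" "a = g * p" "q \<in> OE" "b = g * q" using gen[OF aI] gen[OF bI] by blast
  obtain u v where uv: "u \<in> OE" "v \<in> OE" "g = u * a + v * b" using g(1) unfolding I_def by blast
  have "g * (u * p + v * q) = g * 1" using uv(3) unfolding pq(2,4) by (simp add: algebra_simps)
  hence "u * p + v * q = 1" using g0 by (simp only: mult_cancel_left) simp
  moreover have "g \<in> OE" using g(1) sub by blast
  ultimately show ?thesis using pq uv(1,2) by (intro bexI[of _ g] bexI[of _ p] bexI[of _ q] bexI[of _ u] bexI[of _ v] conjI)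
qed

text \<open>Truncating the coordinates with respect to 1 and w errs by at most 1 in the real part
  and sqrt d in the imaginary part, whence the value of \<rho>.\<close>

lemma integral_field_imag_quad:
  assumes "class_number E = 1"
  shows "integral_field E OE w (1 + sqrt d) 2"
proof
  have d1: "sqrt d \<ge> 1" using d_pos by simp
  have cw: "cmod w = sqrt d" unfolding w_def by (simp add: norm_mult)
  show "subsemiring E" using E_0 E_1 E_add E_mult by (auto simp: subsemiring_def)
  show "subsemiring OE" using OE_closed by (auto simp: subsemiring_def)
  show "OE \<subseteq> E" unfolding ring_of_integers_def by blast
  show "x \<in> \<int>" if "x \<in> OE" "Im x = 0" for x
    using that unfolding integers_iff by (intro bounded_powers_real) auto
  show "\<exists>q>0. of_nat q * x \<in> OE" if "x \<in> E" for x using ex_denominator_order[OF that] order_subset by blast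
  show "\<exists>d\<in>OE. \<exists>p\<in>OE. \<exists>q\<in>OE. \<exists>u\<in>OE. \<exists>v\<in>OE. a = d * p \<and> b = d * q \<and> u * p + v * q = 1"
    if "a \<in> OE" "b \<in> OE" for a b by (rule bezout_integers[OF assms that])
  show "w \<in> OE" by (rule w_integer)
  show "cmod w \<le> 1 + sqrt d" unfolding cw by simp
  show "\<exists>m m'. \<bar>of_int m\<bar> \<le> cmod (of_real r * x) \<and> \<bar>of_int m'\<bar> \<le> cmod (of_real r * x) \<and>
      cmod (of_real r * x - (of_int m + of_int m' * w)) \<le> 1 + sqrt d" for r x
  proof -
    define z where "z = of_real r * x"
    obtain m :: int where m: "\<bar>of_int m\<bar> \<le> \<bar>Re z\<bar>" "\<bar>Re z - of_int m\<bar> \<le> 1" using truncate_toward_zero by blast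
    obtain m' :: int where m': "\<bar>of_int m'\<bar> \<le> \<bar>Im z / sqrt d\<bar>" "\<bar>Im z / sqrt d - of_int m'\<bar> \<le> 1"
      using truncate_toward_zero by blast
    have "\<bar>Im z / sqrt d\<bar> \<le> \<bar>Im z\<bar> / 1" unfolding abs_divide using d1 by (intro divide_left_mono) auto
    hence 2: "\<bar>of_int m'\<bar> \<le> cmod z" using m'(1) abs_Im_le_cmod[of z] by simp
    have 1: "\<bar>of_int m\<bar> \<le> cmod z" using m(1) abs_Re_le_cmod[of z] by simp
    have "cmod (z - (of_int m + of_int m' * w)) \<le> \<bar>Re z - of_int m\<bar> + \<bar>Im z - of_int m' * sqrt d\<bar>"
      using cmod_le[of "z - (of_int m + of_int m' * w)"] by (simp add: w_def)
    also have "Im z - of_int m' * sqrt d = sqrt d * (Im z / sqrt d - of_int m')" using d_pos by (simp add: algebra_simps)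
    also have "\<bar>sqrt d * (Im z / sqrt d - of_int m')\<bar> \<le> sqrt d * 1"
      unfolding abs_mult using m'(2) by (intro mult_mono) auto
    finally have "cmod (z - (of_int m + of_int m' * w)) \<le> 1 + sqrt d" using m(2) by simp
    thus ?thesis using 1 2 unfolding z_def by blast
  qed
  show "\<exists>Z\<subseteq>OE. finite Z \<and> card Z = (2 * L + 1) ^ 2 \<and> (\<forall>z\<in>Z. cmod z \<le> 2 * (1 + sqrt d) * real L)" for L
  proof -
    define J where "J = {- int L .. int L}"
    define e where "e = (\<lambda>(a, b). of_int a + of_int b * w)"
    have "inj_on e (J \<times> J)"
    proof (rule inj_onI)
      fix p q assume "e p = e q"
      hence "Re (e p) = Re (e q)" "Im (e p) = Im (e q)" by simp_all
      thus "p = q" using d_pos unfolding e_def w_def by (cases p; cases q) auto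
    qed
    hence "card (e ` (J \<times> J)) = card J ^ 2"
      by (simp add: card_image card_cartesian_product power2_eq_square)
    moreover have "card J = 2 * L + 1" unfolding J_def card_atLeastAtMost_int by linarith
    ultimately have "card (e ` (J \<times> J)) = (2 * L + 1) ^ 2" by (simp only:)
    moreover have "e ` (J \<times> J) \<subseteq> OE" using order_I order_subset unfolding e_def by auto
    moreover have "cmod z \<le> 2 * (1 + sqrt d) * real L" if z: "z \<in> e ` (J \<times> J)" for z
    proof -
      obtain a b where ab: "a \<in> J" "b \<in> J" "z = of_int a + of_int b * w" using z unfolding e_def by auto
      have "\<bar>real_of_int a\<bar> \<le> real L" "\<bar>real_of_int b\<bar> \<le> real L" using ab(1,2) unfolding J_def by auto
      hence "\<bar>real_of_int a\<bar> + \<bar>real_of_int b\<bar> * sqrt d \<le> real L + real L * sqrt d"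
        by (intro add_mono mult_right_mono) auto
      moreover have "cmod z \<le> \<bar>real_of_int a\<bar> + \<bar>real_of_int b\<bar> * sqrt d"
        unfolding ab(3) using norm_triangle_ineq[of "of_int a" "of_int b * w"] by (simp add: norm_mult cw)
      moreover have "real L + real L * sqrt d \<le> 2 * (1 + sqrt d) * real L" by (simp add: algebra_simps)
      ultimately show ?thesis by linarith
    qed
    ultimately show ?thesis by (intro exI[of _ "e ` (J \<times> J)"]) (simp add: J_def)
  qed
  show "finite ((\<lambda>z. (\<lfloor>Re z / l\<rfloor>, \<lfloor>Im z / l\<rfloor>)) ` {z \<in> E. cmod z \<le> D}) \<and>
      real (card ((\<lambda>z. (\<lfloor>Re z / l\<rfloor>, \<lfloor>Im z / l\<rfloor>)) ` {z \<in> E. cmod z \<le> D})) \<le> (4 * D / l) ^ 2"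
    if l: "0 < l" "l \<le> D" for l D :: real
  proof -
    let ?J = "{- \<lfloor>D / l\<rfloor> - 1 .. \<lfloor>D / l\<rfloor>}"
    have sub: "(\<lambda>z. (\<lfloor>Re z / l\<rfloor>, \<lfloor>Im z / l\<rfloor>)) ` {z \<in> E. cmod z \<le> D} \<subseteq> ?J \<times> ?J"
    proof
      fix c assume "c \<in> (\<lambda>z. (\<lfloor>Re z / l\<rfloor>, \<lfloor>Im z / l\<rfloor>)) ` {z \<in> E. cmod z \<le> D}"
      then obtain z where z: "cmod z \<le> D" "c = (\<lfloor>Re z / l\<rfloor>, \<lfloor>Im z / l\<rfloor>)" by blast
      have "\<bar>Re z\<bar> \<le> D" "\<bar>Im z\<bar> \<le> D" using abs_Re_le_cmod[of z] abs_Im_le_cmod[of z] z(1) by linarith+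
      from this[THEN cell_index_bounds[OF l]] show "c \<in> ?J \<times> ?J" unfolding z(2) by blast
    qed
    have "real (card ((\<lambda>z. (\<lfloor>Re z / l\<rfloor>, \<lfloor>Im z / l\<rfloor>)) ` {z \<in> E. cmod z \<le> D})) \<le> real (card (?J \<times> ?J))"
      unfolding of_nat_le_iff by (rule card_mono[OF _ sub]) simp
    also have "\<dots> = (real (card ?J))\<^sup>2" by (simp only: card_cartesian_product of_nat_mult power2_eq_square)
    also have "\<dots> \<le> (4 * D / l)\<^sup>2" using card_cell_indices[OF l] by (intro power_mono) auto
    finally show ?thesis using finite_subset[OF sub] by simp
  qed
qed (simp_all add: E_minus E_inverse E_cnj OE_closed)

end

theorem theorem6p1:
  fixes E :: "complex set"
  assumes "E = \<rat> \<or> (imaginary_quadratic_field E \<and> class_number E = 1)"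
  shows "\<exists>\<epsilon> :: nat \<Rightarrow> real. \<epsilon> \<in> o(\<lambda>_. 1) \<and>
    (\<forall>\<^sub>F s in at_top.
       ereal_of_enat (phi_star E s) \<ge>
         ereal ((ln (real s) / ((4 + 4 * sqrt 2) * sqrt (beta E)))\<^sup>2 * (1 + \<epsilon> s)))"
proof -
  \<comment> \<open>The constant of the claim is a square, hence nonnegative, and
    \<open>phi_star_lower_bound\<close> holds for every such K. The error term can therefore be
    taken to be zero.\<close>
  define K where "K = (1 / ((4 + 4 * sqrt 2) * sqrt (beta E)))\<^sup>2"
  have "\<exists>w \<rho> \<delta>. integral_field E (ring_of_integers E) w \<rho> \<delta>"
    using assms
  proof
    assume "E = \<rat>"
    thus ?thesis using integral_field_Rats ring_of_integers_Rats by metis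
  next
    assume E: "imaginary_quadratic_field E \<and> class_number E = 1"
    then obtain d :: nat where d: "squarefree d"
      "E = {of_rat a + of_rat b * (\<i> * of_real (sqrt (real d))) | a b. True}"
      unfolding imaginary_quadratic_field_def by blast
    have "d > 0" using d(1) by (metis gr0I not_squarefree_0)
    interpret imag_quad d E "\<i> * of_real (sqrt (real d))"
      by unfold_locales (rule \<open>d > 0\<close>, rule refl, rule d(2))
    show ?thesis using integral_field_imag_quad E by blast
  qed
  then obtain w \<rho> \<delta> where "integral_field E (ring_of_integers E) w \<rho> \<delta>" by blast
  then interpret integral_field E "ring_of_integers E" w \<rho> \<delta> .
  have "\<forall>\<^sub>F s in sequentially. ereal (K * (ln (real s))\<^sup>2) \<le> ereal_of_enat (phi_star E s)"
    by (rule phi_star_lower_bound) (auto simp: K_def)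
  moreover have "K * (ln (real s))\<^sup>2 = (ln (real s) / ((4 + 4 * sqrt 2) * sqrt (beta E)))\<^sup>2 * (1 + 0)" for s
    by (simp add: K_def power_divide power_mult_distrib)
  ultimately show ?thesis
    by (intro exI[of _ "\<lambda>_. 0"]) simp
qed

end
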